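(* Let $(l,Q,\omega,\varphi)$ be regular data (see context). Then: (i) $g(s)=\bar\varsigma s$ for every $s\in[0,\inf\Phi]$; in particular, $\inf\Phi=0$ if $\vartheta(1^-)=\infty$; (ii) $g(s)=\Big(\inf_{m\in\Phi^{-1}(s)}\mathfrak G_s(m)\Big)\wedge\Big(\liminf_{m\to0^+}\mathfrak G_s(m)\Big)\wedge\Big(\liminf_{m\to1^-}\mathfrak G_s(m)\Big)$ for every $s\in(\inf\Phi,\sup\Phi)$; (iii) $g(s)=2\Psi(1)$ for every $s\in[\sup\Phi,\infty)$. In particular, $s_{\mathrm{frac}}\in[\inf\Phi,\sup\Phi]$.
   Context: Convention: $0\cdot\infty=0$. Regular data: $l,Q\in C^0([0,1],[0,\infty))$ with $l(1)=1$, $l^{-1}(\{0\})=Q^{-1}(\{0\})=\{0\}$, $Q$ increasing in a right neighbourhood of $0$, and $t\mapsto (l(t)/Q(1-t))^{1/2}$ (on $[0,1)$) increasing in a right neighbourhood of $0$; $\omega\in C^0([0,1],[0,\infty))$ with $\omega^{-1}(\{0\})=\{0\}$ such that the limit $\bar\varsigma:=\lim_{t\to0^+}(\omega(t)/Q(t))^{1/2}\in[0,\infty]$ exists; $\varphi\in C^0([0,\infty),[0,\infty))$ non-decreasing with $\lim_{t\to\infty}\varphi(t)\in(0,\infty)$, $\varphi^{-1}(0)=\{0\}$, right-differentiable at $0$ with $\varphi'(0^+)=1$; and the function $\vartheta(t):=\frac{\omega(1-t)}{Q(1-t)}l(t)$, $t\in[0,1)$, belongs to $C^1((0,1))$ with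 $\vartheta'>0$ on $(0,1)$. Then $\vartheta(0)=0$ and $\vartheta(1^-)=\bar\varsigma^2\in(0,\infty]$; set $\vartheta(1):=\vartheta(1^-)$. $\Psi(t):=\int_0^t\omega^{1/2}(1-\tau)\,d\tau$. For $s\ge0$, $$g(s):=\inf\int_0^1\big(\vartheta(v)|u'|^2+\omega(1-v)|v'|^2\big)^{1/2}dx$$ over $u,v\in H^1((0,1))$ with $u(0)=0$, $u(1)=s$, $0\le v\le1$, $v(0)=v(1)=1$. $s_{\mathrm{frac}}:=\sup\{s\in[0,\infty): g(s)<2\Psi(1)\}\in(0,\infty]$. For $m\in(0,1)$, $t\in[2m-1,1]$: $\vartheta_m(t):=\vartheta(m+|t-m|)$, $\omega_m(1-t):=\omega(1-m-|t-m|)$. For $s>0$ and $w\in BV((2m-1,1))$ let $$sc^-G_{m,s}(w):=\int_{2m-1}^1\big(\vartheta_m(t)|w'|^2+\omega_m(1-t)\big)^{1/2}dt+\int_{2m-1}^1\vartheta_m^{1/2}\,d|D^sw|+\vartheta^{1/2}(1^-)|w((2m-1)^+)|+\vartheta^{1/2}(1^-)|w(1^-)-s|,$$ and $+\infty$ on $L^1\setminus BV$. $\mathfrak G_s(m):=\min_{L^1((2m-1,1))}sc^-G_{m,s}$ (the minimum is attained, at a unique function). $\Phi(x):=2\int_x^1\Big(\frac{\vartheta(x)\,\omega(1-t)}{\vartheta(t)(\vartheta(t)-\vartheta(x))}\Big)^{1/2}dt$ for $x\in(0,1)$. *)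

theory Defs
  imports "HOL-Analysis.Analysis"
begin

section \<open>Sobolev and BV functions on an open interval\<close>

text \<open>Functions on \<open>(a,b)\<close> are represented by total functions on the reals whose values
  outside the interval (or, where endpoint values matter, outside its closure) are irrelevant.
  Elements of \<open>L\<^sup>1\<close>, \<open>L\<^sup>2\<close> and \<open>BV\<close> are represented by arbitrary Lebesgue measurable
  representatives.\<close>

definition test_function :: "real \<Rightarrow> real \<Rightarrow> (real \<Rightarrow> real) \<Rightarrow> bool" where
  "test_function a b \<eta> \<longleftrightarrow> \<eta> C1_differentiable_on UNIV \<and>
     (\<exists>K. compact K \<and> K \<subseteq> {a<..<b} \<and> (\<forall>x. x \<notin> K \<longrightarrow> \<eta> x = 0))"

definition L2_on :: "real \<Rightarrow> real \<Rightarrow> (real \<Rightarrow> real) \<Rightarrow> bool" where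
  "L2_on a b f \<longleftrightarrow> set_borel_measurable lebesgue {a<..<b} f \<and>
     (\<lambda>x. (f x)\<^sup>2) absolutely_integrable_on {a<..<b}"

definition has_weak_L2_deriv :: "real \<Rightarrow> real \<Rightarrow> (real \<Rightarrow> real) \<Rightarrow> (real \<Rightarrow> real) \<Rightarrow> bool" where
  "has_weak_L2_deriv a b f f' \<longleftrightarrow> L2_on a b f' \<and>
     (\<forall>\<eta>. test_function a b \<eta> \<longrightarrow>
        (LINT x:{a<..<b}|lebesgue. f x * deriv \<eta> x) = - (LINT x:{a<..<b}|lebesgue. f' x * \<eta> x))"

definition H1_on :: "real \<Rightarrow> real \<Rightarrow> (real \<Rightarrow> real) \<Rightarrow> bool" where
  "H1_on a b f \<longleftrightarrow> L2_on a b f \<and> (\<exists>f'. has_weak_L2_deriv a b f f')"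

definition weak_deriv :: "real \<Rightarrow> real \<Rightarrow> (real \<Rightarrow> real) \<Rightarrow> real \<Rightarrow> real" where
  "weak_deriv a b f = (SOME f'. has_weak_L2_deriv a b f f')"

text \<open>A finite signed Borel measure on \<open>(a,b)\<close> is given through its polar decomposition: a finite
  measure \<open>M\<close>, its total variation, together with a density \<open>\<sigma>\<close> of modulus one.\<close>

definition polar_signed_measure :: "real \<Rightarrow> real \<Rightarrow> real measure \<Rightarrow> (real \<Rightarrow> real) \<Rightarrow> bool" where
  "polar_signed_measure a b M \<sigma> \<longleftrightarrow>
     finite_measure M \<and> sets M = sets (restrict_space borel {a<..<b}) \<and>
     \<sigma> \<in> borel_measurable M \<and> (\<forall>x\<in>{a<..<b}. \<bar>\<sigma> x\<bar> = 1)"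

definition BV_on :: "real \<Rightarrow> real \<Rightarrow> (real \<Rightarrow> real) \<Rightarrow> bool" where
  "BV_on a b w \<longleftrightarrow> w absolutely_integrable_on {a<..<b} \<and>
     (\<exists>M \<sigma>. polar_signed_measure a b M \<sigma> \<and>
        (\<forall>\<eta>. test_function a b \<eta> \<longrightarrow>
           (LINT x:{a<..<b}|lebesgue. w x * deriv \<eta> x) = - (LINT x|M. \<sigma> x * \<eta> x)))"

text \<open>The Lebesgue decomposition \<open>Dw = f dx + D\<^sup>sw\<close> of the distributional derivative, with
  \<open>D\<^sup>sw = \<sigma> M\<close> and \<open>M = |D\<^sup>sw|\<close>.  The density \<open>f\<close> is unique up to null sets, \<open>M\<close> is unique.\<close>

definition BV_decomposition ::
    "real \<Rightarrow> real \<Rightarrow> (real \<Rightarrow> real) \<Rightarrow> (real \<Rightarrow> real) \<Rightarrow> real measure \<Rightarrow> (real \<Rightarrow> real) \<Rightarrow> bool" where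
  "BV_decomposition a b w f M \<sigma> \<longleftrightarrow>
     f absolutely_integrable_on {a<..<b} \<and> polar_signed_measure a b M \<sigma> \<and>
     (\<exists>N\<in>sets M. emeasure lborel N = 0 \<and> emeasure M ({a<..<b} - N) = 0) \<and>
     (\<forall>\<eta>. test_function a b \<eta> \<longrightarrow>
        (LINT x:{a<..<b}|lebesgue. w x * deriv \<eta> x)
          = - ((LINT x:{a<..<b}|lebesgue. f x * \<eta> x) + (LINT x|M. \<sigma> x * \<eta> x)))"

definition ac_deriv :: "real \<Rightarrow> real \<Rightarrow> (real \<Rightarrow> real) \<Rightarrow> real \<Rightarrow> real" where
  "ac_deriv a b w = (SOME f. \<exists>M \<sigma>. BV_decomposition a b w f M \<sigma>)"

definition sing_variation :: "real \<Rightarrow> real \<Rightarrow> (real \<Rightarrow> real) \<Rightarrow> real measure" where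
  "sing_variation a b w = (SOME M. \<exists>f \<sigma>. BV_decomposition a b w f M \<sigma>)"

text \<open>One-sided traces \<open>w(a\<^sup>+)\<close> and \<open>w(b\<^sup>-)\<close>: one-sided limits of a good representative of \<open>w\<close>.\<close>

definition trace_left_end :: "real \<Rightarrow> real \<Rightarrow> (real \<Rightarrow> real) \<Rightarrow> real" where
  "trace_left_end a b w = (THE c. \<exists>v. (AE t in lebesgue. t \<in> {a<..<b} \<longrightarrow> v t = w t) \<and>
     (v \<longlongrightarrow> c) (at_right a))"

definition trace_right_end :: "real \<Rightarrow> real \<Rightarrow> (real \<Rightarrow> real) \<Rightarrow> real" where
  "trace_right_end a b w = (THE c. \<exists>v. (AE t in lebesgue. t \<in> {a<..<b} \<longrightarrow> v t = w t) \<and>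
     (v \<longlongrightarrow> c) (at_left b))"


section \<open>Regular data\<close>

text \<open>Quantities with values in \<open>[0,\<infinity>]\<close> are of type \<^typ>\<open>ennreal\<close>, whose multiplication satisfies
  \<open>0 * \<infinity> = 0\<close>.\<close>

definition esqrt :: "ennreal \<Rightarrow> ennreal" where
  "esqrt x = (if x = top then top else ennreal (sqrt (enn2real x)))"

definition theta0 :: "(real \<Rightarrow> real) \<Rightarrow> (real \<Rightarrow> real) \<Rightarrow> (real \<Rightarrow> real) \<Rightarrow> real \<Rightarrow> real" where
  "theta0 l Q \<omega> t = \<omega> (1 - t) / Q (1 - t) * l t"

definition theta :: "(real \<Rightarrow> real) \<Rightarrow> (real \<Rightarrow> real) \<Rightarrow> (real \<Rightarrow> real) \<Rightarrow> real \<Rightarrow> ennreal" where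
  "theta l Q \<omega> t = (if t < 1 then ennreal (theta0 l Q \<omega> t)
     else Lim (at_left 1) (\<lambda>\<tau>. ennreal (theta0 l Q \<omega> \<tau>)))"

definition sigma_bar :: "(real \<Rightarrow> real) \<Rightarrow> (real \<Rightarrow> real) \<Rightarrow> ennreal" where
  "sigma_bar Q \<omega> = Lim (at_right 0) (\<lambda>t. ennreal (sqrt (\<omega> t / Q t)))"

definition regular_data ::
    "(real \<Rightarrow> real) \<Rightarrow> (real \<Rightarrow> real) \<Rightarrow> (real \<Rightarrow> real) \<Rightarrow> (real \<Rightarrow> real) \<Rightarrow> bool" where
  "regular_data l Q \<omega> \<phi> \<longleftrightarrow>
     continuous_on {0..1} l \<and> (\<forall>t\<in>{0..1}. 0 \<le> l t) \<and> l 1 = 1 \<and> {t\<in>{0..1}. l t = 0} = {0} \<and>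
     continuous_on {0..1} Q \<and> (\<forall>t\<in>{0..1}. 0 \<le> Q t) \<and> {t\<in>{0..1}. Q t = 0} = {0} \<and>
     (\<exists>\<delta>\<in>{0<..<1}. mono_on {0..\<delta>} Q) \<and>
     (\<exists>\<delta>\<in>{0<..<1}. mono_on {0..\<delta>} (\<lambda>t. sqrt (l t / Q (1 - t)))) \<and>
     continuous_on {0..1} \<omega> \<and> (\<forall>t\<in>{0..1}. 0 \<le> \<omega> t) \<and> {t\<in>{0..1}. \<omega> t = 0} = {0} \<and>
     (\<exists>L. ((\<lambda>t. ennreal (sqrt (\<omega> t / Q t))) \<longlongrightarrow> L) (at_right 0)) \<and>
     continuous_on {0..} \<phi> \<and> (\<forall>t\<ge>0. 0 \<le> \<phi> t) \<and> mono_on {0..} \<phi> \<and>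
     (\<exists>L>0. (\<phi> \<longlongrightarrow> L) at_top) \<and> {t\<in>{0..}. \<phi> t = 0} = {0} \<and>
     (\<phi> has_real_derivative 1) (at_right 0) \<and>
     (\<exists>\<theta>'. continuous_on {0<..<1} \<theta>' \<and>
        (\<forall>t\<in>{0<..<1}. (theta0 l Q \<omega> has_real_derivative \<theta>' t) (at t) \<and> 0 < \<theta>' t))"


section \<open>The surface energy density and its auxiliary functions\<close>

definition Psi :: "(real \<Rightarrow> real) \<Rightarrow> real \<Rightarrow> real" where
  "Psi \<omega> t = integral {0..t} (\<lambda>\<tau>. sqrt (\<omega> (1 - \<tau>)))"

text \<open>The continuity requirement selects the continuous representatives, for which the pointwise
  constraints are meant.\<close>

definition admissible :: "real \<Rightarrow> (real \<Rightarrow> real) \<Rightarrow> (real \<Rightarrow> real) \<Rightarrow> bool" where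
  "admissible s u v \<longleftrightarrow>
     H1_on 0 1 u \<and> H1_on 0 1 v \<and> continuous_on {0..1} u \<and> continuous_on {0..1} v \<and>
     u 0 = 0 \<and> u 1 = s \<and> (\<forall>x\<in>{0..1}. 0 \<le> v x \<and> v x \<le> 1) \<and> v 0 = 1 \<and> v 1 = 1"

definition g_surf :: "(real \<Rightarrow> real) \<Rightarrow> (real \<Rightarrow> real) \<Rightarrow> (real \<Rightarrow> real) \<Rightarrow> real \<Rightarrow> ennreal" where
  "g_surf l Q \<omega> s = (INF (u, v) \<in> {(u, v). admissible s u v}.
     \<integral>\<^sup>+ x\<in>{0<..<1}. esqrt (theta l Q \<omega> (v x) * ennreal ((weak_deriv 0 1 u x)\<^sup>2)
        + ennreal (\<omega> (1 - v x) * (weak_deriv 0 1 v x)\<^sup>2)) \<partial>lebesgue)"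

definition s_frac :: "(real \<Rightarrow> real) \<Rightarrow> (real \<Rightarrow> real) \<Rightarrow> (real \<Rightarrow> real) \<Rightarrow> ennreal" where
  "s_frac l Q \<omega> = (SUP s \<in> {s. 0 \<le> s \<and> g_surf l Q \<omega> s < ennreal (2 * Psi \<omega> 1)}. ennreal s)"

definition theta_refl ::
    "(real \<Rightarrow> real) \<Rightarrow> (real \<Rightarrow> real) \<Rightarrow> (real \<Rightarrow> real) \<Rightarrow> real \<Rightarrow> real \<Rightarrow> ennreal" where
  "theta_refl l Q \<omega> m t = theta l Q \<omega> (m + \<bar>t - m\<bar>)"

text \<open>This is \<open>\<omega>\<^sub>m(1 - t)\<close> as a function of \<open>t\<close>.\<close>

definition omega_refl :: "(real \<Rightarrow> real) \<Rightarrow> real \<Rightarrow> real \<Rightarrow> real" where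
  "omega_refl \<omega> m t = \<omega> (1 - m - \<bar>t - m\<bar>)"

definition scG :: "(real \<Rightarrow> real) \<Rightarrow> (real \<Rightarrow> real) \<Rightarrow> (real \<Rightarrow> real) \<Rightarrow> real \<Rightarrow> real \<Rightarrow>
    (real \<Rightarrow> real) \<Rightarrow> ennreal" where
  "scG l Q \<omega> m s w = (if BV_on (2*m - 1) 1 w then
       (\<integral>\<^sup>+ t\<in>{2*m - 1<..<1}. esqrt (theta_refl l Q \<omega> m t * ennreal ((ac_deriv (2*m - 1) 1 w t)\<^sup>2)
          + ennreal (omega_refl \<omega> m t)) \<partial>lebesgue)
       + (\<integral>\<^sup>+ t. esqrt (theta_refl l Q \<omega> m t) \<partial>sing_variation (2*m - 1) 1 w)
       + esqrt (theta l Q \<omega> 1) * ennreal \<bar>trace_left_end (2*m - 1) 1 w\<bar>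
       + esqrt (theta l Q \<omega> 1) * ennreal \<bar>trace_right_end (2*m - 1) 1 w - s\<bar>
     else top)"

text \<open>The infimum is attained, so this is the minimum of \<open>scG\<close> over \<open>L\<^sup>1((2m-1,1))\<close>.\<close>

definition min_scG :: "(real \<Rightarrow> real) \<Rightarrow> (real \<Rightarrow> real) \<Rightarrow> (real \<Rightarrow> real) \<Rightarrow> real \<Rightarrow> real \<Rightarrow> ennreal" where
  "min_scG l Q \<omega> s m = (INF w \<in> {w. w absolutely_integrable_on {2*m - 1<..<1}}. scG l Q \<omega> m s w)"

definition Phi :: "(real \<Rightarrow> real) \<Rightarrow> (real \<Rightarrow> real) \<Rightarrow> (real \<Rightarrow> real) \<Rightarrow> real \<Rightarrow> ennreal" where
  "Phi l Q \<omega> x = 2 * (\<integral>\<^sup>+ t\<in>{x<..<1}. ennreal (sqrt (theta0 l Q \<omega> x * \<omega> (1 - t) /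
     (theta0 l Q \<omega> t * (theta0 l Q \<omega> t - theta0 l Q \<omega> x)))) \<partial>lebesgue)"

definition inf_Phi :: "(real \<Rightarrow> real) \<Rightarrow> (real \<Rightarrow> real) \<Rightarrow> (real \<Rightarrow> real) \<Rightarrow> ennreal" where
  "inf_Phi l Q \<omega> = (INF x\<in>{0<..<1}. Phi l Q \<omega> x)"

definition sup_Phi :: "(real \<Rightarrow> real) \<Rightarrow> (real \<Rightarrow> real) \<Rightarrow> (real \<Rightarrow> real) \<Rightarrow> ennreal" where
  "sup_Phi l Q \<omega> = (SUP x\<in>{0<..<1}. Phi l Q \<omega> x)"

end

(* The energy is the length of the curve (u, v) in the degenerate metric
   theta(v) du^2 + omega(1-v) dv^2.  Let F s m be the length of the curve that runs down to height m
   and back along the geodesic with Clairaut constant sqrt(theta m), with the remaining horizontal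
   distance (possibly negative) covered at height m at cost sqrt(theta m) per unit.  Cauchy-Schwarz
   with that constant bounds the energy of every curve with min v = m, and of every BV graph over
   [2m-1, 1], from below by F s m; both bounds are attained if Phi m = s.  Formally
   F' = (sqrt theta)' (s - Phi), so F decreases where Phi > s and increases where Phi < s.  Hence the
   infimum of F over [0,1] is reached at a point with Phi m = s, or at m = 0 (value 2 Psi 1), or in
   the limit m -> 1 (value sigma_bar * s), which gives the three cases. *)

theory Submission
  imports Defs
begin

section \<open>Test functions and the fundamental lemma\<close>

text \<open>The formula for \<open>F'\<close> is only a guide. The integrand of \<open>Phi\<close>
  is unbounded near the turning height, \<open>Phi\<close> may be infinite and its continuity is
  never established, so \<open>F\<close> is not differentiated. The sign of \<open>F'\<close> is
  replaced by one-sided pointwise statements: if \<open>Phi\<close> exceeds \<open>s\<close> at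
  \<open>y\<close>, there are points arbitrarily close to the right of \<open>y\<close> with smaller
  \<open>F\<close>; if \<open>Phi\<close> is below \<open>s\<close> at \<open>y\<close>, there are
  such points to the left. The first rests on the concavity of the calibration integrand in
  \<open>sqrt (\<theta> m)\<close>, the second also on \<open>\<theta>' > 0\<close>. Both need
  strict inequalities; the affine dependence of \<open>F\<close> on \<open>s\<close> carries the
  results to the closed ranges of \<open>s\<close>. The other obstacle is that derivatives, singular
  parts and traces are defined by duality with test functions and by choice operators. Before
  anything can be calibrated, the increments of a function have to be recovered from whatever
  objects were chosen. The du Bois-Reymond lemma and the Lebesgue decomposition with its uniqueness
  serve this purpose.\<close>

lemma has_real_derivative_pos_part_square:
  fixes r :: real
  shows "((\<lambda>x. (max 0 x)\<^sup>2) has_real_derivative 2 * max 0 r) (at r)"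
proof -
  consider "r < 0" | "r > 0" | "r = 0" by linarith
  then show ?thesis
  proof cases
    case 1
    have "eventually (\<lambda>x. x \<in> {..<0}) (nhds r)"
      using 1 by (intro eventually_nhds_in_open) auto
    then have "eventually (\<lambda>x. (max 0 x)\<^sup>2 = (0::real)) (nhds r)"
      by eventually_elim (auto simp: max_def)
    then have "((\<lambda>x. (max 0 x)\<^sup>2) has_real_derivative 0) (at r) \<longleftrightarrow> ((\<lambda>x. 0::real) has_real_derivative 0) (at r)"
      by (intro DERIV_cong_ev) auto
    then show ?thesis using 1 by (simp add: max_def)
  next
    case 2
    have "eventually (\<lambda>x. x \<in> {0<..}) (nhds r)"
      using 2 by (intro eventually_nhds_in_open) auto
    then have "eventually (\<lambda>x. (max 0 x)\<^sup>2 = x\<^sup>2) (nhds r)"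
      by eventually_elim (auto simp: max_def)
    then have "((\<lambda>x. (max 0 x)\<^sup>2) has_real_derivative 2 * r) (at r) \<longleftrightarrow> ((\<lambda>x. x\<^sup>2) has_real_derivative 2 * r) (at r)"
      by (intro DERIV_cong_ev) auto
    moreover have "((\<lambda>x. x\<^sup>2) has_real_derivative 2 * r) (at r)"
      by (auto intro!: derivative_eq_intros)
    ultimately show ?thesis using 2 by (simp add: max_def)
  next
    case 3
    have "((\<lambda>h. (max 0 (r + h))\<^sup>2 / h) \<longlongrightarrow> 0) (at 0)"
    proof (rule Lim_null_comparison)
      show "\<forall>\<^sub>F h in at 0. norm ((max 0 (r + h))\<^sup>2 / h) \<le> \<bar>h\<bar>"
        using 3 by (intro always_eventually allI) (auto simp: max_def power2_eq_square)
      show "((\<lambda>h. \<bar>h\<bar>) \<longlongrightarrow> 0) (at (0::real))"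
        by (intro tendsto_eq_intros) auto
    qed
    then show ?thesis using 3 by (simp add: DERIV_def)
  qed
qed

text \<open>Squares of positive parts are C1 across the end points, which is the smoothness that
  \<open>test_function\<close> demands.\<close>

definition bump :: "real \<Rightarrow> real \<Rightarrow> real \<Rightarrow> real" where
  "bump c d x = (max 0 (x - c))\<^sup>2 * (max 0 (d - x))\<^sup>2"

lemma bump_nonneg: "0 \<le> bump c d x"
  by (simp add: bump_def)

lemma bump_eq_0: "x \<notin> {c..d} \<Longrightarrow> bump c d x = 0"
  by (auto simp: bump_def max_def)

lemma bump_pos: "c < x \<Longrightarrow> x < d \<Longrightarrow> bump c d x > 0"
  by (auto simp: bump_def max_def)

lemma bump_has_derivative:
  "(bump c d has_real_derivative
     (2 * max 0 (x - c) * (max 0 (d - x))\<^sup>2 - (max 0 (x - c))\<^sup>2 * (2 * max 0 (d - x)))) (at x)"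
proof -
  have 1: "((\<lambda>x. (max 0 (x - c))\<^sup>2) has_real_derivative 2 * max 0 (x - c) * 1) (at x)"
    by (rule DERIV_chain2[OF has_real_derivative_pos_part_square]) (auto intro!: derivative_eq_intros)
  have 2: "((\<lambda>x. (max 0 (d - x))\<^sup>2) has_real_derivative 2 * max 0 (d - x) * (- 1)) (at x)"
    by (rule DERIV_chain2[OF has_real_derivative_pos_part_square]) (auto intro!: derivative_eq_intros)
  show ?thesis
    unfolding bump_def[abs_def] using DERIV_mult[OF 1 2] by (simp add: algebra_simps)
qed

lemma C1_differentiable_onI_real:
  fixes f :: "real \<Rightarrow> real"
  assumes "\<And>x. (f has_real_derivative f' x) (at x)" "continuous_on UNIV f'"
  shows "f C1_differentiable_on UNIV"
  unfolding C1_differentiable_on_def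
  using assms by (auto simp: has_real_derivative_iff_has_vector_derivative)

text \<open>The map \<open>r \<mapsto> n * r / (1 + n * r)\<close> keeps the values in
  \<open>[0,1)\<close> and, as \<open>n\<close> grows, pushes every positive value of the bump
  towards 1 while its zeros stay fixed. This turns bumps into approximations of indicators.\<close>

lemma test_function_bump:
  assumes "a < c" "d < b" "n \<ge> 0"
  shows "test_function a b (\<lambda>x. n * bump c d x / (1 + n * bump c d x))"
proof -
  define q' where "q' x = 2 * max 0 (x - c) * (max 0 (d - x))\<^sup>2 - (max 0 (x - c))\<^sup>2 * (2 * max 0 (d - x))" for x
  have nz: "1 + n * bump c d x > 0" for x
    using assms(3) bump_nonneg[of c d x] by (simp add: add_pos_nonneg)
  have q': "(bump c d has_real_derivative q' x) (at x)" for x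
    unfolding q'_def by (rule bump_has_derivative)
  have "((\<lambda>x. n * bump c d x / (1 + n * bump c d x)) has_real_derivative
         n * q' x / (1 + n * bump c d x)\<^sup>2) (at x)" for x
    using nz[of x] by (auto intro!: derivative_eq_intros q' simp: power2_eq_square field_simps)
  moreover have "continuous_on UNIV (\<lambda>x. n * q' x / (1 + n * bump c d x)\<^sup>2)"
    unfolding q'_def bump_def using nz unfolding bump_def
    by (intro continuous_intros) (smt (verit) power_eq_0_iff)
  ultimately have "(\<lambda>x. n * bump c d x / (1 + n * bump c d x)) C1_differentiable_on UNIV"
    by (rule C1_differentiable_onI_real)
  moreover have "compact {c..d} \<and> {c..d} \<subseteq> {a<..<b} \<and>
      (\<forall>x. x \<notin> {c..d} \<longrightarrow> n * bump c d x / (1 + n * bump c d x) = 0)"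
    using assms by (auto simp: bump_eq_0)
  ultimately show ?thesis
    unfolding test_function_def by blast
qed

text \<open>Two limits run together: the supports, kept \<open>1 / Suc n\<close> away from the ends
  so that they are compact inside the interval, fill it up, while the factor \<open>n\<close>
  saturates the height.\<close>

lemma indicator_approx_test_function:
  obtains \<eta> where "\<And>n::nat. test_function a b (\<eta> n)" "\<And>n x. 0 \<le> \<eta> n x" "\<And>n x. \<eta> n x \<le> 1"
    "\<And>x. (\<lambda>n. \<eta> n x) \<longlonglongrightarrow> indicator ({c<..<d} \<inter> {a<..<b}) x"
proof -
  define l u where "l = max a c" and "u = min b d"
  define q where "q n x = bump (l + 1 / Suc n) (u - 1 / Suc n) x" for n x
  define \<eta> where "\<eta> n x = real n * q n x / (1 + real n * q n x)" for n x
  have q0: "q n x \<ge> 0" for n x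
    by (simp add: q_def bump_nonneg)
  have "test_function a b (\<eta> n)" for n
  proof -
    have "1 / real (Suc n) > 0" by simp
    then have "a < l + 1 / Suc n" "u - 1 / Suc n < b" unfolding l_def u_def by linarith+
    then show ?thesis unfolding \<eta>_def[abs_def] q_def[abs_def] by (intro test_function_bump) auto
  qed
  moreover have "0 \<le> \<eta> n x" for n x
    unfolding \<eta>_def using q0 by (intro divide_nonneg_nonneg) (auto simp: add_nonneg_nonneg)
  moreover have "\<eta> n x \<le> 1" for n x
    using q0[of n x] by (simp add: \<eta>_def divide_simps add_pos_nonneg)
  moreover have "(\<lambda>n. \<eta> n x) \<longlonglongrightarrow> indicator ({c<..<d} \<inter> {a<..<b}) x" for x
  proof (cases "l < x \<and> x < u")
    case False
    have "\<eta> n x = 0" for n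
    proof -
      have "1 / real (Suc n) > 0" by simp
      then have "x \<notin> {l + 1 / Suc n..u - 1 / Suc n}" using False by (simp only: atLeastAtMost_iff) linarith
      then have "q n x = 0" unfolding q_def by (rule bump_eq_0)
      then show ?thesis by (simp add: \<eta>_def)
    qed
    moreover have "x \<notin> {c<..<d} \<inter> {a<..<b}" using False by (auto simp: l_def u_def)
    ultimately show ?thesis by simp
  next
    case True
    have inv: "(\<lambda>n. 1 / real (Suc n)) \<longlonglongrightarrow> 0"
      using LIMSEQ_inverse_real_of_nat by (simp add: inverse_eq_divide)
    have lim: "(\<lambda>n. q n x) \<longlonglongrightarrow> bump l u x"
      unfolding q_def bump_def
      by (rule tendsto_eq_intros inv refl | simp)+
    have pos: "bump l u x > 0" using True by (intro bump_pos) auto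
    have "filterlim (\<lambda>n. 1 + real n * q n x) at_top sequentially"
      by (intro filterlim_tendsto_add_at_top[OF tendsto_const]
          filterlim_at_top_mult_tendsto_pos[OF lim pos] filterlim_real_sequentially)
    then have "(\<lambda>n. inverse (1 + real n * q n x)) \<longlonglongrightarrow> 0"
      by (rule tendsto_inverse_0_at_top)
    then have "(\<lambda>n. 1 - inverse (1 + real n * q n x)) \<longlonglongrightarrow> 1 - 0"
      by (intro tendsto_intros)
    moreover have "1 - inverse (1 + real n * q n x) = \<eta> n x" for n
    proof -
      have "1 + real n * q n x > 0" using q0 by (simp add: add_pos_nonneg)
      then show ?thesis by (simp add: \<eta>_def field_simps)
    qed
    moreover have "x \<in> {c<..<d} \<inter> {a<..<b}" using True by (auto simp: l_def u_def)
    ultimately show ?thesis by simp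
  qed
  ultimately show thesis by (rule that)
qed

lemma test_function_continuous: "test_function a b \<eta> \<Longrightarrow> continuous_on UNIV \<eta>"
  unfolding test_function_def by (auto dest: C1_differentiable_imp_continuous_on)

lemma test_function_measurable [measurable_dest]:
  "test_function a b \<eta> \<Longrightarrow> \<eta> \<in> borel_measurable borel"
  by (intro borel_measurable_continuous_onI test_function_continuous)

lemma test_function_bounded:
  assumes "test_function a b \<eta>"
  obtains B where "\<And>x. \<bar>\<eta> x\<bar> \<le> B"
proof -
  obtain K where K: "compact K" "\<And>x. x \<notin> K \<Longrightarrow> \<eta> x = 0"
    using assms unfolding test_function_def by blast
  have "bounded (\<eta> ` K)"
    using K(1) test_function_continuous[OF assms] by (meson compact_continuous_image compact_imp_bounded continuous_on_subset subset_UNIV)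
  then obtain B where B: "\<And>x. x \<in> K \<Longrightarrow> \<bar>\<eta> x\<bar> \<le> B" unfolding bounded_iff by auto
  have "\<bar>\<eta> x\<bar> \<le> max B 0" for x using B[of x] K(2)[of x] by (cases "x \<in> K") auto
  then show thesis by (rule that)
qed

text \<open>Dominated convergence for any measure with Borel measurable identity map. One statement
  then serves Lebesgue measure and the measures on \<open>{a<..<b}\<close>, which live on different
  sigma-algebras.\<close>

lemma tendsto_integral_indicator:
  fixes h :: "real \<Rightarrow> real"
  assumes meas: "(\<lambda>x. x) \<in> measurable M borel" and h: "integrable M h"
    and \<eta>: "\<And>n. \<eta> n \<in> borel_measurable borel" "\<And>n x. \<bar>\<eta> n x\<bar> \<le> 1"
    and lim: "\<And>x. (\<lambda>n. \<eta> n x) \<longlonglongrightarrow> (\<xi> x :: real)"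
  shows "(\<lambda>n. LINT x|M. h x * \<eta> n x) \<longlonglongrightarrow> (LINT x|M. h x * \<xi> x)"
proof (rule integral_dominated_convergence[where w = "\<lambda>x. \<bar>h x\<bar>"])
  have \<eta>M: "\<eta> n \<in> borel_measurable M" for n
    using measurable_compose[OF meas \<eta>(1)] .
  then have \<xi>M: "\<xi> \<in> borel_measurable M"
    by (rule borel_measurable_LIMSEQ_real[rotated]) (rule lim)
  show "(\<lambda>x. h x * \<xi> x) \<in> borel_measurable M" "\<And>n. (\<lambda>x. h x * \<eta> n x) \<in> borel_measurable M"
    using h \<eta>M \<xi>M by auto
  show "AE x in M. (\<lambda>n. h x * \<eta> n x) \<longlonglongrightarrow> h x * \<xi> x"
    using lim by (auto intro!: tendsto_intros)
  show "AE x in M. norm (h x * \<eta> n x) \<le> \<bar>h x\<bar>" for n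
    using mult_left_mono[OF \<eta>(2)] by (auto simp: abs_mult intro!: AE_I2 mult_left_le)
qed (use h in auto)

lemma integrable_mult_indicator_borel:
  fixes h :: "real \<Rightarrow> real"
  assumes meas: "(\<lambda>x. x) \<in> measurable M borel" and h: "integrable M h" and A: "A \<in> sets borel"
  shows "integrable M (\<lambda>x. h x * indicator A x)"
proof -
  have "indicator A \<in> borel_measurable M"
    using measurable_compose[OF meas, of "indicator A" borel] A by auto
  then show ?thesis using h
    by (intro Bochner_Integration.integrable_bound[OF h] borel_measurable_times AE_I2)
      (auto simp: abs_mult split: split_indicator)
qed

text \<open>Dynkin's argument: the open intervals are an intersection-stable generator of the Borel
  sets, and for them the claim is a limit of test functions. A finite family of measures is treated
  at once because comparing two Lebesgue decompositions involves three of them; this avoids forming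
  their signed combination as a single object.\<close>

proposition test_functional_zero:
  fixes \<mu> :: "'i \<Rightarrow> real measure" and h :: "'i \<Rightarrow> real \<Rightarrow> real"
  assumes "finite I" and meas: "\<And>i. i \<in> I \<Longrightarrow> (\<lambda>x. x) \<in> measurable (\<mu> i) borel"
    and h: "\<And>i. i \<in> I \<Longrightarrow> integrable (\<mu> i) (h i)"
    and zero: "\<And>\<eta>. test_function a b \<eta> \<Longrightarrow> (\<Sum>i\<in>I. LINT x|\<mu> i. h i x * \<eta> x) = 0"
    and A: "A \<in> sets borel"
  shows "(\<Sum>i\<in>I. LINT x|\<mu> i. h i x * indicator (A \<inter> {a<..<b}) x) = 0"
proof -
  define P where "P A \<longleftrightarrow> (\<Sum>i\<in>I. LINT x|\<mu> i. h i x * indicator (A \<inter> {a<..<b}) x) = 0" for A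
  let ?G = "{{c<..<d} |c d :: real. True}"
  have gen: "P {c<..<d}" for c d
  proof -
    obtain \<eta> where \<eta>: "\<And>n::nat. test_function a b (\<eta> n)" "\<And>n x. 0 \<le> \<eta> n x" "\<And>n x. \<eta> n x \<le> 1"
      "\<And>x. (\<lambda>n. \<eta> n x) \<longlonglongrightarrow> indicator ({c<..<d} \<inter> {a<..<b}) x"
      using indicator_approx_test_function by blast
    have "(\<lambda>n. \<Sum>i\<in>I. LINT x|\<mu> i. h i x * \<eta> n x)
        \<longlonglongrightarrow> (\<Sum>i\<in>I. LINT x|\<mu> i. h i x * indicator ({c<..<d} \<inter> {a<..<b}) x)"
      using \<eta> by (intro tendsto_sum tendsto_integral_indicator meas h) (auto intro: test_function_measurable)
    then show ?thesis unfolding P_def using zero[OF \<eta>(1)] by (simp add: LIMSEQ_const_iff)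
  qed
  have borel: "sets borel = sigma_sets UNIV ?G"
  proof -
    have "(borel :: real measure) = sigma UNIV (range (\<lambda>(c, d). {c<..<d}))"
      by (simp add: borel_eq_box)
    also have "range (\<lambda>(c, d). {c<..<d}) = ?G" by auto
    finally show ?thesis by (metis sets_measure_of top_greatest Pow_UNIV)
  qed
  have "Int_stable ?G"
    unfolding Int_stable_def by (clarsimp; blast)
  have G_Pow: "?G \<subseteq> Pow UNIV" by simp
  have "A \<in> sigma_sets UNIV ?G" using A borel by simp
  then have "P A"
  proof (induction rule: sigma_sets_induct_disjoint[OF \<open>Int_stable ?G\<close> G_Pow,
        consumes 1, case_names basic empty compl union])
    case (basic A)
    then show ?case using gen by auto
  next
    case empty
    then show ?case by (simp add: P_def)
  next
    case (compl A)
    then have A: "A \<in> sets borel" using borel by simp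
    \<comment> \<open>All sets are intersected with \<open>{a<..<b}\<close>, so this interval takes
      the part of the whole space when passing to complements.\<close>
    have "P {a<..<b}" by (rule gen)
    have "(LINT x|\<mu> i. h i x * indicator ((UNIV - A) \<inter> {a<..<b}) x) =
       (LINT x|\<mu> i. h i x * indicator ({a<..<b} \<inter> {a<..<b}) x) - (LINT x|\<mu> i. h i x * indicator (A \<inter> {a<..<b}) x)"
      if "i \<in> I" for i
    proof (subst Bochner_Integration.integral_diff[symmetric])
      show "integrable (\<mu> i) (\<lambda>x. h i x * indicator (A \<inter> {a<..<b}) x)"
        using A by (intro integrable_mult_indicator_borel meas h that) auto
      show "integrable (\<mu> i) (\<lambda>x. h i x * indicator ({a<..<b} \<inter> {a<..<b}) x)"
        by (intro integrable_mult_indicator_borel meas h that) auto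
    qed (auto intro!: Bochner_Integration.integral_cong simp: indicator_def)
    then show ?case using compl \<open>P {a<..<b}\<close> unfolding P_def by (simp add: sum_subtractf)
  next
    case (union A)
    from union have A: "\<And>n. A n \<in> sets borel" using borel by auto
    have sums: "(\<lambda>n. LINT x|\<mu> i. h i x * indicator (A n \<inter> {a<..<b}) x) sums
        (LINT x|\<mu> i. h i x * indicator ((\<Union>n. A n) \<inter> {a<..<b}) x)" if "i \<in> I" for i
    proof -
      let ?B = "\<lambda>n. (\<Union>k<n. A k) \<inter> {a<..<b}"
      have "(\<Sum>k<n. LINT x|\<mu> i. h i x * indicator (A k \<inter> {a<..<b}) x) =
          (LINT x|\<mu> i. h i x * indicator (?B n) x)" for n
      proof (subst Bochner_Integration.integral_sum[symmetric])
        show "integrable (\<mu> i) (\<lambda>x. h i x * indicator (A k \<inter> {a<..<b}) x)" for k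
          using A by (intro integrable_mult_indicator_borel meas h that) auto
        have "disjoint_family_on (\<lambda>n. A n \<inter> {a<..<b}) {..<n}"
          using union(1) by (auto simp: disjoint_family_on_def)
        moreover have "?B n = (\<Union>k\<in>{..<n}. A k \<inter> {a<..<b})" by blast
        ultimately have "(\<Sum>k<n. indicator (A k \<inter> {a<..<b}) x) = (indicator (?B n) x :: real)" for x
          using indicator_UN_disjoint[OF finite_lessThan, where ?'c = real] by metis
        then show "(LINT x|\<mu> i. (\<Sum>k<n. h i x * indicator (A k \<inter> {a<..<b}) x)) =
            (LINT x|\<mu> i. h i x * indicator (?B n) x)"
          by (simp flip: sum_distrib_left)
      qed
      moreover have "(\<lambda>n. LINT x|\<mu> i. h i x * indicator (?B n) x) \<longlonglongrightarrow>
          (LINT x|\<mu> i. h i x * indicator ((\<Union>n. A n) \<inter> {a<..<b}) x)"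
      proof (rule tendsto_integral_indicator[OF meas[OF that] h[OF that]])
        show "(\<lambda>n. indicator (?B n) x) \<longlonglongrightarrow> indicator ((\<Union>n. A n) \<inter> {a<..<b}) x" for x :: real
        proof (rule tendsto_eventually, cases "x \<in> (\<Union>n. A n)")
          case True
          then obtain k where "x \<in> A k" by auto
          show "\<forall>\<^sub>F n in sequentially. indicator (?B n) x = indicator ((\<Union>n. A n) \<inter> {a<..<b}) x"
          proof (rule eventually_mono[OF eventually_gt_at_top[of k]])
            fix n assume "k < n"
            then have "x \<in> (\<Union>k<n. A k)" using \<open>x \<in> A k\<close> by blast
            then show "indicator (?B n) x = indicator ((\<Union>n. A n) \<inter> {a<..<b}) x"
              using True by (simp only: indicator_def Int_iff)
          qed
        next
          case False
          then show "\<forall>\<^sub>F n in sequentially. indicator (?B n) x = indicator ((\<Union>n. A n) \<inter> {a<..<b}) x"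
            by (auto simp: indicator_def)
        qed
      qed (use A in \<open>auto simp: indicator_def\<close>)
      ultimately show ?thesis unfolding sums_def by simp
    qed
    have "(\<lambda>n. \<Sum>i\<in>I. LINT x|\<mu> i. h i x * indicator (A n \<inter> {a<..<b}) x) sums
        (\<Sum>i\<in>I. LINT x|\<mu> i. h i x * indicator ((\<Union>n. A n) \<inter> {a<..<b}) x)"
      by (intro sums_sum sums)
    moreover have "(\<Sum>i\<in>I. LINT x|\<mu> i. h i x * indicator (A n \<inter> {a<..<b}) x) = 0" for n
      using union(3) unfolding P_def by blast
    ultimately show ?case unfolding P_def by (simp add: sums_iff)
  qed
  then show ?thesis by (simp add: P_def)
qed

text \<open>The natural test sets are those where \<open>f\<close> has a fixed sign. They are only
  Lebesgue sets, whereas the assumption speaks of Borel sets; hence they are formed from a Borel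
  function that agrees with \<open>f\<close> almost everywhere.\<close>

lemma AE_lebesgue_zero_if_integrals_zero:
  fixes f :: "real \<Rightarrow> real"
  assumes f: "integrable lebesgue f" and S: "S \<in> sets borel"
    and zero: "\<And>A. A \<in> sets borel \<Longrightarrow> (LINT x|lebesgue. f x * indicator (A \<inter> S) x) = 0"
  shows "AE x in lebesgue. x \<in> S \<longrightarrow> f x = 0"
proof -
  obtain g where g: "g \<in> borel_measurable lborel" "AE x in lborel. f x = g x"
    using completion_ex_borel_measurable_real[of f lborel] f by auto
  have fg: "AE x in lebesgue. f x = g x" using g(2) by (rule AE_completion)
  have gM: "g \<in> borel_measurable borel" using g(1) by simp
  have gL: "g \<in> borel_measurable lebesgue" using g(1) by (rule measurable_completion)
  have id: "(\<lambda>x::real. x) \<in> measurable lebesgue borel"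
    by (intro measurable_completion) simp
  have AE0: "AE x in lebesgue. x \<in> A \<inter> S \<longrightarrow> f x = 0"
    if A: "A \<in> sets borel" and sgn: "\<And>x. x \<in> A \<Longrightarrow> 0 \<le> s * g x" "s \<noteq> 0" for A and s :: real
  proof -
    have int: "integrable lebesgue (\<lambda>x. s * (f x * indicator (A \<inter> S) x))"
      using A S by (intro integrable_mult_right integrable_mult_indicator_borel id f) auto
    have nn: "AE x in lebesgue. 0 \<le> s * (f x * indicator (A \<inter> S) x)"
      using fg by eventually_elim (use sgn in \<open>auto simp: indicator_def\<close>)
    have "(LINT x|lebesgue. s * (f x * indicator (A \<inter> S) x)) = 0"
      using zero[OF A] by simp
    then have "AE x in lebesgue. s * (f x * indicator (A \<inter> S) x) = 0"
      using integral_nonneg_eq_0_iff_AE[OF int nn] by simp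
    then show ?thesis by eventually_elim (use \<open>s \<noteq> 0\<close> in \<open>auto simp: indicator_def\<close>)
  qed
  have "AE x in lebesgue. x \<in> {x. g x \<ge> 0} \<inter> S \<longrightarrow> f x = 0"
    using gM by (intro AE0[where s = 1]) auto
  moreover have "AE x in lebesgue. x \<in> {x. g x \<le> 0} \<inter> S \<longrightarrow> f x = 0"
    using gM by (intro AE0[where s = "- 1"]) auto
  ultimately show ?thesis by eventually_elim auto
qed

section \<open>Distributional derivatives that are measures\<close>

lemma test_function_support:
  assumes "test_function a b \<eta>" "a < b"
  obtains c d where "a < c" "d < b" "\<And>x. x \<notin> {c..d} \<Longrightarrow> \<eta> x = 0"
proof -
  obtain K where K: "compact K" "K \<subseteq> {a<..<b}" "\<And>x. x \<notin> K \<Longrightarrow> \<eta> x = 0"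
    using assms unfolding test_function_def by blast
  show thesis
  proof (cases "K = {}")
    case True
    then show thesis using that[of "(a + b) / 2" "(a + b) / 2"] K(3) assms(2) by auto
  next
    case False
    obtain c where c: "c \<in> K" "\<And>t. t \<in> K \<Longrightarrow> c \<le> t" using compact_attains_inf[OF K(1) False] by auto
    obtain d where d: "d \<in> K" "\<And>t. t \<in> K \<Longrightarrow> t \<le> d" using compact_attains_sup[OF K(1) False] by auto
    have "a < c" "d < b" using c(1) d(1) K(2) by auto
    moreover have "\<eta> x = 0" if "x \<notin> {c..d}" for x
      using that c d by (intro K(3)) auto
    ultimately show thesis by (rule that)
  qed
qed

lemma test_functionI:
  assumes "a < c" "d < b" "\<And>x. x \<notin> {c..d} \<Longrightarrow> \<eta> x = 0" "\<eta> C1_differentiable_on UNIV"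
  shows "test_function a b \<eta>"
  using assms unfolding test_function_def by (intro conjI exI[of _ "{c..d}"]) auto

lemma test_function_deriv:
  assumes "test_function a b \<eta>"
  shows "(\<eta> has_real_derivative deriv \<eta> x) (at x)" "continuous_on UNIV (deriv \<eta>)"
proof -
  obtain D where D: "\<And>x. (\<eta> has_real_derivative D x) (at x)" "continuous_on UNIV D"
    using assms unfolding test_function_def C1_differentiable_on_def
    by (auto simp: has_real_derivative_iff_has_vector_derivative)
  moreover have "deriv \<eta> = D" using D(1) by (intro ext DERIV_imp_deriv)
  ultimately show "(\<eta> has_real_derivative deriv \<eta> x) (at x)" "continuous_on UNIV (deriv \<eta>)"
    by auto
qed

lemma test_function_deriv_outside:
  assumes "test_function a b \<eta>" "x \<notin> {a<..<b}"
  shows "deriv \<eta> x = 0" "\<eta> x = 0"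
proof -
  obtain K where K: "compact K" "K \<subseteq> {a<..<b}" "\<And>x. x \<notin> K \<Longrightarrow> \<eta> x = 0"
    using assms unfolding test_function_def by blast
  then show "\<eta> x = 0" using assms(2) by blast
  have "eventually (\<lambda>y. y \<in> - K) (nhds x)"
    using K assms(2) compact_imp_closed by (intro eventually_nhds_in_open) auto
  then have "eventually (\<lambda>y. \<eta> y = 0) (nhds x)"
    by eventually_elim (use K(3) in auto)
  then have "deriv \<eta> x = deriv (\<lambda>_. 0) x" by (rule deriv_cong_ev) simp
  then show "deriv \<eta> x = 0" by simp
qed

lemma test_function_deriv_bounded:
  assumes "test_function a b \<eta>"
  obtains B where "\<And>x. \<bar>deriv \<eta> x\<bar> \<le> B"
proof -
  have "compact (deriv \<eta> ` {a..b})"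
    using test_function_deriv(2)[OF assms] by (intro compact_continuous_image) (auto intro: continuous_on_subset)
  then obtain B where B: "\<And>x. x \<in> {a..b} \<Longrightarrow> \<bar>deriv \<eta> x\<bar> \<le> B"
    by (fastforce dest!: compact_imp_bounded simp: bounded_iff)
  have "\<bar>deriv \<eta> x\<bar> \<le> max 0 B" for x
    using B[of x] test_function_deriv_outside(1)[OF assms, of x] by (cases "x \<in> {a<..<b}") auto
  then show thesis by (rule that)
qed

lemma test_function_lincomb:
  assumes "test_function a b \<eta>" "test_function a b \<xi>"
  shows "test_function a b (\<lambda>x. \<eta> x + r * \<xi> x)"
proof -
  obtain K where K: "compact K" "K \<subseteq> {a<..<b}" "\<And>x. x \<notin> K \<Longrightarrow> \<eta> x = 0"
    using assms unfolding test_function_def by blast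
  obtain L where L: "compact L" "L \<subseteq> {a<..<b}" "\<And>x. x \<notin> L \<Longrightarrow> \<xi> x = 0"
    using assms unfolding test_function_def by blast
  have "(\<lambda>x. \<eta> x + r * \<xi> x) C1_differentiable_on UNIV"
    using assms by (auto simp: test_function_def)
  moreover have "compact (K \<union> L)" "K \<union> L \<subseteq> {a<..<b}" "\<And>x. x \<notin> K \<union> L \<Longrightarrow> \<eta> x + r * \<xi> x = 0"
    using K L by auto
  ultimately show ?thesis unfolding test_function_def by blast
qed

text \<open>Vanishing mean is what makes the primitive return to 0 beyond the support, so that it is
  a test function again.\<close>

lemma test_function_antiderivative:
  assumes "test_function a b \<zeta>" "a < b" "integral {a..b} \<zeta> = 0"
  obtains \<xi> where "test_function a b \<xi>" "\<And>x. deriv \<xi> x = \<zeta> x"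
proof -
  obtain c d where cd: "a < c" "d < b" "\<And>x. x \<notin> {c..d} \<Longrightarrow> \<zeta> x = 0"
    using test_function_support[OF assms(1,2)] by blast
  have cont: "continuous_on S \<zeta>" for S
    using test_function_continuous[OF assms(1)] continuous_on_subset by blast
  define \<xi> where "\<xi> x = integral {a..x} \<zeta>" for x
  have zl: "\<xi> x = 0" if "x < c" for x
  proof -
    have "\<xi> x = integral {a..x} (\<lambda>_. 0)"
      unfolding \<xi>_def by (rule integral_cong) (use that cd(3) in auto)
    then show ?thesis by simp
  qed
  have zr: "\<xi> x = 0" if "x > d" for x
  proof (cases "x \<le> a")
    case False
    have tail: "integral {min x b..max x b} \<zeta> = integral {min x b..max x b} (\<lambda>_. 0)"
      by (rule integral_cong) (use that cd(2) in \<open>auto intro!: cd(3) simp: min_def split: if_splits\<close>)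
    have "integral {a..min x b} \<zeta> + integral {min x b..max x b} \<zeta> = integral {a..max x b} \<zeta>"
      using False assms(2) by (intro Henstock_Kurzweil_Integration.integral_combine integrable_continuous_real cont) auto
    then show ?thesis using tail assms(3) by (cases "x \<le> b") (auto simp: \<xi>_def)
  qed (use zl cd in auto)
  have der: "(\<xi> has_real_derivative \<zeta> x) (at x)" for x
  proof (cases "x < c")
    case True
    have "eventually (\<lambda>y. y \<in> {..<c}) (nhds x)" using True by (intro eventually_nhds_in_open) auto
    then have "eventually (\<lambda>y. \<xi> y = 0) (nhds x)" by eventually_elim (use zl in auto)
    then have "(\<xi> has_real_derivative 0) (at x) \<longleftrightarrow> ((\<lambda>_. 0) has_real_derivative 0) (at x)"
      by (intro DERIV_cong_ev) auto
    then show ?thesis using True cd(3)[of x] by simp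
  next
    case False
    then have "(\<xi> has_real_derivative \<zeta> x) (at x within {a..x + 1})"
      unfolding \<xi>_def using cd(1) by (intro integral_has_real_derivative cont) auto
    moreover have "at x within {a..x + 1} = at x"
      using False cd(1) by (intro at_within_interior) simp
    ultimately show ?thesis by simp
  qed
  have "\<xi> C1_differentiable_on UNIV" using der cont by (rule C1_differentiable_onI_real)
  then have "test_function a b \<xi>" using cd(1,2) zl zr by (intro test_functionI[of a c d b]) auto
  moreover have "deriv \<xi> x = \<zeta> x" for x using der by (rule DERIV_imp_deriv)
  ultimately show thesis by (rule that)
qed

lemma test_function_integral:
  assumes "test_function a b \<eta>"
  shows "set_integrable lebesgue {a<..<b} \<eta>" "(LINT x:{a<..<b}|lebesgue. \<eta> x) = integral {a..b} \<eta>"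
proof -
  have "\<eta> absolutely_integrable_on {a..b}"
    by (intro absolutely_integrable_continuous_real continuous_on_subset[OF test_function_continuous[OF assms]]) simp
  then show i: "set_integrable lebesgue {a<..<b} \<eta>"
    by (rule set_integrable_subset) auto
  show "(LINT x:{a<..<b}|lebesgue. \<eta> x) = integral {a..b} \<eta>"
    using set_lebesgue_integral_eq_integral(2)[OF i] by (simp add: integral_open_interval_real)
qed

lemma id_measurable_lebesgue: "(\<lambda>x::real. x) \<in> measurable lebesgue borel"
  by (intro measurable_completion) simp

lemma set_integrable_mult_bounded:
  fixes f \<eta> :: "real \<Rightarrow> real"
  assumes "set_integrable lebesgue S f" "\<eta> \<in> borel_measurable borel" "\<And>x. \<bar>\<eta> x\<bar> \<le> B"
  shows "set_integrable lebesgue S (\<lambda>x. f x * \<eta> x)"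
proof -
  have m: "\<eta> \<in> borel_measurable lebesgue"
    using measurable_compose[OF id_measurable_lebesgue assms(2)] .
  have i: "integrable lebesgue (\<lambda>x. B * (indicator S x *\<^sub>R f x))"
    using assms(1) unfolding set_integrable_def by simp
  have n: "norm ((indicator S x *\<^sub>R f x) * \<eta> x) \<le> norm (B * (indicator S x *\<^sub>R f x))" for x
    using mult_right_mono[OF assms(3)[of x], of "\<bar>f x\<bar>"] assms(3)[of x]
    by (auto simp: indicator_def abs_mult mult.commute)
  have "(\<lambda>x. (indicator S x *\<^sub>R f x) * \<eta> x) \<in> borel_measurable lebesgue"
    using assms(1) m unfolding set_integrable_def by auto
  then have "integrable lebesgue (\<lambda>x. (indicator S x *\<^sub>R f x) * \<eta> x)"
    by (rule Bochner_Integration.integrable_bound[OF i]) (use n in auto)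
  then show ?thesis by (simp add: set_integrable_def mult.assoc)
qed

text \<open>Subtracting from a test function \<open>\<psi>\<close> its mean times a fixed
  \<open>\<eta>0\<close> of integral 1 leaves the derivative of a test function, on which
  \<open>k\<close> vanishes. Hence \<open>k - C\<close> annihilates every \<open>\<psi>\<close>,
  with \<open>C\<close> the pairing of \<open>k\<close> with \<open>\<eta>0\<close>.\<close>

lemma du_bois_reymond:
  fixes k :: "real \<Rightarrow> real"
  assumes "a < b" and k: "set_integrable lebesgue {a<..<b} k"
    and zero: "\<And>\<eta>. test_function a b \<eta> \<Longrightarrow> (LINT t:{a<..<b}|lebesgue. k t * deriv \<eta> t) = 0"
  obtains C where "AE t in lebesgue. t \<in> {a<..<b} \<longrightarrow> k t = C"
proof -
  have kint: "set_integrable lebesgue {a<..<b} (\<lambda>x. k x * \<eta> x)" if \<eta>: "test_function a b \<eta>" for \<eta>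
  proof -
    obtain B where "\<And>x. \<bar>\<eta> x\<bar> \<le> B" using test_function_bounded[OF \<eta>] by blast
    then show ?thesis by (rule set_integrable_mult_bounded[OF k test_function_measurable[OF \<eta>]])
  qed
  obtain \<eta>0 where \<eta>0: "test_function a b \<eta>0" "integral {a..b} \<eta>0 = 1"
  proof -
    obtain \<eta> where \<eta>: "\<And>n::nat. test_function a b (\<eta> n)" "\<And>n x. 0 \<le> \<eta> n x" "\<And>n x. \<eta> n x \<le> 1"
      "\<And>x. (\<lambda>n. \<eta> n x) \<longlonglongrightarrow> indicator ({a<..<b} \<inter> {a<..<b}) x"
      using indicator_approx_test_function by blast
    have "(\<lambda>n. LINT x|lebesgue. indicator {a<..<b} x * \<eta> n x)
        \<longlonglongrightarrow> (LINT x|lebesgue. indicator {a<..<b} x * indicator ({a<..<b} \<inter> {a<..<b}) x)"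
      using \<eta> by (intro tendsto_integral_indicator id_measurable_lebesgue)
        (auto intro: test_function_measurable simp: integrable_indicator_iff assms(1) less_imp_le)
    moreover have "(LINT x|lebesgue. indicator {a<..<b} x * indicator ({a<..<b} \<inter> {a<..<b}) x) = b - a"
      using assms(1) by (simp flip: indicator_inter_arith)
    moreover have "(LINT x|lebesgue. indicator {a<..<b} x * \<eta> n x) = integral {a..b} (\<eta> n)" for n
      using test_function_integral(2)[OF \<eta>(1)[of n]] by (simp add: set_lebesgue_integral_def)
    ultimately have "(\<lambda>n. integral {a..b} (\<eta> n)) \<longlonglongrightarrow> b - a" by simp
    then have "eventually (\<lambda>n. integral {a..b} (\<eta> n) > 0) sequentially"
      using assms(1) by (intro order_tendstoD) auto
    then obtain n where n: "integral {a..b} (\<eta> n) > 0"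
      by (auto simp: eventually_sequentially)
    \<comment> \<open>The rule for linear combinations scales only the second summand, so division
      by the integral \<open>r\<close> is written as \<open>1 + (1 / r - 1)\<close>.\<close>
    have "test_function a b (\<lambda>x. \<eta> n x + (1 / integral {a..b} (\<eta> n) - 1) * \<eta> n x)"
      by (intro test_function_lincomb \<eta>)
    also have "(\<lambda>x. \<eta> n x + (1 / integral {a..b} (\<eta> n) - 1) * \<eta> n x) = (\<lambda>x. \<eta> n x / integral {a..b} (\<eta> n))"
      by (auto simp: field_simps)
    finally show thesis using n by (intro that) auto
  qed
  define C where "C = (LINT t:{a<..<b}|lebesgue. k t * \<eta>0 t)"
  have orth: "(LINT t:{a<..<b}|lebesgue. (k t - C) * \<psi> t) = 0" if \<psi>: "test_function a b \<psi>" for \<psi>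
  proof -
    let ?I = "integral {a..b} \<psi>"
    let ?\<zeta> = "\<lambda>x. \<psi> x + (- ?I) * \<eta>0 x"
    have \<zeta>: "test_function a b ?\<zeta>" by (intro test_function_lincomb \<psi> \<eta>0)
    have "integral {a..b} ?\<zeta> = ?I + (- ?I) * integral {a..b} \<eta>0"
      by (subst integral_add)
         (auto intro!: integrable_continuous_real continuous_intros
           continuous_on_subset[OF test_function_continuous[OF \<eta>0(1)]]
           continuous_on_subset[OF test_function_continuous[OF \<psi>]])
    then have "integral {a..b} ?\<zeta> = 0" using \<eta>0(2) by simp
    then obtain \<xi> where \<xi>: "test_function a b \<xi>" "\<And>x. deriv \<xi> x = ?\<zeta> x"
      using test_function_antiderivative[OF \<zeta> assms(1)] by blast
    have i1: "set_integrable lebesgue {a<..<b} (\<lambda>t. ?I * (k t * \<eta>0 t))"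
      by (rule set_integrable_mult_right) (rule kint[OF \<eta>0(1)])
    have i2: "set_integrable lebesgue {a<..<b} (\<lambda>t. C * \<psi> t)"
      by (rule set_integrable_mult_right) (rule test_function_integral(1)[OF \<psi>])
    have "(LINT t:{a<..<b}|lebesgue. k t * deriv \<xi> t) =
        (LINT t:{a<..<b}|lebesgue. k t * \<psi> t - ?I * (k t * \<eta>0 t))"
      by (simp add: \<xi>(2) algebra_simps)
    then have "(LINT t:{a<..<b}|lebesgue. k t * \<psi> t) = (LINT t:{a<..<b}|lebesgue. ?I * (k t * \<eta>0 t))"
      using zero[OF \<xi>(1)] set_integral_diff(2)[OF kint[OF \<psi>] i1] by linarith
    moreover have "(LINT t:{a<..<b}|lebesgue. ?I * (k t * \<eta>0 t)) = ?I * C"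
      unfolding C_def by (rule set_integral_mult_right)
    moreover have "(LINT t:{a<..<b}|lebesgue. C * \<psi> t) = C * ?I"
      unfolding test_function_integral(2)[OF \<psi>, symmetric] by (rule set_integral_mult_right)
    moreover have "(LINT t:{a<..<b}|lebesgue. (k t - C) * \<psi> t) = (LINT t:{a<..<b}|lebesgue. k t * \<psi> t - C * \<psi> t)"
      by (simp add: left_diff_distrib)
    ultimately show ?thesis
      using set_integral_diff(2)[OF kint[OF \<psi>] i2] mult.commute[of C ?I] by linarith
  qed
  have "set_integrable lebesgue {a<..<b} (\<lambda>_. C)"
    unfolding set_integrable_def using assms(1) by (intro integrable_scaleR_left) simp
  then have hint: "set_integrable lebesgue {a<..<b} (\<lambda>t. k t - C)"
    using k by (intro set_integral_diff)
  have "AE t in lebesgue. t \<in> {a<..<b} \<longrightarrow> indicator {a<..<b} t *\<^sub>R (k t - C) = 0"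
  proof (rule AE_lebesgue_zero_if_integrals_zero)
    show "integrable lebesgue (\<lambda>t. indicator {a<..<b} t *\<^sub>R (k t - C))"
      using hint by (simp add: set_integrable_def)
    fix A :: "real set" assume "A \<in> sets borel"
    then show "(LINT t|lebesgue. indicator {a<..<b} t *\<^sub>R (k t - C) * indicator (A \<inter> {a<..<b}) t) = 0"
      using test_functional_zero[of "{()}" "\<lambda>_. lebesgue" "\<lambda>_ t. indicator {a<..<b} t *\<^sub>R (k t - C)" a b A]
        hint orth id_measurable_lebesgue
      by (auto simp: set_integrable_def set_lebesgue_integral_def mult.assoc)
  qed auto
  then have "AE t in lebesgue. t \<in> {a<..<b} \<longrightarrow> k t = C"
    by eventually_elim auto
  then show thesis by (rule that)
qed

section \<open>Distribution functions of signed measures in polar form\<close>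

definition cumulative :: "real measure \<Rightarrow> (real \<Rightarrow> real) \<Rightarrow> real \<Rightarrow> real" where
  "cumulative M \<sigma> t = (LINT y|M. (if y < t then \<sigma> y else 0))"

lemma
  assumes "polar_signed_measure a b M \<sigma>"
  shows space_polar: "space M = {a<..<b}"
    and finite_measure_polar: "finite_measure M"
    and sets_polar: "A \<in> sets M \<longleftrightarrow> A \<in> sets borel \<and> A \<subseteq> {a<..<b}"
    and id_measurable_polar: "(\<lambda>x. x) \<in> measurable M borel"
    and polar_measurable: "\<sigma> \<in> borel_measurable M"
    and polar_integrable: "integrable M \<sigma>"
    and polar_abs: "x \<in> {a<..<b} \<Longrightarrow> \<bar>\<sigma> x\<bar> = 1"
proof -
  have s: "sets M = sets (restrict_space borel {a<..<b})"
    and fin: "finite_measure M" and m: "\<sigma> \<in> borel_measurable M" and one: "\<And>x. x \<in> {a<..<b} \<Longrightarrow> \<bar>\<sigma> x\<bar> = 1"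
    using assms by (auto simp: polar_signed_measure_def)
  show sp: "space M = {a<..<b}" using sets_eq_imp_space_eq[OF s] by (simp add: space_restrict_space)
  show "A \<in> sets M \<longleftrightarrow> A \<in> sets borel \<and> A \<subseteq> {a<..<b}"
    unfolding s by (subst sets_restrict_space_iff) auto
  show "(\<lambda>x. x) \<in> measurable M borel"
    by (subst measurable_cong_sets[OF s refl]) (intro measurable_restrict_space1, simp)
  interpret finite_measure M by (rule fin)
  show "integrable M \<sigma>" using m one sp by (intro integrable_const_bound[where B = 1]) auto
  show "x \<in> {a<..<b} \<Longrightarrow> \<bar>\<sigma> x\<bar> = 1" by (rule one)
  show "finite_measure M" "\<sigma> \<in> borel_measurable M" by fact+
qed

text \<open>The inner integral, with \<open>y\<close> fixed, of the Fubini argument in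
  \<open>cumulative_integration_by_parts\<close>.\<close>

lemma test_function_FTC:
  assumes "test_function a b \<eta>" "y \<in> {a<..<b}"
  shows "(LINT t|lborel. indicator {a<..<b} t * (if y < t then deriv \<eta> t else 0)) = - \<eta> y"
proof -
  have "(LINT t|lborel. indicator {a<..<b} t * (if y < t then deriv \<eta> t else 0)) =
      (LINT t|lborel. deriv \<eta> t * indicator {y..b} t)"
  proof (rule integral_cong_AE)
    show "AE t in lborel. indicator {a<..<b} t * (if y < t then deriv \<eta> t else 0) = deriv \<eta> t * indicator {y..b} t"
      using AE_lborel_singleton[of y] AE_lborel_singleton[of b]
      by eventually_elim (use assms in \<open>auto simp: indicator_def\<close>)
  next
    have [measurable]: "deriv \<eta> \<in> borel_measurable borel"
      using test_function_deriv(2)[OF assms(1)] by (intro borel_measurable_continuous_onI)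
    show "(\<lambda>t. indicator {a<..<b} t * (if y < t then deriv \<eta> t else 0)) \<in> borel_measurable lborel"
      "(\<lambda>t. deriv \<eta> t * indicator {y..b} t) \<in> borel_measurable lborel"
      by measurable
  qed
  also have "\<dots> = \<eta> b - \<eta> y"
    using assms test_function_deriv[OF assms(1)]
    by (intro has_bochner_integral_integral_eq has_bochner_integral_FTC_Icc_real)
       (auto simp: continuous_on_eq_continuous_at)
  finally show ?thesis using test_function_deriv_outside(2)[OF assms(1), of b] by simp
qed

lemma cumulative_measurable:
  assumes "polar_signed_measure a b M \<sigma>"
  shows "cumulative M \<sigma> \<in> borel_measurable borel"
proof -
  interpret finite_measure M by (rule finite_measure_polar[OF assms])
  note [measurable] = id_measurable_polar[OF assms] polar_measurable[OF assms]
  show ?thesis unfolding cumulative_def[abs_def] by measurable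
qed

lemma cumulative_bounded:
  assumes "polar_signed_measure a b M \<sigma>"
  shows "\<bar>cumulative M \<sigma> t\<bar> \<le> measure M (space M)"
proof -
  interpret finite_measure M by (rule finite_measure_polar[OF assms])
  note [measurable] = id_measurable_polar[OF assms] polar_measurable[OF assms]
  have "\<bar>cumulative M \<sigma> t\<bar> \<le> (LINT y|M. \<bar>if y < t then \<sigma> y else 0\<bar>)"
    unfolding cumulative_def by (rule integral_abs_bound)
  also have "\<dots> \<le> (LINT y|M. 1)"
    by (intro integral_mono integrable_const_bound[where B = 1])
       (use polar_abs[OF assms] space_polar[OF assms] in auto)
  finally show ?thesis by simp
qed

lemma cumulative_integrable:
  assumes "polar_signed_measure a b M \<sigma>"
  shows "set_integrable lebesgue {a<..<b} (cumulative M \<sigma>)"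
proof -
  have "integrable lborel (\<lambda>x. indicator {a<..<b} x *\<^sub>R cumulative M \<sigma> x)"
    using cumulative_measurable[OF assms] cumulative_bounded[OF assms]
    by (intro integrableI_bounded_set[where A = "{a<..<b}" and B = "measure M (space M)"])
       (use emeasure_bounded_finite[OF bounded_Ioo[of a b]] in auto)
  then show ?thesis unfolding set_integrable_def
    using integrable_completion[of "\<lambda>x. indicator {a<..<b} x *\<^sub>R cumulative M \<sigma> x" lborel] by auto
qed

text \<open>Fubini on the region \<open>y < t\<close>: integrating \<open>deriv \<eta>\<close> over
  \<open>t\<close> beyond \<open>y\<close> gives \<open>- \<eta> y\<close>, and integrating
  \<open>\<sigma>\<close> over \<open>y\<close> below \<open>t\<close> gives the distribution
  function.\<close>

lemma cumulative_integration_by_parts: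
  assumes M: "polar_signed_measure a b M \<sigma>" and \<eta>: "test_function a b \<eta>"
  shows "(LINT t:{a<..<b}|lebesgue. cumulative M \<sigma> t * deriv \<eta> t) = - (LINT y|M. \<sigma> y * \<eta> y)"
proof (cases "a < b")
  case True
  interpret finite_measure M by (rule finite_measure_polar[OF M])
  note sfM = sigma_finite_measure_axioms
  interpret pair_sigma_finite lborel M by standard
  note [measurable] = id_measurable_polar[OF M] polar_measurable[OF M]
  have [measurable]: "deriv \<eta> \<in> borel_measurable borel"
    using test_function_deriv(2)[OF \<eta>] by (intro borel_measurable_continuous_onI)
  obtain B where B: "\<And>x. \<bar>deriv \<eta> x\<bar> \<le> B" using test_function_deriv_bounded[OF \<eta>] by blast
  define F where "F t y = indicator {a<..<b} t * (if y < t then \<sigma> y * deriv \<eta> t else 0)" for t y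
  have "integrable (lborel \<Otimes>\<^sub>M M) (case_prod F)"
  proof (rule integrableI_bounded_set[where A = "{a<..<b} \<times> space M" and B = B])
    show "case_prod F \<in> borel_measurable (lborel \<Otimes>\<^sub>M M)" unfolding F_def by measurable
    show "emeasure (lborel \<Otimes>\<^sub>M M) ({a<..<b} \<times> space M) < \<infinity>"
      using True by (subst sigma_finite_measure.emeasure_pair_measure_Times[OF sfM]) (auto simp: emeasure_eq_measure ennreal_mult_less_top)
    have "norm (F t y) \<le> B" if "t \<in> {a<..<b}" "y \<in> space M" for t y
    proof -
      have "\<bar>\<sigma> y\<bar> = 1" using that(2) polar_abs[OF M] space_polar[OF M] by simp
      moreover have "0 \<le> B" using order_trans[OF abs_ge_zero B] .
      ultimately show ?thesis using that(1) B[of t] by (simp add: F_def abs_mult)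
    qed
    then show "AE x in lborel \<Otimes>\<^sub>M M. x \<in> {a<..<b} \<times> space M \<longrightarrow> norm (case_prod F x) \<le> B"
      by (intro AE_I2) (simp add: split_paired_all)
    have "F t y = 0" if "t \<notin> {a<..<b}" for t y
      using that by (simp add: F_def)
    then show "AE x in lborel \<Otimes>\<^sub>M M. x \<notin> {a<..<b} \<times> space M \<longrightarrow> case_prod F x = 0"
      by (intro AE_I2) (simp add: split_paired_all space_pair_measure)
    show "{a<..<b} \<times> space M \<in> sets (lborel \<Otimes>\<^sub>M M)"
      by (rule pair_measureI) simp_all
  qed
  then have fub: "(LINT y|M. LINT t|lborel. F t y) = (LINT t|lborel. LINT y|M. F t y)"
    by (rule Fubini_integral)
  \<comment> \<open>The product measure is formed with \<open>lborel\<close>; since the integrand is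
    Borel, leaving the completion does not change the integral.\<close>
  have "(LINT t:{a<..<b}|lebesgue. cumulative M \<sigma> t * deriv \<eta> t) =
      (LINT t:{a<..<b}|lborel. cumulative M \<sigma> t * deriv \<eta> t)"
    unfolding set_lebesgue_integral_def
    by (rule integral_completion)
      (use cumulative_measurable[OF M] in \<open>auto intro!: borel_measurable_scaleR borel_measurable_times\<close>)
  also have "\<dots> = (LINT t|lborel. LINT y|M. F t y)"
    unfolding set_lebesgue_integral_def cumulative_def F_def
  proof (intro Bochner_Integration.integral_cong refl)
    fix t
    have "(LINT y|M. indicator {a<..<b} t * (if y < t then \<sigma> y * deriv \<eta> t else 0)) =
        (LINT y|M. (indicator {a<..<b} t * deriv \<eta> t) * (if y < t then \<sigma> y else 0))"
      by (intro Bochner_Integration.integral_cong) auto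
    also have "\<dots> = (indicator {a<..<b} t * deriv \<eta> t) * (LINT y|M. (if y < t then \<sigma> y else 0))"
      by (rule Bochner_Integration.integral_mult_right_zero)
    finally show "indicator {a<..<b} t *\<^sub>R ((LINT y|M. (if y < t then \<sigma> y else 0)) * deriv \<eta> t) =
       (LINT y|M. indicator {a<..<b} t * (if y < t then \<sigma> y * deriv \<eta> t else 0))"
      by (simp only: real_scaleR_def ac_simps)
  qed
  also have "\<dots> = (LINT y|M. \<sigma> y * (- \<eta> y))"
    unfolding fub[symmetric]
  proof (intro Bochner_Integration.integral_cong refl)
    fix y assume "y \<in> space M"
    then have "y \<in> {a<..<b}" using space_polar[OF M] by simp
    have "(LINT t|lborel. F t y) = (LINT t|lborel. \<sigma> y * (indicator {a<..<b} t * (if y < t then deriv \<eta> t else 0)))"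
      unfolding F_def by (intro Bochner_Integration.integral_cong) auto
    then show "(LINT t|lborel. F t y) = \<sigma> y * (- \<eta> y)"
      using test_function_FTC[OF \<eta> \<open>y \<in> {a<..<b}\<close>] by simp
  qed
  finally show ?thesis by simp
next
  case False
  then have "space M = {}" using space_polar[OF M] by simp
  then have "(LINT y|M. \<sigma> y * \<eta> y) = (LINT y|M. 0)"
    by (intro Bochner_Integration.integral_cong) auto
  then show ?thesis using False by (simp add: set_lebesgue_integral_def)
qed

text \<open>Both sides have the same distributional derivative, so \<open>du_bois_reymond\<close>
  makes their difference constant. The right-hand side is the good representative from which the
  traces are read off.\<close>

lemma BV_representation:
  assumes "a < b" and M: "polar_signed_measure a b M \<sigma>" and w: "w absolutely_integrable_on {a<..<b}"
    and D: "\<And>\<eta>. test_function a b \<eta> \<Longrightarrow>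
      (LINT x:{a<..<b}|lebesgue. w x * deriv \<eta> x) = - (LINT x|M. \<sigma> x * \<eta> x)"
  obtains C where "AE t in lebesgue. t \<in> {a<..<b} \<longrightarrow> w t = C + cumulative M \<sigma> t"
proof -
  have "set_integrable lebesgue {a<..<b} (\<lambda>t. w t - cumulative M \<sigma> t)"
    by (intro set_integral_diff w cumulative_integrable[OF M])
  moreover have "(LINT t:{a<..<b}|lebesgue. (w t - cumulative M \<sigma> t) * deriv \<eta> t) = 0"
    if \<eta>: "test_function a b \<eta>" for \<eta>
  proof -
    have m: "deriv \<eta> \<in> borel_measurable borel"
      using test_function_deriv(2)[OF \<eta>] by (intro borel_measurable_continuous_onI)
    obtain B where B: "\<And>x. \<bar>deriv \<eta> x\<bar> \<le> B" using test_function_deriv_bounded[OF \<eta>] by blast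
    have "(LINT t:{a<..<b}|lebesgue. w t * deriv \<eta> t - cumulative M \<sigma> t * deriv \<eta> t) =
      (LINT t:{a<..<b}|lebesgue. w t * deriv \<eta> t) - (LINT t:{a<..<b}|lebesgue. cumulative M \<sigma> t * deriv \<eta> t)"
      by (intro set_integral_diff set_integrable_mult_bounded[OF _ m B] w cumulative_integrable[OF M])
    then show ?thesis
      using D[OF \<eta>] cumulative_integration_by_parts[OF M \<eta>] by (simp add: left_diff_distrib)
  qed
  ultimately obtain C where "AE t in lebesgue. t \<in> {a<..<b} \<longrightarrow> w t - cumulative M \<sigma> t = C"
    using du_bois_reymond[OF assms(1)] by blast
  then have "AE t in lebesgue. t \<in> {a<..<b} \<longrightarrow> w t = C + cumulative M \<sigma> t"
    by eventually_elim auto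
  then show thesis by (rule that)
qed

text \<open>The measure lives on the open interval, so no atom sits at \<open>a\<close> and the sets
  \<open>y < t\<close> shrink to the empty set. At the right end they exhaust the space for the same
  reason.\<close>

lemma cumulative_tendsto_left_end:
  assumes M: "polar_signed_measure a b M \<sigma>"
  shows "(cumulative M \<sigma> \<longlongrightarrow> 0) (at_right a)"
  unfolding tendsto_at_iff_sequentially comp_def cumulative_def
proof (intro allI impI)
  interpret finite_measure M by (rule finite_measure_polar[OF M])
  note [measurable] = id_measurable_polar[OF M] polar_measurable[OF M]
  fix X :: "nat \<Rightarrow> real" assume X: "\<forall>i. X i \<in> {a<..} - {a}" "X \<longlonglongrightarrow> a"
  have "(\<lambda>n. LINT y|M. (if y < X n then \<sigma> y else 0)) \<longlonglongrightarrow> (LINT y|M. 0)"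
  proof (rule integral_dominated_convergence[where w = "\<lambda>_. 1"])
    show "AE y in M. (\<lambda>n. if y < X n then \<sigma> y else 0) \<longlonglongrightarrow> 0"
    proof (rule AE_I2)
      fix y assume "y \<in> space M"
      then have "a < y" using space_polar[OF M] by simp
      then have "eventually (\<lambda>n. X n < y) sequentially" using X(2) by (intro order_tendstoD)
      then show "(\<lambda>n. if y < X n then \<sigma> y else 0) \<longlonglongrightarrow> 0"
        by (intro tendsto_eventually) (erule eventually_mono, simp)
    qed
    show "AE y in M. norm (if y < X n then \<sigma> y else 0) \<le> 1" for n
      using polar_abs[OF M] space_polar[OF M] by auto
  qed auto
  then show "(\<lambda>n. LINT y|M. (if y < X n then \<sigma> y else 0)) \<longlonglongrightarrow> 0" by simp
qed

lemma cumulative_tendsto_right_end: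
  assumes M: "polar_signed_measure a b M \<sigma>"
  shows "(cumulative M \<sigma> \<longlongrightarrow> (LINT y|M. \<sigma> y)) (at_left b)"
  unfolding tendsto_at_iff_sequentially comp_def cumulative_def
proof (intro allI impI)
  interpret finite_measure M by (rule finite_measure_polar[OF M])
  note [measurable] = id_measurable_polar[OF M] polar_measurable[OF M]
  fix X :: "nat \<Rightarrow> real" assume X: "\<forall>i. X i \<in> {..<b} - {b}" "X \<longlonglongrightarrow> b"
  show "(\<lambda>n. LINT y|M. (if y < X n then \<sigma> y else 0)) \<longlonglongrightarrow> (LINT y|M. \<sigma> y)"
  proof (rule integral_dominated_convergence[where w = "\<lambda>_. 1"])
    show "AE y in M. (\<lambda>n. if y < X n then \<sigma> y else 0) \<longlonglongrightarrow> \<sigma> y"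
    proof (rule AE_I2)
      fix y assume "y \<in> space M"
      then have "y < b" using space_polar[OF M] by simp
      then have "eventually (\<lambda>n. y < X n) sequentially" using X(2) by (intro order_tendstoD)
      then show "(\<lambda>n. if y < X n then \<sigma> y else 0) \<longlonglongrightarrow> \<sigma> y"
        by (intro tendsto_eventually) (erule eventually_mono, simp)
    qed
    show "AE y in M. norm (if y < X n then \<sigma> y else 0) \<le> 1" for n
      using polar_abs[OF M] space_polar[OF M] by auto
  qed auto
qed

section \<open>One-sided traces\<close>

lemma AE_lebesgue_interval_ex:
  assumes "AE t in lebesgue. t \<in> {c<..<d} \<longrightarrow> P t" "c < (d::real)"
  obtains t where "t \<in> {c<..<d}" "P t"
proof -
  have "\<exists>t\<in>{c<..<d}. P t"
  proof (rule ccontr)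
    assume "\<not> ?thesis"
    with assms(1) have "AE t in lebesgue. t \<notin> {c<..<d}"
      by (auto elim: eventually_mono)
    then have "emeasure lebesgue {c<..<d} = 0"
      by (subst (asm) AE_iff_measurable[where N = "{c<..<d}"]) auto
    then show False using assms(2) by simp
  qed
  then show thesis using that by blast
qed

text \<open>This justifies the \<open>THE\<close> in both traces: different limits would keep two
  representatives apart on a whole interval, which has positive measure.\<close>

lemma one_sided_limit_unique:
  fixes v v' :: "real \<Rightarrow> real"
  assumes "F = at_right a \<or> F = at_left b" "a < b"
    "AE t in lebesgue. t \<in> {a<..<b} \<longrightarrow> v t = v' t" "(v \<longlongrightarrow> c) F" "(v' \<longlongrightarrow> c') F"
  shows "c = c'"
proof (rule ccontr)
  assume "c \<noteq> c'"
  have "((\<lambda>t. v t - v' t) \<longlongrightarrow> c - c') F" by (intro tendsto_diff assms)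
  then have ev: "eventually (\<lambda>t. v t - v' t \<noteq> 0) F"
    using \<open>c \<noteq> c'\<close> by (intro tendsto_imp_eventually_ne) auto
  obtain p q where pq: "p < q" "{p<..<q} \<subseteq> {a<..<b}" "\<And>t. t \<in> {p<..<q} \<Longrightarrow> v t \<noteq> v' t"
  proof (cases "F = at_right a")
    case True
    with ev obtain e where "e > a" "\<And>t. a < t \<Longrightarrow> t < e \<Longrightarrow> v t \<noteq> v' t"
      by (auto simp: eventually_at_right_field)
    then show thesis using assms(2) by (intro that[of a "min b e"]) auto
  next
    case False
    with ev assms(1) obtain e where "e < b" "\<And>t. e < t \<Longrightarrow> t < b \<Longrightarrow> v t \<noteq> v' t"
      by (auto simp: eventually_at_left_field)
    then show thesis using assms(2) by (intro that[of "max a e" b]) auto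
  qed
  have "AE t in lebesgue. t \<in> {p<..<q} \<longrightarrow> v t = v' t"
    using assms(3) by eventually_elim (use pq in auto)
  from AE_lebesgue_interval_ex[OF this pq(1)] pq(3) show False by metis
qed

lemma
  assumes "a < b" "AE t in lebesgue. t \<in> {a<..<b} \<longrightarrow> v t = w t"
  shows trace_left_end_eqI: "(v \<longlongrightarrow> c) (at_right a) \<Longrightarrow> trace_left_end a b w = c"
    and trace_right_end_eqI: "(v \<longlongrightarrow> c) (at_left b) \<Longrightarrow> trace_right_end a b w = c"
proof -
  have *: "AE t in lebesgue. t \<in> {a<..<b} \<longrightarrow> v' t = v t"
    if "AE t in lebesgue. t \<in> {a<..<b} \<longrightarrow> v' t = w t" for v'
    using that assms(2) by eventually_elim auto
  show "trace_left_end a b w = c" if "(v \<longlongrightarrow> c) (at_right a)"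
    unfolding trace_left_end_def
    by (rule the_equality) (use assms that one_sided_limit_unique[of "at_right a" a b] * in blast)+
  show "trace_right_end a b w = c" if "(v \<longlongrightarrow> c) (at_left b)"
    unfolding trace_right_end_def
    by (rule the_equality) (use assms that one_sided_limit_unique[of "at_left b" a b] * in blast)+
qed

section \<open>Absolutely continuous functions and uniqueness of the Lebesgue decomposition\<close>

text \<open>Views \<open>p dx\<close> as a measure in polar form, so that what holds for
  distribution functions applies to absolutely continuous functions. The density is first replaced
  by a Borel representative, since the measure must live on the Borel sets of the interval.\<close>

lemma density_polar:
  assumes p: "set_integrable lebesgue {a<..<b} p"
  obtains M \<sigma> where "polar_signed_measure a b M \<sigma>"
    "\<And>\<eta>. \<eta> \<in> borel_measurable borel \<Longrightarrow>
       (LINT y|M. \<sigma> y * \<eta> y) = (LINT t:{a<..<b}|lebesgue. p t * \<eta> t)"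
proof -
  have pm: "(\<lambda>x. indicator {a<..<b} x *\<^sub>R p x) \<in> borel_measurable lebesgue"
    using p by (auto simp: set_integrable_def)
  then obtain q where q: "q \<in> borel_measurable lborel" "AE x in lborel. indicator {a<..<b} x *\<^sub>R p x = q x"
    using completion_ex_borel_measurable_real by blast
  have pq: "AE x in lebesgue. indicator {a<..<b} x *\<^sub>R p x = q x"
    using q(2) by (rule AE_completion)
  have [measurable]: "q \<in> borel_measurable borel" using q(1) by simp
  have "integrable lebesgue q"
    by (rule Bochner_Integration.integrable_cong_AE_imp[of lebesgue "\<lambda>x. indicator {a<..<b} x *\<^sub>R p x"])
      (use p pq q(1) in \<open>auto simp: set_integrable_def intro: measurable_completion elim: eventually_mono\<close>)
  then have qint: "integrable lborel q" using integrable_completion q(1) by blast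
  define L where "L = restrict_space lborel {a<..<b}"
  define M where "M = density L (\<lambda>x. ennreal \<bar>q x\<bar>)"
  \<comment> \<open>The value 1 where \<open>q\<close> vanishes keeps the modulus equal to one
    everywhere, as the polar form requires.\<close>
  define \<sigma> where "\<sigma> x = (if q x < 0 then - 1 else 1::real)" for x
  have Lm: "f \<in> borel_measurable borel \<Longrightarrow> f \<in> borel_measurable L" for f :: "real \<Rightarrow> real"
    unfolding L_def by (intro measurable_restrict_space1) simp
  have \<sigma>m [measurable]: "\<sigma> \<in> borel_measurable borel" unfolding \<sigma>_def[abs_def] by measurable
  have sp: "space M = {a<..<b}" by (simp add: M_def L_def space_restrict_space)
  have "emeasure M (space M) = (\<integral>\<^sup>+x. ennreal \<bar>q x\<bar> * indicator (space M) x \<partial>L)"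
    unfolding M_def using Lm[of q] by (intro emeasure_density) auto
  also have "\<dots> = (\<integral>\<^sup>+x. ennreal \<bar>q x\<bar> \<partial>L)"
    by (intro nn_integral_cong) (auto simp: M_def)
  also have "\<dots> = (\<integral>\<^sup>+x. ennreal \<bar>q x\<bar> * indicator {a<..<b} x \<partial>lborel)"
    unfolding L_def by (rule nn_integral_restrict_space) simp
  also have "\<dots> \<le> (\<integral>\<^sup>+x. ennreal \<bar>q x\<bar> \<partial>lborel)"
    by (intro nn_integral_mono) (auto simp: indicator_def)
  also have "\<dots> < \<infinity>" using qint by (simp add: integrable_iff_bounded)
  finally have fin: "finite_measure M" by (intro finite_measureI) (auto simp: less_top)
  have "sets M = sets (restrict_space borel {a<..<b})"
    unfolding M_def L_def by (simp cong: sets_restrict_space_cong)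
  then have "polar_signed_measure a b M \<sigma>"
    using fin Lm[OF \<sigma>m] by (auto simp: polar_signed_measure_def \<sigma>_def M_def)
  moreover have "(LINT y|M. \<sigma> y * \<eta> y) = (LINT t:{a<..<b}|lebesgue. p t * \<eta> t)"
    if \<eta>[measurable]: "\<eta> \<in> borel_measurable borel" for \<eta>
  proof -
    have "(LINT y|M. \<sigma> y * \<eta> y) = (LINT y|L. \<bar>q y\<bar> *\<^sub>R (\<sigma> y * \<eta> y))"
      unfolding M_def by (intro integral_density Lm) (simp_all add: borel_measurable_abs)
    also have "\<dots> = (LINT y|L. q y * \<eta> y)"
      by (intro Bochner_Integration.integral_cong) (auto simp: \<sigma>_def)
    also have "\<dots> = (LINT y|lborel. indicator {a<..<b} y *\<^sub>R (q y * \<eta> y))"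
      unfolding L_def by (rule integral_restrict_space) simp
    also have "\<dots> = (LINT y|lebesgue. indicator {a<..<b} y *\<^sub>R (q y * \<eta> y))"
      by (rule integral_completion[symmetric]) simp
    also have "\<dots> = (LINT y|lebesgue. indicator {a<..<b} y *\<^sub>R (p y * \<eta> y))"
    proof (rule integral_cong_AE)
      show "AE y in lebesgue. indicator {a<..<b} y *\<^sub>R (q y * \<eta> y) = indicator {a<..<b} y *\<^sub>R (p y * \<eta> y)"
        using pq by eventually_elim (auto simp: indicator_def)
      show "(\<lambda>y. indicator {a<..<b} y *\<^sub>R (q y * \<eta> y)) \<in> borel_measurable lebesgue"
        by (intro measurable_completion) simp
      have "(\<lambda>y. (indicator {a<..<b} y *\<^sub>R p y) * \<eta> y) \<in> borel_measurable lebesgue"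
        using pm measurable_compose[OF id_measurable_lebesgue \<eta>] by (intro borel_measurable_times)
      then show "(\<lambda>y. indicator {a<..<b} y *\<^sub>R (p y * \<eta> y)) \<in> borel_measurable lebesgue"
        by (simp add: mult.assoc)
    qed
    finally show ?thesis by (simp add: set_lebesgue_integral_def)
  qed
  ultimately show thesis by (rule that)
qed

lemma LINT_indicator_eq_integral:
  fixes p :: "real \<Rightarrow> real"
  assumes "set_integrable lebesgue {a<..<b} p" "t \<in> {a..b}"
  shows "(LINT x:{a<..<b}|lebesgue. p x * indicator {..<t} x) = integral {a..t} p"
proof -
  have "(LINT x:{a<..<b}|lebesgue. p x * indicator {..<t} x) = (LINT x:{a<..<t}|lebesgue. p x)"
    unfolding set_lebesgue_integral_def
    by (intro Bochner_Integration.integral_cong) (use assms(2) in \<open>auto split: split_indicator\<close>)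
  also have "\<dots> = integral {a<..<t} p"
    by (intro set_lebesgue_integral_eq_integral(2) set_integrable_subset[OF assms(1)]) (use assms(2) in auto)
  finally show ?thesis by (simp add: integral_open_interval_real)
qed

lemma absolutely_integrable_Icc_iff_Ioo:
  fixes p :: "real \<Rightarrow> real"
  shows "p absolutely_integrable_on {a..b} \<longleftrightarrow> p absolutely_integrable_on {a<..<b}"
  by (simp add: absolutely_integrable_on_def integrable_on_Icc_iff_Ioo)

lemma integral_deriv_test_function:
  assumes "test_function a b \<eta>" "a < b"
  shows "(LINT t:{a<..<b}|lebesgue. deriv \<eta> t) = 0"
proof -
  have "(deriv \<eta> has_integral \<eta> b - \<eta> a) {a..b}"
    using assms(2) test_function_deriv(1)[OF assms(1)]
    by (intro fundamental_theorem_of_calculus)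
       (auto simp: has_real_derivative_iff_has_vector_derivative intro: has_vector_derivative_at_within)
  then have "integral {a..b} (deriv \<eta>) = 0"
    using test_function_deriv_outside(2)[OF assms(1)] by (simp add: integral_unique)
  moreover have "deriv \<eta> absolutely_integrable_on {a..b}"
    by (intro absolutely_integrable_continuous_real continuous_on_subset[OF test_function_deriv(2)[OF assms(1)]]) simp
  ultimately show ?thesis
    using set_lebesgue_integral_eq_integral(2)[of "{a<..<b}" "deriv \<eta>"]
    by (simp add: absolutely_integrable_Icc_iff_Ioo integral_open_interval_real)
qed

text \<open>The primitive of \<open>p\<close> is the distribution function of \<open>p dx\<close>,
  so this is \<open>cumulative_integration_by_parts\<close>; the constant drops out because
  \<open>deriv \<eta>\<close> has mean zero.\<close>

lemma absolutely_continuous_integration_by_parts: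
  assumes "a < b" and p: "set_integrable lebesgue {a<..<b} p"
    and w: "\<And>t. t \<in> {a<..<b} \<Longrightarrow> w t = C + integral {a..t} p" and \<eta>: "test_function a b \<eta>"
  shows "(LINT t:{a<..<b}|lebesgue. w t * deriv \<eta> t) = - (LINT t:{a<..<b}|lebesgue. p t * \<eta> t)"
proof -
  obtain M \<sigma> where M: "polar_signed_measure a b M \<sigma>" "\<And>\<eta>. \<eta> \<in> borel_measurable borel \<Longrightarrow>
       (LINT y|M. \<sigma> y * \<eta> y) = (LINT t:{a<..<b}|lebesgue. p t * \<eta> t)"
    using density_polar[OF p] by blast
  have cum: "cumulative M \<sigma> t = integral {a..t} p" if "t \<in> {a<..<b}" for t
  proof -
    have "cumulative M \<sigma> t = (LINT y|M. \<sigma> y * indicator {..<t} y)"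
      unfolding cumulative_def by (intro Bochner_Integration.integral_cong) (auto simp: indicator_def)
    also have "\<dots> = (LINT t':{a<..<b}|lebesgue. p t' * indicator {..<t} t')" by (intro M) simp
    also have "\<dots> = integral {a..t} p" using that by (intro LINT_indicator_eq_integral p) auto
    finally show ?thesis .
  qed
  have m: "deriv \<eta> \<in> borel_measurable borel"
    using test_function_deriv(2)[OF \<eta>] by (intro borel_measurable_continuous_onI)
  obtain B where B: "\<And>x. \<bar>deriv \<eta> x\<bar> \<le> B" using test_function_deriv_bounded[OF \<eta>] by blast
  have "set_integrable lebesgue {a<..<b} (\<lambda>_. C)"
    unfolding set_integrable_def using assms(1) by (intro integrable_scaleR_left) simp
  then have i1: "set_integrable lebesgue {a<..<b} (\<lambda>t. C * deriv \<eta> t)"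
    by (rule set_integrable_mult_bounded[OF _ m B])
  have i2: "set_integrable lebesgue {a<..<b} (\<lambda>t. cumulative M \<sigma> t * deriv \<eta> t)"
    by (rule set_integrable_mult_bounded[OF cumulative_integrable[OF M(1)] m B])
  have "(LINT t:{a<..<b}|lebesgue. w t * deriv \<eta> t) =
      (LINT t:{a<..<b}|lebesgue. C * deriv \<eta> t + cumulative M \<sigma> t * deriv \<eta> t)"
    by (intro set_lebesgue_integral_cong) (auto simp: w cum algebra_simps)
  also have "\<dots> = (LINT t:{a<..<b}|lebesgue. C * deriv \<eta> t) + (LINT t:{a<..<b}|lebesgue. cumulative M \<sigma> t * deriv \<eta> t)"
    by (rule set_integral_add[OF i1 i2])
  also have "(LINT t:{a<..<b}|lebesgue. C * deriv \<eta> t) = C * (LINT t:{a<..<b}|lebesgue. deriv \<eta> t)"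
    by (rule set_integral_mult_right)
  also have "(LINT t:{a<..<b}|lebesgue. cumulative M \<sigma> t * deriv \<eta> t) = - (LINT y|M. \<sigma> y * \<eta> y)"
    by (rule cumulative_integration_by_parts[OF M(1) \<eta>])
  finally show ?thesis
    using integral_deriv_test_function[OF \<eta> assms(1)] M(2)[OF test_function_measurable[OF \<eta>]] by simp
qed

lemma AE_constant_continuous:
  fixes f :: "real \<Rightarrow> real"
  assumes "a < b" "continuous_on {a..b} f" "AE t in lebesgue. t \<in> {a<..<b} \<longrightarrow> f t = C" "x \<in> {a..b}"
  shows "f x = C"
proof (rule ccontr)
  assume "f x \<noteq> C"
  then obtain d where d: "d > 0" "\<And>y. y \<in> {a..b} \<Longrightarrow> dist y x < d \<Longrightarrow> dist (f y) (f x) < \<bar>f x - C\<bar>"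
    using assms(2,4) unfolding continuous_on_iff by (metis zero_less_abs_iff right_minus_eq)
  define p q where "p = max a (x - d)" and "q = min b (x + d)"
  have pq: "p < q" using assms(1,4) d(1) by (auto simp: p_def q_def)
  have "AE t in lebesgue. t \<in> {p<..<q} \<longrightarrow> f t = C"
    using assms(3) by eventually_elim (auto simp: p_def q_def)
  from AE_lebesgue_interval_ex[OF this pq] obtain t where t: "t \<in> {p<..<q}" "f t = C" .
  have "dist (f t) (f x) < \<bar>f x - C\<bar>"
    using t(1) by (intro d) (auto simp: p_def q_def dist_real_def)
  then show False using t(2) by (simp add: dist_real_def)
qed

text \<open>The difference of \<open>u\<close> and the primitive of \<open>f\<close> has weak
  derivative zero, hence is constant almost everywhere, and everywhere on the closed interval by
  continuity.\<close>

lemma weak_derivative_absolutely_continuous: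
  assumes "a < b" and u: "continuous_on {a..b} u" and f: "set_integrable lebesgue {a<..<b} f"
    and D: "\<And>\<eta>. test_function a b \<eta> \<Longrightarrow>
        (LINT x:{a<..<b}|lebesgue. u x * deriv \<eta> x) = - (LINT x:{a<..<b}|lebesgue. f x * \<eta> x)"
    and x: "x \<in> {a..b}"
  shows "u x = u a + integral {a..x} f"
proof -
  have fi: "f integrable_on {a..b}"
    using f absolutely_integrable_Icc_iff_Ioo set_lebesgue_integral_eq_integral(1) by blast
  have uc: "continuous_on {a..b} (\<lambda>x. u x - integral {a..x} f)"
    by (intro continuous_on_diff u indefinite_integral_continuous_1 fi)
  have ui: "set_integrable lebesgue {a<..<b} (\<lambda>x. u x - integral {a..x} f)"
    using absolutely_integrable_continuous_real[OF uc] by (simp add: absolutely_integrable_Icc_iff_Ioo)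
  have ii: "set_integrable lebesgue {a<..<b} (\<lambda>x. integral {a..x} f)"
    using absolutely_integrable_continuous_real[OF indefinite_integral_continuous_1[OF fi]]
    by (simp add: absolutely_integrable_Icc_iff_Ioo)
  have u': "set_integrable lebesgue {a<..<b} u"
    using absolutely_integrable_continuous_real[OF u] by (simp add: absolutely_integrable_Icc_iff_Ioo)
  have "(LINT t:{a<..<b}|lebesgue. (u t - integral {a..t} f) * deriv \<eta> t) = 0" if \<eta>: "test_function a b \<eta>" for \<eta>
  proof -
    have m: "deriv \<eta> \<in> borel_measurable borel"
      using test_function_deriv(2)[OF \<eta>] by (intro borel_measurable_continuous_onI)
    obtain B where B: "\<And>x. \<bar>deriv \<eta> x\<bar> \<le> B" using test_function_deriv_bounded[OF \<eta>] by blast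
    have "(LINT t:{a<..<b}|lebesgue. u t * deriv \<eta> t - integral {a..t} f * deriv \<eta> t) =
        (LINT t:{a<..<b}|lebesgue. u t * deriv \<eta> t) - (LINT t:{a<..<b}|lebesgue. integral {a..t} f * deriv \<eta> t)"
      by (rule set_integral_diff(2)[OF set_integrable_mult_bounded[OF u' m B] set_integrable_mult_bounded[OF ii m B]])
    then show ?thesis
      using D[OF \<eta>] absolutely_continuous_integration_by_parts[OF assms(1) f _ \<eta>, of "\<lambda>t. integral {a..t} f" 0]
      by (simp add: left_diff_distrib)
  qed
  then obtain C where C: "AE t in lebesgue. t \<in> {a<..<b} \<longrightarrow> u t - integral {a..t} f = C"
    using du_bois_reymond[OF assms(1) ui] by blast
  have "u x - integral {a..x} f = C" "u a - integral {a..a} f = C"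
    using AE_constant_continuous[OF assms(1) uc C x] AE_constant_continuous[OF assms(1) uc C, of a] assms(1)
    by simp_all
  then show ?thesis by simp
qed

lemma L2_on_imp_set_integrable:
  assumes "L2_on a b f"
  shows "set_integrable lebesgue {a<..<b} f"
proof -
  have "integrable lebesgue (\<lambda>x. indicator {a<..<b} x *\<^sub>R (1::real))"
    using integrable_real_indicator[of "{a<..<b}" lebesgue] emeasure_bounded_finite[OF bounded_Ioo[of a b]] by simp
  then have i: "integrable lebesgue (\<lambda>x. indicator {a<..<b} x *\<^sub>R 1 + indicator {a<..<b} x *\<^sub>R (f x)\<^sup>2)"
    using assms by (intro Bochner_Integration.integrable_add) (auto simp: L2_on_def set_integrable_def)
  have "\<bar>y\<bar> \<le> 1 + y\<^sup>2" for y :: real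
    using zero_le_power2[of "\<bar>y\<bar> - 1"] by (simp add: power2_eq_square algebra_simps)
  then show ?thesis unfolding set_integrable_def
    by (intro Bochner_Integration.integrable_bound[OF i])
       (use assms in \<open>auto simp: L2_on_def set_borel_measurable_def indicator_def\<close>)
qed

text \<open>Two decompositions of one function represent the same functional. Their difference
  involves Lebesgue measure, \<open>M1\<close> and \<open>M2\<close>, and
  \<open>test_functional_zero\<close> transfers its vanishing from test functions to Borel
  sets.\<close>

lemma BV_decomposition_functional_eq:
  assumes "BV_decomposition a b w f1 M1 \<sigma>1" "BV_decomposition a b w f2 M2 \<sigma>2" "A \<in> sets borel"
  shows "(LINT x|lebesgue. (indicator {a<..<b} x *\<^sub>R (f1 x - f2 x)) * indicator (A \<inter> {a<..<b}) x)
     = (LINT x|M2. \<sigma>2 x * indicator (A \<inter> {a<..<b}) x) - (LINT x|M1. \<sigma>1 x * indicator (A \<inter> {a<..<b}) x)"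
proof -
  have f: "set_integrable lebesgue {a<..<b} f1" "set_integrable lebesgue {a<..<b} f2"
    and P1: "polar_signed_measure a b M1 \<sigma>1" and P2: "polar_signed_measure a b M2 \<sigma>2"
    and D1: "\<And>\<eta>. test_function a b \<eta> \<Longrightarrow> (LINT x:{a<..<b}|lebesgue. w x * deriv \<eta> x)
          = - ((LINT x:{a<..<b}|lebesgue. f1 x * \<eta> x) + (LINT x|M1. \<sigma>1 x * \<eta> x))"
    and D2: "\<And>\<eta>. test_function a b \<eta> \<Longrightarrow> (LINT x:{a<..<b}|lebesgue. w x * deriv \<eta> x)
          = - ((LINT x:{a<..<b}|lebesgue. f2 x * \<eta> x) + (LINT x|M2. \<sigma>2 x * \<eta> x))"
    using assms(1,2) by (auto simp: BV_decomposition_def)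
  define \<mu> where "\<mu> i = (if i = 0 then lebesgue else if i = 1 then M1 else M2)" for i :: nat
  define h where "h i x = (if i = 0 then indicator {a<..<b} x *\<^sub>R (f1 x - f2 x) else if i = 1 then \<sigma>1 x else - \<sigma>2 x)"
    for i :: nat and x
  have "(\<Sum>i\<in>{..<3}. LINT x|\<mu> i. h i x * indicator (A \<inter> {a<..<b}) x) = 0"
  proof (rule test_functional_zero)
    show "(\<lambda>x. x) \<in> measurable (\<mu> i) borel" for i
      using id_measurable_lebesgue id_measurable_polar[OF P1] id_measurable_polar[OF P2] by (simp add: \<mu>_def)
    show "integrable (\<mu> i) (h i)" for i
      using polar_integrable[OF P1] polar_integrable[OF P2] set_integral_diff(1)[OF f]
      by (simp add: \<mu>_def h_def[abs_def] set_integrable_def)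
    fix \<eta> assume \<eta>: "test_function a b \<eta>"
    obtain B where B: "\<And>x. \<bar>\<eta> x\<bar> \<le> B" using test_function_bounded[OF \<eta>] by blast
    have i: "set_integrable lebesgue {a<..<b} (\<lambda>x. f1 x * \<eta> x)" "set_integrable lebesgue {a<..<b} (\<lambda>x. f2 x * \<eta> x)"
      using f by (auto intro!: set_integrable_mult_bounded[OF _ test_function_measurable[OF \<eta>] B])
    have "(LINT x|lebesgue. indicator {a<..<b} x *\<^sub>R (f1 x - f2 x) * \<eta> x) =
       (LINT x:{a<..<b}|lebesgue. f1 x * \<eta> x - f2 x * \<eta> x)"
      by (simp add: set_lebesgue_integral_def algebra_simps)
    also have "\<dots> = (LINT x:{a<..<b}|lebesgue. f1 x * \<eta> x) - (LINT x:{a<..<b}|lebesgue. f2 x * \<eta> x)"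
      by (rule set_integral_diff(2)[OF i])
    finally show "(\<Sum>i\<in>{..<3}. LINT x|\<mu> i. h i x * \<eta> x) = 0"
      using D1[OF \<eta>] D2[OF \<eta>] by (simp add: numeral_3_eq_3 \<mu>_def h_def)
  qed (use assms(3) in auto)
  then show ?thesis by (simp add: numeral_3_eq_3 \<mu>_def h_def)
qed

text \<open>Away from \<open>N1\<close> and \<open>N2\<close> both singular measures vanish, so the
  densities integrate alike there; the removed sets are Lebesgue null.\<close>

lemma BV_decomposition_ac_unique:
  assumes D: "BV_decomposition a b w f1 M1 \<sigma>1" "BV_decomposition a b w f2 M2 \<sigma>2"
  shows "AE x in lebesgue. x \<in> {a<..<b} \<longrightarrow> f1 x = f2 x"
proof -
  have f: "set_integrable lebesgue {a<..<b} f1" "set_integrable lebesgue {a<..<b} f2"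
    and P1: "polar_signed_measure a b M1 \<sigma>1" and P2: "polar_signed_measure a b M2 \<sigma>2"
    using D by (auto simp: BV_decomposition_def)
  obtain N1 where N1: "N1 \<in> sets M1" "emeasure lborel N1 = 0" "emeasure M1 ({a<..<b} - N1) = 0"
    using D by (auto simp: BV_decomposition_def)
  obtain N2 where N2: "N2 \<in> sets M2" "emeasure lborel N2 = 0" "emeasure M2 ({a<..<b} - N2) = 0"
    using D by (auto simp: BV_decomposition_def)
  define S where "S = {a<..<b} - (N1 \<union> N2)"
  have Nb: "N1 \<in> sets borel" "N2 \<in> sets borel" using N1 N2 sets_polar[OF P1] sets_polar[OF P2] by auto
  have zero: "(LINT x|M. \<sigma> x * indicator (A \<inter> {a<..<b}) x) = 0"
    if "emeasure M ({a<..<b} - N) = 0" "N \<inter> A = {}" "polar_signed_measure a b M \<sigma>" "N \<in> sets M" for M \<sigma> N A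
  proof (rule integral_eq_zero_AE)
    have "{a<..<b} - N \<in> null_sets M" using that sets_polar[OF that(3)] by (auto simp: null_sets_def)
    then show "AE x in M. \<sigma> x * indicator (A \<inter> {a<..<b}) x = 0"
      by (rule AE_I') (use that(2) in \<open>auto simp: indicator_def\<close>)
  qed
  have "AE x in lebesgue. x \<in> S \<longrightarrow> indicator {a<..<b} x *\<^sub>R (f1 x - f2 x) = 0"
  proof (rule AE_lebesgue_zero_if_integrals_zero)
    show "integrable lebesgue (\<lambda>x. indicator {a<..<b} x *\<^sub>R (f1 x - f2 x))"
      using set_integral_diff(1)[OF f] by (simp add: set_integrable_def)
    show S: "S \<in> sets borel" using Nb by (auto simp: S_def)
    fix A :: "real set" assume A: "A \<in> sets borel"
    have "A \<inter> S \<inter> {a<..<b} = A \<inter> S" "N1 \<inter> (A \<inter> S) = {}" "N2 \<inter> (A \<inter> S) = {}"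
      by (auto simp: S_def)
    then show "(LINT x|lebesgue. indicator {a<..<b} x *\<^sub>R (f1 x - f2 x) * indicator (A \<inter> S) x) = 0"
      using BV_decomposition_functional_eq[OF D, of "A \<inter> S"] A S
        zero[OF N1(3) _ P1 N1(1), of "A \<inter> S"] zero[OF N2(3) _ P2 N2(1), of "A \<inter> S"]
      by simp
  qed
  moreover have "AE x in lebesgue. x \<notin> N1 \<and> x \<notin> N2"
    using Nb N1(2) N2(2) by (intro AE_completion AE_conjI AE_not_in) (auto simp: null_sets_def)
  ultimately show ?thesis by eventually_elim (auto simp: S_def)
qed

text \<open>\<open>sing_variation\<close> is picked by choice; for an absolutely continuous function
  this shows that every possible pick is null. On the parts of the carrier \<open>N\<close> where
  \<open>\<sigma>1\<close> is 1 or -1 the Lebesgue term vanishes because \<open>N\<close> is null,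
  so the mass of \<open>M1\<close> there must vanish as well.\<close>

lemma BV_decomposition_singular_zero:
  assumes D: "BV_decomposition a b w f1 M1 \<sigma>1" "BV_decomposition a b w f2 M2 \<sigma>2"
    and M2: "emeasure M2 (space M2) = 0"
  shows "emeasure M1 (space M1) = 0"
proof -
  have P1: "polar_signed_measure a b M1 \<sigma>1" and P2: "polar_signed_measure a b M2 \<sigma>2"
    using D by (auto simp: BV_decomposition_def)
  interpret finite_measure M1 by (rule finite_measure_polar[OF P1])
  obtain N where N: "N \<in> sets M1" "emeasure lborel N = 0" "emeasure M1 ({a<..<b} - N) = 0"
    using D by (auto simp: BV_decomposition_def)
  have Nb: "N \<in> sets borel" "N \<subseteq> {a<..<b}" using N sets_polar[OF P1] by auto
  have ae2: "AE x in M2. P x" for P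
    using M2 by (intro AE_I'[of "space M2"]) (auto simp: null_sets_def)
  have z: "measure M1 ({x\<in>space M1. \<sigma>1 x = s} \<inter> N) = 0" if s: "s = 1 \<or> s = - 1" for s
  proof -
    let ?A = "{x\<in>space M1. \<sigma>1 x = s} \<inter> N"
    have A1: "?A \<in> sets M1" using polar_measurable[OF P1] N(1) by auto
    then have A: "?A \<in> sets borel" "?A \<inter> {a<..<b} = ?A" using sets_polar[OF P1] by auto
    have "(LINT x|lebesgue. indicator {a<..<b} x *\<^sub>R (f1 x - f2 x) * indicator ?A x) = 0"
    proof (rule integral_eq_zero_AE)
      have "AE x in lebesgue. x \<notin> N"
        using Nb N(2) by (intro AE_completion AE_not_in) (auto simp: null_sets_def)
      then show "AE x in lebesgue. indicator {a<..<b} x *\<^sub>R (f1 x - f2 x) * indicator ?A x = 0"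
        by eventually_elim auto
    qed
    moreover have "(LINT x|M2. \<sigma>2 x * indicator ?A x) = 0" by (rule integral_eq_zero_AE[OF ae2])
    ultimately have "(LINT x|M1. \<sigma>1 x * indicator ?A x) = 0"
      using BV_decomposition_functional_eq[OF D A(1)] A(2) by simp
    moreover have "(LINT x|M1. \<sigma>1 x * indicator ?A x) = (LINT x|M1. s * indicator ?A x)"
      by (intro Bochner_Integration.integral_cong) (auto simp: indicator_def)
    moreover have "(LINT x|M1. s * indicator ?A x) = s * measure M1 ?A" using A1 by simp
    ultimately show ?thesis using s by auto
  qed
  have "\<sigma>1 x = 1 \<or> \<sigma>1 x = - 1" if "x \<in> space M1" for x
    using polar_abs[OF P1, of x] space_polar[OF P1] that by (simp add: abs_if split: if_splits)
  then have cover: "space M1 \<subseteq> ({x\<in>space M1. \<sigma>1 x = 1} \<inter> N) \<union> ({x\<in>space M1. \<sigma>1 x = - 1} \<inter> N) \<union> ({a<..<b} - N)"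
    using space_polar[OF P1] by blast
  have S: "{x\<in>space M1. \<sigma>1 x = 1} \<inter> N \<in> sets M1" "{x\<in>space M1. \<sigma>1 x = - 1} \<inter> N \<in> sets M1"
    using polar_measurable[OF P1] N(1) by auto
  have "{a<..<b} - N \<in> sets M1"
    unfolding space_polar[OF P1, symmetric] by (intro sets.Diff sets.top N)
  note S = S this
  have "emeasure M1 (space M1) \<le> emeasure M1 (({x\<in>space M1. \<sigma>1 x = 1} \<inter> N) \<union> ({x\<in>space M1. \<sigma>1 x = - 1} \<inter> N) \<union> ({a<..<b} - N))"
    using S by (intro emeasure_mono cover sets.Un)
  also have "\<dots> \<le> emeasure M1 ({x\<in>space M1. \<sigma>1 x = 1} \<inter> N) + emeasure M1 ({x\<in>space M1. \<sigma>1 x = - 1} \<inter> N)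
      + emeasure M1 ({a<..<b} - N)"
    using S by (intro order_trans[OF emeasure_subadditive] add_right_mono emeasure_subadditive sets.Un)
  also have "\<dots> = 0" using z[of 1] z[of "- 1"] N(3) by (simp add: emeasure_eq_measure)
  finally show ?thesis by simp
qed

section \<open>Existence of the Lebesgue decomposition, traces and Sobolev functions\<close>

text \<open>\<open>N\<close> is the union of a maximizing sequence for the \<open>M\<close>-measure
  among the \<open>L\<close>-null sets. A disjoint \<open>L\<close>-null set of positive
  \<open>M\<close>-measure could be added to \<open>N\<close> and would exceed the supremum.\<close>

lemma (in finite_measure) ex_maximal_null_set:
  assumes "\<And>A. A \<in> sets M \<Longrightarrow> A \<in> sets L"
  obtains N where "N \<in> sets M" "emeasure L N = 0"
    "\<And>A. A \<in> sets M \<Longrightarrow> emeasure L A = 0 \<Longrightarrow> A \<inter> N = {} \<Longrightarrow> emeasure M A = 0"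
proof -
  define Z where "Z = {A \<in> sets M. emeasure L A = 0}"
  define S where "S = (SUP A\<in>Z. measure M A)"
  have bdd: "bdd_above (measure M ` Z)"
    by (intro bdd_aboveI[of _ "measure M (space M)"]) (auto intro: bounded_measure)
  have "{} \<in> Z" by (simp add: Z_def)
  have "\<exists>A\<in>Z. S - 1 / Suc n < measure M A" for n
  proof -
    have "S - 1 / Suc n < S" by simp
    then show ?thesis unfolding S_def using \<open>{} \<in> Z\<close> bdd less_cSUP_iff[of Z "measure M"] by blast
  qed
  then obtain A where A: "\<And>n. A n \<in> Z" "\<And>n::nat. S - 1 / Suc n < measure M (A n)" by metis
  define N where "N = (\<Union>n. A n)"
  have AM: "A n \<in> sets M" for n using A(1)[of n] by (simp add: Z_def)
  then have N: "N \<in> sets M" by (auto simp: N_def)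
  have "emeasure L N \<le> (\<Sum>n. emeasure L (A n))"
    unfolding N_def using AM assms by (intro emeasure_subadditive_countably) auto
  also have "(\<Sum>n. emeasure L (A n)) = 0" using A(1) by (simp add: Z_def)
  finally have N0: "emeasure L N = 0" by simp
  have "S \<le> measure M N"
  proof (rule LIMSEQ_le_const2)
    show "(\<lambda>n. S - 1 / Suc n) \<longlonglongrightarrow> S"
      using tendsto_diff[OF tendsto_const[of S] LIMSEQ_inverse_real_of_nat] by (simp add: inverse_eq_divide)
    have "measure M (A n) \<le> measure M N" for n using N by (intro finite_measure_mono) (auto simp: N_def)
    then show "\<exists>k. \<forall>n\<ge>k. S - 1 / Suc n \<le> measure M N" using A(2) by (meson less_le_trans less_imp_le)
  qed
  moreover have "emeasure M B = 0" if B: "B \<in> sets M" "emeasure L B = 0" "B \<inter> N = {}" for B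
  proof -
    have "emeasure L (N \<union> B) \<le> emeasure L N + emeasure L B"
      using N B assms by (intro emeasure_subadditive) auto
    then have "N \<union> B \<in> Z" using N B N0 by (auto simp: Z_def)
    then have "measure M (N \<union> B) \<le> S" unfolding S_def using bdd by (rule cSUP_upper)
    moreover have "measure M (N \<union> B) = measure M N + measure M B"
      using N B by (intro finite_measure_Union) auto
    ultimately show ?thesis using \<open>S \<le> measure M N\<close> measure_nonneg[of M B]
      by (simp only: emeasure_eq_measure) (simp add: ennreal_eq_0_iff)
  qed
  ultimately show thesis using that N N0 by blast
qed

text \<open>The part of \<open>M\<close> on a maximal Lebesgue-null set \<open>N\<close> is
  singular; by maximality the rest is absolutely continuous, and Radon-Nikodym gives its density.
  The identity is stated for all bounded Borel functions, because the constant 1 is inserted later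
  to get the increment between the traces.\<close>

lemma polar_Lebesgue_decomposition:
  assumes P: "polar_signed_measure a b M \<sigma>"
  obtains f M' where "f absolutely_integrable_on {a<..<b}" "polar_signed_measure a b M' \<sigma>"
    "\<exists>N\<in>sets M'. emeasure lborel N = 0 \<and> emeasure M' ({a<..<b} - N) = 0"
    "\<And>\<eta>. \<eta> \<in> borel_measurable borel \<Longrightarrow> bounded (range \<eta>) \<Longrightarrow>
       (LINT x|M. \<sigma> x * \<eta> x) = (LINT x:{a<..<b}|lebesgue. f x * \<eta> x) + (LINT x|M'. \<sigma> x * \<eta> x)"
proof -
  interpret finite_measure M by (rule finite_measure_polar[OF P])
  obtain N where N: "N \<in> sets M" "emeasure lborel N = 0"
    "\<And>A. A \<in> sets M \<Longrightarrow> emeasure lborel A = 0 \<Longrightarrow> A \<inter> N = {} \<Longrightarrow> emeasure M A = 0"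
    using ex_maximal_null_set[of lborel] sets_polar[OF P] by auto
  define L where "L = restrict_space lborel {a<..<b}"
  define M0 where "M0 = density M (\<lambda>x. ennreal (indicator ({a<..<b} - N) x))"
  define M' where "M' = density M (\<lambda>x. ennreal (indicator N x))"
  have sL: "sets L = sets M"
    using P by (simp add: L_def polar_signed_measure_def sets_restrict_space)
  have L: "finite_measure L"
    by (intro finite_measureI)
       (use emeasure_bounded_finite[OF bounded_Ioo[of a b]] in \<open>auto simp: L_def emeasure_restrict_space space_restrict_space\<close>)
  interpret L: finite_measure L by (rule L)
  have C: "{a<..<b} - N \<in> sets M" unfolding space_polar[OF P, symmetric] by (intro sets.Diff sets.top N)
  have em: "emeasure (density M (\<lambda>x. ennreal (indicator S x))) A = emeasure M (S \<inter> A)"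
    if "S \<in> sets M" "A \<in> sets M" for S A
    using that by (simp add: emeasure_density ennreal_indicator flip: indicator_inter_arith)
  have fin: "finite_measure (density M (\<lambda>x. ennreal (indicator S x)))" if "S \<in> sets M" for S
    using em[OF that sets.top] by (intro finite_measureI) (simp add: emeasure_eq_measure)
  have sM': "sets M0 = sets M" "sets M' = sets M" by (simp_all add: M0_def M'_def)
  have "absolutely_continuous L M0"
    unfolding absolutely_continuous_def
  proof
    fix A assume "A \<in> null_sets L"
    then have A: "A \<in> sets M" "emeasure L A = 0" using sL by auto
    have "A \<subseteq> {a<..<b}" using A(1) sets_polar[OF P] by simp
    then have "emeasure lborel A = 0"
      using A(2) unfolding L_def by (subst (asm) emeasure_restrict_space) auto
    moreover have "emeasure lborel (({a<..<b} - N) \<inter> A) \<le> emeasure lborel A"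
      using A(1) sets_polar[OF P] by (intro emeasure_mono) auto
    ultimately have "emeasure M (({a<..<b} - N) \<inter> A) = 0"
      using A(1) C by (intro N(3)) auto
    then show "A \<in> null_sets M0" using em[OF C A(1)] A(1) sM' by (simp add: M0_def null_sets_def)
  qed
  then obtain g where g: "g \<in> borel_measurable L" "density L g = M0"
    using L.Radon_Nikodym_finite_measure[of M0] fin[OF C] sL sM' by (auto simp: M0_def)
  have "(\<integral>\<^sup>+x. g x \<partial>L) = emeasure M0 (space L)"
    unfolding g(2)[symmetric] using g(1)
    by (subst emeasure_density) (auto intro!: nn_integral_cong)
  also have "\<dots> \<noteq> \<infinity>" using finite_measure.emeasure_finite[OF fin[OF C]] by (simp add: M0_def)
  \<comment> \<open>Radon-Nikodym provides an extended real density; finiteness of \<open>M0\<close>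
    makes it finite almost everywhere, so it can be replaced by a real function.\<close>
  finally have "AE x in L. g x \<noteq> \<infinity>" by (rule nn_integral_PInf_AE[OF g(1)])
  then have "AE x in L. g x = ennreal (enn2real (g x))" by eventually_elim (simp add: less_top)
  then have "density L g = density L (\<lambda>x. ennreal (enn2real (g x)))"
    using g(1) by (intro density_cong) auto
  then have M0: "M0 = density L (\<lambda>x. ennreal (enn2real (g x)))" using g(2) by simp
  define f where "f x = enn2real (g x) * \<sigma> x" for x
  have \<sigma>L: "\<sigma> \<in> borel_measurable L" "\<sigma> \<in> borel_measurable M0" "\<sigma> \<in> borel_measurable M'"
    using polar_measurable[OF P] measurable_cong_sets sL sM' by blast+
  interpret M0: finite_measure M0 unfolding M0_def by (rule fin[OF C])
  have "integrable M0 \<sigma>"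
    using \<sigma>L(2) polar_abs[OF P] space_polar[OF P]
    by (intro M0.integrable_const_bound[where B = 1]) (auto simp: M0_def)
  then have "integrable L f"
    unfolding M0 f_def using g(1) \<sigma>L(1) by (subst (asm) integrable_density) auto
  then have fi: "integrable lborel (\<lambda>x. indicator {a<..<b} x *\<^sub>R f x)"
    unfolding L_def by (subst (asm) integrable_restrict_space) auto
  then have fa: "f absolutely_integrable_on {a<..<b}"
    unfolding set_integrable_def
    using integrable_completion[of "\<lambda>x. indicator {a<..<b} x *\<^sub>R f x" lborel] by auto
  have P': "polar_signed_measure a b M' \<sigma>"
    using fin[OF N(1)] \<sigma>L(3) P sM'(2) by (simp add: polar_signed_measure_def M'_def)
  have "emeasure M' ({a<..<b} - N) = 0"
    unfolding M'_def using em[OF N(1) C] by (simp add: Diff_disjoint)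
  then have sing: "\<exists>N\<in>sets M'. emeasure lborel N = 0 \<and> emeasure M' ({a<..<b} - N) = 0"
    using N(1,2) sM'(2) by auto
  have "(LINT x|M. \<sigma> x * \<eta> x) = (LINT x:{a<..<b}|lebesgue. f x * \<eta> x) + (LINT x|M'. \<sigma> x * \<eta> x)"
    if \<eta>': "\<eta> \<in> borel_measurable borel" "bounded (range \<eta>)" for \<eta>
  proof -
    obtain B where \<eta>: "\<eta> \<in> borel_measurable borel" "\<And>x. \<bar>\<eta> x\<bar> \<le> B"
      using \<eta>' by (auto simp: bounded_iff)
    have \<eta>M: "\<eta> \<in> borel_measurable M"
      using measurable_compose[OF id_measurable_polar[OF P] \<eta>(1)] .
    then have \<eta>L: "\<eta> \<in> borel_measurable L" using measurable_cong_sets[OF sL refl] by blast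
    have i: "integrable M (\<lambda>x. indicator S x * (\<sigma> x * \<eta> x))" if "S \<in> sets M" for S
    proof (rule integrable_const_bound[where B = B])
      have "0 \<le> B" using order_trans[OF abs_ge_zero \<eta>(2)] .
      then show "AE x in M. norm (indicator S x * (\<sigma> x * \<eta> x)) \<le> B"
        using polar_abs[OF P] space_polar[OF P] \<eta>(2) by (auto simp: abs_mult split: split_indicator)
      show "(\<lambda>x. indicator S x * (\<sigma> x * \<eta> x)) \<in> borel_measurable M"
        using that \<eta>M polar_measurable[OF P] by auto
    qed
    have "(LINT x|M. \<sigma> x * \<eta> x) =
        (LINT x|M. indicator ({a<..<b} - N) x * (\<sigma> x * \<eta> x) + indicator N x * (\<sigma> x * \<eta> x))"
      using space_polar[OF P] by (intro Bochner_Integration.integral_cong) (auto split: split_indicator)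
    also have "\<dots> = (LINT x|M. indicator ({a<..<b} - N) x * (\<sigma> x * \<eta> x)) + (LINT x|M. indicator N x * (\<sigma> x * \<eta> x))"
      by (intro Bochner_Integration.integral_add i C N(1))
    also have "(LINT x|M. indicator N x * (\<sigma> x * \<eta> x)) = (LINT x|M'. \<sigma> x * \<eta> x)"
      unfolding M'_def using N(1) \<eta>M polar_measurable[OF P] by (subst integral_density) auto
    also have "(LINT x|M. indicator ({a<..<b} - N) x * (\<sigma> x * \<eta> x)) = (LINT x|M0. \<sigma> x * \<eta> x)"
      unfolding M0_def using C \<eta>M polar_measurable[OF P] by (subst integral_density) auto
    also have "\<dots> = (LINT x|L. f x * \<eta> x)"
      unfolding M0 using g(1) \<eta>L \<sigma>L(1) by (subst integral_density) (auto simp: f_def mult.assoc)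
    also have "\<dots> = (LINT x|lborel. indicator {a<..<b} x *\<^sub>R (f x * \<eta> x))"
      unfolding L_def by (rule integral_restrict_space) simp
    also have "\<dots> = (LINT x:{a<..<b}|lebesgue. f x * \<eta> x)"
      unfolding set_lebesgue_integral_def
    proof (rule integral_completion[symmetric])
      have "(\<lambda>x. (indicator {a<..<b} x *\<^sub>R f x) * \<eta> x) \<in> borel_measurable lborel"
        using fi \<eta>(1) by (intro borel_measurable_times) auto
      then show "(\<lambda>x. indicator {a<..<b} x *\<^sub>R (f x * \<eta> x)) \<in> borel_measurable lborel"
        by (simp add: mult.assoc)
    qed
    finally show ?thesis .
  qed
  then show thesis by (rule that[OF fa P' sing])
qed

text \<open>The traces are the end limits of constant plus distribution function, so they differ by
  the total mass of the derivative. The decomposition tested with the constant 1 splits this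
  mass.\<close>

lemma BV_on_ex_decomposition:
  assumes "a < b" "BV_on a b w"
  obtains f M \<sigma> where "BV_decomposition a b w f M \<sigma>"
    "trace_right_end a b w - trace_left_end a b w = (LINT x:{a<..<b}|lebesgue. f x) + (LINT x|M. \<sigma> x)"
proof -
  obtain M \<sigma> where M: "polar_signed_measure a b M \<sigma>" and w: "w absolutely_integrable_on {a<..<b}"
    and D: "\<And>\<eta>. test_function a b \<eta> \<Longrightarrow>
      (LINT x:{a<..<b}|lebesgue. w x * deriv \<eta> x) = - (LINT x|M. \<sigma> x * \<eta> x)"
    using assms(2) unfolding BV_on_def by blast
  obtain f M' where f: "f absolutely_integrable_on {a<..<b}" "polar_signed_measure a b M' \<sigma>"
    "\<exists>N\<in>sets M'. emeasure lborel N = 0 \<and> emeasure M' ({a<..<b} - N) = 0"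
    and eq: "\<And>\<eta>. \<eta> \<in> borel_measurable borel \<Longrightarrow> bounded (range \<eta>) \<Longrightarrow>
       (LINT x|M. \<sigma> x * \<eta> x) = (LINT x:{a<..<b}|lebesgue. f x * \<eta> x) + (LINT x|M'. \<sigma> x * \<eta> x)"
    using polar_Lebesgue_decomposition[OF M] by blast
  have "BV_decomposition a b w f M' \<sigma>"
    unfolding BV_decomposition_def
  proof (intro conjI f allI impI)
    fix \<eta> assume \<eta>: "test_function a b \<eta>"
    obtain B where "\<And>x. \<bar>\<eta> x\<bar> \<le> B" using test_function_bounded[OF \<eta>] by blast
    then have "bounded (range \<eta>)" by (auto simp: bounded_iff)
    then show "(LINT x:{a<..<b}|lebesgue. w x * deriv \<eta> x)
          = - ((LINT x:{a<..<b}|lebesgue. f x * \<eta> x) + (LINT x|M'. \<sigma> x * \<eta> x))"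
      using D[OF \<eta>] eq[OF test_function_measurable[OF \<eta>]] by simp
  qed
  moreover obtain C where C: "AE t in lebesgue. t \<in> {a<..<b} \<longrightarrow> w t = C + cumulative M \<sigma> t"
    using BV_representation[OF assms(1) M w D] .
  then have C': "AE t in lebesgue. t \<in> {a<..<b} \<longrightarrow> C + cumulative M \<sigma> t = w t"
    by eventually_elim auto
  have "trace_left_end a b w = C + 0"
    by (rule trace_left_end_eqI[OF assms(1) C']) (intro tendsto_add tendsto_const cumulative_tendsto_left_end[OF M])
  moreover have "trace_right_end a b w = C + (LINT y|M. \<sigma> y)"
    by (rule trace_right_end_eqI[OF assms(1) C']) (intro tendsto_add tendsto_const cumulative_tendsto_right_end[OF M])
  moreover have "(LINT x|M. \<sigma> x) = (LINT x:{a<..<b}|lebesgue. f x) + (LINT x|M'. \<sigma> x)"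
    using eq[of "\<lambda>_. 1"] by simp
  ultimately show thesis by (intro that) auto
qed

text \<open>Two decompositions assign the same mass to the whole interval, so the formula known for
  one of them holds for all, in particular for the one that is chosen in \<open>scG\<close>.\<close>

lemma BV_on_trace_difference:
  assumes "a < b" "BV_on a b w" "BV_decomposition a b w f M \<sigma>"
  shows "trace_right_end a b w - trace_left_end a b w = (LINT x:{a<..<b}|lebesgue. f x) + (LINT x|M. \<sigma> x)"
proof -
  obtain f' M' \<sigma>' where D: "BV_decomposition a b w f' M' \<sigma>'"
    and tr: "trace_right_end a b w - trace_left_end a b w = (LINT x:{a<..<b}|lebesgue. f' x) + (LINT x|M'. \<sigma>' x)"
    using BV_on_ex_decomposition[OF assms(1,2)] .
  have P: "polar_signed_measure a b M \<sigma>" "polar_signed_measure a b M' \<sigma>'"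
    and f: "set_integrable lebesgue {a<..<b} f" "set_integrable lebesgue {a<..<b} f'"
    using D assms(3) by (auto simp: BV_decomposition_def)
  have one: "(LINT x|M. \<sigma> x * indicator (UNIV \<inter> {a<..<b}) x) = (LINT x|M. \<sigma> x)"
    if "polar_signed_measure a b M \<sigma>" for M \<sigma>
    using space_polar[OF that] by (intro Bochner_Integration.integral_cong) auto
  have "(LINT x|lebesgue. (indicator {a<..<b} x *\<^sub>R (f x - f' x)) * indicator (UNIV \<inter> {a<..<b}) x) =
      (LINT x:{a<..<b}|lebesgue. f x - f' x)"
    unfolding set_lebesgue_integral_def
    by (intro Bochner_Integration.integral_cong) (auto split: split_indicator)
  also have "\<dots> = (LINT x:{a<..<b}|lebesgue. f x) - (LINT x:{a<..<b}|lebesgue. f' x)"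
    by (rule set_integral_diff(2)[OF f])
  finally show ?thesis
    using BV_decomposition_functional_eq[OF assms(3) D, of UNIV] one[OF P(1)] one[OF P(2)] tr by simp
qed

text \<open>\<open>ac_deriv\<close> and \<open>sing_variation\<close> are two independent choices
  and may stem from different decompositions. Uniqueness of the density shows that, up to a null
  set, they can be read in a common one.\<close>

lemma BV_on_ac_deriv_sing_variation:
  assumes "a < b" "BV_on a b w"
  obtains f \<sigma> where "BV_decomposition a b w f (sing_variation a b w) \<sigma>"
    "AE x in lebesgue. x \<in> {a<..<b} \<longrightarrow> ac_deriv a b w x = f x"
proof -
  have ex: "\<exists>f M \<sigma>. BV_decomposition a b w f M \<sigma>"
    using BV_on_ex_decomposition[OF assms] by metis
  then have "\<exists>M f \<sigma>. BV_decomposition a b w f M \<sigma>" by blast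
  then have "\<exists>f \<sigma>. BV_decomposition a b w f (sing_variation a b w) \<sigma>"
    unfolding sing_variation_def by (rule someI_ex)
  moreover have "\<exists>M \<sigma>. BV_decomposition a b w (ac_deriv a b w) M \<sigma>"
    unfolding ac_deriv_def using ex by (rule someI_ex)
  ultimately show thesis using that BV_decomposition_ac_unique by metis
qed

lemma polar_null_measure:
  "polar_signed_measure a b (null_measure (restrict_space borel {a<..<b})) (\<lambda>_. 1)"
  by (auto simp: polar_signed_measure_def intro!: finite_measureI)

lemma weak_deriv_BV_decomposition:
  assumes p: "set_integrable lebesgue {a<..<b} p"
    and D: "\<And>\<eta>. test_function a b \<eta> \<Longrightarrow>
        (LINT x:{a<..<b}|lebesgue. w x * deriv \<eta> x) = - (LINT x:{a<..<b}|lebesgue. p x * \<eta> x)"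
  shows "BV_decomposition a b w p (null_measure (restrict_space borel {a<..<b})) (\<lambda>_. 1)"
  unfolding BV_decomposition_def
proof (intro conjI p polar_null_measure allI impI)
  show "\<exists>N\<in>sets (null_measure (restrict_space borel {a<..<b})).
       emeasure lborel N = 0 \<and> emeasure (null_measure (restrict_space borel {a<..<b})) ({a<..<b} - N) = 0"
    by (intro bexI[of _ "{}"]) auto
  fix \<eta> assume \<eta>: "test_function a b \<eta>"
  have "AE x in null_measure (restrict_space borel {a<..<b}). 1 * \<eta> x = 0"
    by (rule AE_I'[of "{a<..<b}"]) (auto simp: null_sets_def sets_restrict_space space_restrict_space)
  then have "(LINT x|null_measure (restrict_space borel {a<..<b}). 1 * \<eta> x) = 0"
    by (rule integral_eq_zero_AE)
  then show "(LINT x:{a<..<b}|lebesgue. w x * deriv \<eta> x) =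
      - ((LINT x:{a<..<b}|lebesgue. p x * \<eta> x) + (LINT x|null_measure (restrict_space borel {a<..<b}). 1 * \<eta> x))"
    using D[OF \<eta>] by simp
qed

text \<open>For an absolutely continuous competitor this pins down every chosen object that occurs
  in \<open>scG\<close>: density, singular part and both traces.\<close>

lemma absolutely_continuous_BV:
  assumes "a < b" and p: "set_integrable lebesgue {a<..<b} p"
    and w: "\<And>t. t \<in> {a<..<b} \<Longrightarrow> w t = C + integral {a..t} p"
  shows "w absolutely_integrable_on {a<..<b}" "BV_on a b w"
    "AE x in lebesgue. x \<in> {a<..<b} \<longrightarrow> ac_deriv a b w x = p x"
    "emeasure (sing_variation a b w) (space (sing_variation a b w)) = 0"
    "trace_left_end a b w = C" "trace_right_end a b w = C + integral {a..b} p"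
proof -
  have pi: "p integrable_on {a..b}"
    using p absolutely_integrable_Icc_iff_Ioo set_lebesgue_integral_eq_integral(1) by blast
  have cont: "continuous_on {a..b} (\<lambda>t. C + integral {a..t} p)"
    by (intro continuous_intros indefinite_integral_continuous_1 pi)
  then have ci: "set_integrable lebesgue {a<..<b} (\<lambda>t. C + integral {a..t} p)"
    using absolutely_integrable_continuous_real absolutely_integrable_Icc_iff_Ioo by blast
  then show wi: "w absolutely_integrable_on {a<..<b}"
    using set_integrable_cong[of lebesgue lebesgue "{a<..<b}" "{a<..<b}" w, OF refl refl w] by simp
  have D: "(LINT x:{a<..<b}|lebesgue. w x * deriv \<eta> x) = - (LINT x:{a<..<b}|lebesgue. p x * \<eta> x)"
    if "test_function a b \<eta>" for \<eta>
    by (rule absolutely_continuous_integration_by_parts[OF assms(1) p w that])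
  show bv: "BV_on a b w"
  proof -
    obtain M \<sigma> where M: "polar_signed_measure a b M \<sigma>" "\<And>\<eta>. \<eta> \<in> borel_measurable borel \<Longrightarrow>
       (LINT y|M. \<sigma> y * \<eta> y) = (LINT t:{a<..<b}|lebesgue. p t * \<eta> t)"
      using density_polar[OF p] by blast
    then have "\<forall>\<eta>. test_function a b \<eta> \<longrightarrow>
           (LINT x:{a<..<b}|lebesgue. w x * deriv \<eta> x) = - (LINT x|M. \<sigma> x * \<eta> x)"
      using D test_function_measurable by simp
    then show ?thesis using wi M(1) unfolding BV_on_def by blast
  qed
  obtain f \<sigma> where f: "BV_decomposition a b w f (sing_variation a b w) \<sigma>"
    "AE x in lebesgue. x \<in> {a<..<b} \<longrightarrow> ac_deriv a b w x = f x"
    using BV_on_ac_deriv_sing_variation[OF assms(1) bv] .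
  have dec: "BV_decomposition a b w p (null_measure (restrict_space borel {a<..<b})) (\<lambda>_. 1)"
    by (rule weak_deriv_BV_decomposition[OF p D])
  show "emeasure (sing_variation a b w) (space (sing_variation a b w)) = 0"
    by (rule BV_decomposition_singular_zero[OF f(1) dec]) auto
  show "AE x in lebesgue. x \<in> {a<..<b} \<longrightarrow> ac_deriv a b w x = p x"
    using f(2) BV_decomposition_ac_unique[OF f(1) dec] by eventually_elim auto
  have w': "AE t in lebesgue. t \<in> {a<..<b} \<longrightarrow> C + integral {a..t} p = w t"
    using w by simp
  have "((\<lambda>t. C + integral {a..t} p) \<longlongrightarrow> C + integral {a..a} p) (at_right a)"
    using continuous_on_Icc_at_rightD[OF cont assms(1)] .
  then show "trace_left_end a b w = C"
    by (intro trace_left_end_eqI[OF assms(1) w']) simp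
  have "((\<lambda>t. C + integral {a..t} p) \<longlongrightarrow> C + integral {a..b} p) (at_left b)"
    using continuous_on_Icc_at_leftD[OF cont assms(1)] .
  then show "trace_right_end a b w = C + integral {a..b} p"
    by (intro trace_right_end_eqI[OF assms(1) w'])
qed

section \<open>Sobolev functions and their weak derivatives\<close>

lemma H1_on_weak_deriv:
  assumes "H1_on a b u"
  shows "has_weak_L2_deriv a b u (weak_deriv a b u)"
  using assms unfolding H1_on_def weak_deriv_def by (metis someI_ex)

lemma H1_on_absolutely_continuous:
  assumes "a < b" "H1_on a b u" "continuous_on {a..b} u" "x \<in> {a..b}"
  shows "u x = u a + integral {a..x} (weak_deriv a b u)"
  by (rule weak_derivative_absolutely_continuous[OF assms(1,3) _ _ assms(4)])
     (use H1_on_weak_deriv[OF assms(2)] in \<open>auto simp: has_weak_L2_deriv_def L2_on_imp_set_integrable\<close>)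

lemma weak_deriv_absolutely_integrable:
  assumes "H1_on a b u"
  shows "weak_deriv a b u absolutely_integrable_on {a<..<b}"
  using H1_on_weak_deriv[OF assms] by (auto simp: has_weak_L2_deriv_def L2_on_imp_set_integrable)

lemma L2_on_bounded:
  assumes "set_borel_measurable lebesgue {a<..<b} f" "\<And>x. x \<in> {a<..<b} \<Longrightarrow> \<bar>f x\<bar> \<le> B"
  shows "L2_on a b f"
proof -
  have "integrable lebesgue (\<lambda>x. (indicator {a<..<b} x *\<^sub>R f x)\<^sup>2)"
  proof (rule integrableI_bounded_set[where A = "{a<..<b}" and B = "B\<^sup>2"])
    show "(\<lambda>x. (indicator {a<..<b} x *\<^sub>R f x)\<^sup>2) \<in> borel_measurable lebesgue"
      using assms(1) unfolding set_borel_measurable_def by (rule borel_measurable_power)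
    show "AE x in lebesgue. x \<in> {a<..<b} \<longrightarrow> norm ((indicator {a<..<b} x *\<^sub>R f x)\<^sup>2) \<le> B\<^sup>2"
      using assms(2) by (auto simp: abs_le_square_iff[symmetric] intro: order_trans[OF _ abs_ge_self])
  qed (use emeasure_bounded_finite[OF bounded_Ioo[of a b]] in auto)
  moreover have "(\<lambda>x. (indicator {a<..<b} x *\<^sub>R f x)\<^sup>2) = (\<lambda>x. indicator {a<..<b} x *\<^sub>R (f x)\<^sup>2)"
    by (auto split: split_indicator)
  ultimately show ?thesis using assms(1) by (simp add: L2_on_def set_integrable_def)
qed

text \<open>Bounded slopes suffice for the competitors. The chosen weak derivative is identified
  with \<open>p\<close> by reading both as BV decompositions without singular part and using
  uniqueness of the density.\<close>

lemma absolutely_continuous_H1: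
  assumes "a < b" and p: "set_borel_measurable lebesgue {a<..<b} p" "\<And>x. x \<in> {a<..<b} \<Longrightarrow> \<bar>p x\<bar> \<le> B"
    and w: "\<And>t. t \<in> {a..b} \<Longrightarrow> w t = C + integral {a..t} p"
  shows "H1_on a b w" "continuous_on {a..b} w"
    "AE x in lebesgue. x \<in> {a<..<b} \<longrightarrow> weak_deriv a b w x = p x"
proof -
  have p2: "L2_on a b p" by (rule L2_on_bounded[OF p])
  then have p1: "set_integrable lebesgue {a<..<b} p" by (rule L2_on_imp_set_integrable)
  then have pi: "p integrable_on {a..b}"
    using absolutely_integrable_Icc_iff_Ioo set_lebesgue_integral_eq_integral(1) by blast
  have "continuous_on {a..b} (\<lambda>t. C + integral {a..t} p)"
    by (intro continuous_intros indefinite_integral_continuous_1 pi)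
  then show cont: "continuous_on {a..b} w"
    using w continuous_on_cong[of "{a..b}" "{a..b}" w] by simp
  have D: "(LINT x:{a<..<b}|lebesgue. w x * deriv \<eta> x) = - (LINT x:{a<..<b}|lebesgue. p x * \<eta> x)"
    if "test_function a b \<eta>" for \<eta>
    by (rule absolutely_continuous_integration_by_parts[OF assms(1) p1 _ that]) (simp add: w)
  have "w absolutely_integrable_on {a<..<b}"
    using absolutely_integrable_continuous_real[OF cont] by (simp add: absolutely_integrable_Icc_iff_Ioo)
  moreover have "compact (w ` {a..b})" by (intro compact_continuous_image cont) simp
  then obtain K where "\<And>x. x \<in> {a..b} \<Longrightarrow> \<bar>w x\<bar> \<le> K"
    by (fastforce dest!: compact_imp_bounded simp: bounded_iff)
  ultimately have "L2_on a b w"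
    by (intro L2_on_bounded[where B = K]) (auto simp: set_integrable_def set_borel_measurable_def)
  moreover have wp: "has_weak_L2_deriv a b w p" using p2 D by (auto simp: has_weak_L2_deriv_def)
  ultimately show H: "H1_on a b w" by (auto simp: H1_on_def)
  have "BV_decomposition a b w q (null_measure (restrict_space borel {a<..<b})) (\<lambda>_. 1)"
    if "has_weak_L2_deriv a b w q" for q
    using that by (intro weak_deriv_BV_decomposition) (auto simp: has_weak_L2_deriv_def L2_on_imp_set_integrable)
  from BV_decomposition_ac_unique[OF this[OF H1_on_weak_deriv[OF H]] this[OF wp]]
  show "AE x in lebesgue. x \<in> {a<..<b} \<longrightarrow> weak_deriv a b w x = p x" .
qed

section \<open>Calibration tools\<close>

lemma absolutely_integrable_bounded_continuous:
  fixes f :: "real \<Rightarrow> real"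
  assumes "continuous_on {a<..<b} f" "\<And>x. x \<in> {a<..<b} \<Longrightarrow> \<bar>f x\<bar> \<le> B"
  shows "f absolutely_integrable_on {a<..<b}"
proof (rule measurable_bounded_by_integrable_imp_absolutely_integrable)
  show "f \<in> borel_measurable (lebesgue_on {a<..<b})"
    by (intro continuous_imp_measurable_on_sets_lebesgue assms) auto
  show "(\<lambda>_. B) integrable_on {a<..<b}"
    using integrable_on_Icc_iff_Ioo[of "\<lambda>_. B" a b] by auto
qed (use assms in auto)

lemma nn_integral_eq_ennreal_integral:
  fixes f :: "real \<Rightarrow> real"
  assumes "f absolutely_integrable_on S" "\<And>x. x \<in> S \<Longrightarrow> 0 \<le> f x"
  shows "(\<integral>\<^sup>+x\<in>S. ennreal (f x) \<partial>lebesgue) = ennreal (integral S f)"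
proof -
  have "(\<integral>\<^sup>+x\<in>S. ennreal (f x) \<partial>lebesgue) = (\<integral>\<^sup>+x. ennreal (indicator S x *\<^sub>R f x) \<partial>lebesgue)"
    by (intro nn_integral_cong) (auto split: split_indicator)
  also have "\<dots> = ennreal (LINT x|lebesgue. indicator S x *\<^sub>R f x)"
    using assms by (intro nn_integral_eq_integral) (auto simp: set_integrable_def split: split_indicator)
  also have "(LINT x|lebesgue. indicator S x *\<^sub>R f x) = integral S f"
    using set_lebesgue_integral_eq_integral(2)[OF assms(1)] by (simp add: set_lebesgue_integral_def)
  finally show ?thesis .
qed

text \<open>\<open>f\<close> may change sign. As \<open>ennreal\<close> truncates at 0, passing to
  the positive part keeps the pointwise bound and can only increase the integral of
  \<open>f\<close>.\<close>

lemma ennreal_integral_le_nn_integral: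
  fixes f :: "real \<Rightarrow> real"
  assumes "f absolutely_integrable_on S" "\<And>x. x \<in> S \<Longrightarrow> ennreal (f x) \<le> g x"
  shows "ennreal (integral S f) \<le> (\<integral>\<^sup>+x\<in>S. g x \<partial>lebesgue)"
proof -
  have a: "(\<lambda>x. \<bar>f x\<bar>) absolutely_integrable_on S" using assms(1) by (rule set_integrable_abs)
  have m: "(\<lambda>x. max 0 (f x)) absolutely_integrable_on S"
  proof -
    have "(\<lambda>x. (1 / 2) * (f x + \<bar>f x\<bar>)) absolutely_integrable_on S"
      using assms(1) a by (intro set_integrable_mult_right set_integral_add(1)) auto
    moreover have "(\<lambda>x. (1 / 2) * (f x + \<bar>f x\<bar>)) = (\<lambda>x. max 0 (f x))" by (auto simp: max_def)
    ultimately show ?thesis by (simp only:)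
  qed
  have "ennreal (integral S f) \<le> ennreal (integral S (\<lambda>x. max 0 (f x)))"
    using assms(1) m by (intro ennreal_leI integral_le) (auto simp: absolutely_integrable_on_def)
  also have "\<dots> = (\<integral>\<^sup>+x\<in>S. ennreal (max 0 (f x)) \<partial>lebesgue)"
    by (rule nn_integral_eq_ennreal_integral[symmetric]) (use m in auto)
  also have "\<dots> \<le> (\<integral>\<^sup>+x\<in>S. g x \<partial>lebesgue)"
    using assms(2) by (intro nn_integral_mono) (auto split: split_indicator simp: max_def)
  finally show ?thesis .
qed

lemma absolutely_integrable_continuous_mult_abs:
  fixes f g :: "real \<Rightarrow> real"
  assumes g: "continuous_on {a..b} g" and f: "f absolutely_integrable_on {a..b}"
  shows "(\<lambda>t. g t * \<bar>f t\<bar>) absolutely_integrable_on {a..b}"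
proof (rule absolutely_integrable_bounded_measurable_product_real)
  show "g \<in> borel_measurable (lebesgue_on {a..b})"
    by (intro continuous_imp_measurable_on_sets_lebesgue g) auto
  show "bounded (g ` {a..b})"
    by (intro compact_imp_bounded compact_continuous_image g) simp
  show "(\<lambda>t. \<bar>f t\<bar>) absolutely_integrable_on {a..b}"
    using f by (rule set_integrable_abs)
qed auto

text \<open>Instead of differentiating the composition almost everywhere, the estimate is proved on short
  intervals, where \<open>h \<circ> v\<close> is almost constant, and propagated by bisection.\<close>

lemma integral_composition_bound:
  fixes v h f :: "real \<Rightarrow> real"
  assumes f: "f absolutely_integrable_on {a..b}"
    and v: "\<And>x. x \<in> {a..b} \<Longrightarrow> v x = v a + integral {a..x} f"
    and im: "\<And>x. x \<in> {a..b} \<Longrightarrow> v x \<in> {c..d}"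
    and h: "continuous_on {c..d} h" "\<And>y. y \<in> {c..d} \<Longrightarrow> 0 \<le> h y"
    and xy: "a \<le> x" "x \<le> y" "y \<le> b"
  shows "\<bar>integral {c..v y} h - integral {c..v x} h\<bar> \<le> integral {x..y} (\<lambda>t. h (v t) * \<bar>f t\<bar>)"
proof -
  have fi: "f integrable_on {a..b}" using f by (rule set_lebesgue_integral_eq_integral(1))
  have vc: "continuous_on {a..b} v"
    by (rule continuous_on_eq[OF continuous_on_add[OF continuous_on_const indefinite_integral_continuous_1[OF fi]]])
      (rule v[symmetric])
  have hv: "continuous_on {a..b} (\<lambda>t. h (v t))"
    by (rule continuous_on_compose2[OF h(1) vc]) (use im in auto)
  have absf: "(\<lambda>t. \<bar>f t\<bar>) absolutely_integrable_on {a..b}" using f by (rule set_integrable_abs)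
  have prod: "(\<lambda>t. h (v t) * \<bar>f t\<bar>) absolutely_integrable_on {a..b}"
    by (rule absolutely_integrable_continuous_mult_abs[OF hv f])
  have pe: "(\<lambda>t. (h (v t) + e) * \<bar>f t\<bar>) integrable_on {p..q}" if "a \<le> p" "q \<le> b" for e p q
  proof -
    have "(\<lambda>t. h (v t) * \<bar>f t\<bar> + e * \<bar>f t\<bar>) integrable_on {a..b}"
      using prod absf by (intro integrable_add integrable_on_mult_right) (auto simp: absolutely_integrable_on_def)
    then show ?thesis using that by (auto simp: algebra_simps intro: integrable_on_subinterval)
  qed
  define H where "H y = integral {c..y} h" for y
  have Hdiff: "H q - H p = integral {p..q} h" if "c \<le> p" "p \<le> q" "q \<le> d" for p q
  proof -
    have "h integrable_on {c..q}"
      using that by (intro integrable_continuous_real continuous_on_subset[OF h(1)]) auto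
    then show ?thesis
      using Henstock_Kurzweil_Integration.integral_combine[of c p q h] that by (simp add: H_def)
  qed
  \<comment> \<open>The slack \<open>e\<close> absorbs the oscillation of \<open>h (v t)\<close> on
    short intervals; it is removed at the end because \<open>f\<close> is integrable.\<close>
  have main: "\<bar>H (v y) - H (v x)\<bar> \<le> integral {x..y} (\<lambda>t. (h (v t) + e) * \<bar>f t\<bar>)" if "e > 0" for e
  proof -
    define P where "P p q \<longleftrightarrow> (a \<le> p \<and> p \<le> q \<and> q \<le> b \<longrightarrow>
        \<bar>H (v q) - H (v p)\<bar> \<le> integral {p..q} (\<lambda>t. (h (v t) + e) * \<bar>f t\<bar>))" for p q
    have "P x y"
      using xy(2)
    proof (induction rule: Bolzano)
      case (trans p q r)
      show ?case
        unfolding P_def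
      proof
        assume "a \<le> p \<and> p \<le> r \<and> r \<le> b"
        with trans have "\<bar>H (v q) - H (v p)\<bar> \<le> integral {p..q} (\<lambda>t. (h (v t) + e) * \<bar>f t\<bar>)"
          "\<bar>H (v r) - H (v q)\<bar> \<le> integral {q..r} (\<lambda>t. (h (v t) + e) * \<bar>f t\<bar>)"
          "integral {p..q} (\<lambda>t. (h (v t) + e) * \<bar>f t\<bar>) + integral {q..r} (\<lambda>t. (h (v t) + e) * \<bar>f t\<bar>)
            = integral {p..r} (\<lambda>t. (h (v t) + e) * \<bar>f t\<bar>)"
          by (auto simp: P_def intro!: Henstock_Kurzweil_Integration.integral_combine pe)
        then show "\<bar>H (v r) - H (v p)\<bar> \<le> integral {p..r} (\<lambda>t. (h (v t) + e) * \<bar>f t\<bar>)" by linarith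
      qed
    next
      case (local z)
      then have "z \<in> {a..b}" using xy by auto
      then obtain \<delta> where \<delta>: "\<delta> > 0" "\<And>t. t \<in> {a..b} \<Longrightarrow> dist t z < \<delta> \<Longrightarrow> dist (h (v t)) (h (v z)) < e / 2"
        using hv \<open>e > 0\<close> unfolding continuous_on_iff by (metis half_gt_zero)
      show ?case
      proof (intro exI[of _ \<delta>] conjI allI impI \<delta>(1))
        fix p q assume pq: "p \<le> z \<and> z \<le> q \<and> q - p < \<delta>"
        show "P p q"
          unfolding P_def
        proof
          assume ab: "a \<le> p \<and> p \<le> q \<and> q \<le> b"
          have near: "h (v s) \<le> h (v t) + e" if "s \<in> {p..q}" "t \<in> {p..q}" for s t
          proof -
            have "dist s z < \<delta>" "dist t z < \<delta>" "s \<in> {a..b}" "t \<in> {a..b}"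
              using that ab pq by (auto simp: dist_real_def)
            from \<delta>(2)[OF this(3,1)] \<delta>(2)[OF this(4,2)]
            have "dist (h (v s)) (h (v z)) < e / 2" "dist (h (v t)) (h (v z)) < e / 2" .
            then show ?thesis by (simp add: dist_real_def abs_if split: if_splits)
          qed
          define lo hi where "lo = min (v p) (v q)" and "hi = max (v p) (v q)"
          define X where "X = integral {p..q} (\<lambda>t. \<bar>f t\<bar>)"
          have lohi: "c \<le> lo" "lo \<le> hi" "hi \<le> d" using im[of p] im[of q] ab by (auto simp: lo_def hi_def)
          \<comment> \<open>Every height between \<open>v p\<close> and \<open>v q\<close> is
            attained inside \<open>{p..q}\<close>. Hence \<open>near\<close> controls
            \<open>h\<close> on all of \<open>{lo..hi}\<close>, and not only at values known to lie
            on the path.\<close>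
          have ivt: "\<exists>s\<in>{p..q}. v s = r" if "r \<in> {lo..hi}" for r
          proof -
            have cpq: "continuous_on {p..q} v" using vc ab by (auto intro: continuous_on_subset)
            show ?thesis
              using IVT'[of v p r q] IVT2'[of v q r p] that cpq ab
              by (cases "v p \<le> v q") (fastforce simp: lo_def hi_def)+
          qed
          have vd: "hi - lo \<le> X"
          proof -
            have "v q - v p = integral {p..q} f"
              using v[of p] v[of q] ab Henstock_Kurzweil_Integration.integral_combine[of a p q f]
                integrable_on_subinterval[OF fi, of a q] by simp
            moreover have "\<bar>integral {p..q} f\<bar> \<le> X"
              unfolding X_def using ab integral_norm_bound_integral[of f "{p..q}" "\<lambda>t. \<bar>f t\<bar>"]
                integrable_on_subinterval[OF fi, of p q]
                integrable_on_subinterval[OF set_lebesgue_integral_eq_integral(1)[OF absf], of p q] by simp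
            ultimately show ?thesis by (auto simp: lo_def hi_def)
          qed
          have X0: "0 \<le> X" using vd lohi by linarith
          define K where "K = h (v z)"
          have "\<bar>H (v q) - H (v p)\<bar> = H hi - H lo"
          proof -
            have "0 \<le> H hi - H lo"
              unfolding Hdiff[OF lohi] using lohi h
              by (intro integral_nonneg integrable_continuous_real) (auto intro: continuous_on_subset)
            then show ?thesis by (auto simp: lo_def hi_def min_def max_def split: if_splits)
          qed
          also have "\<dots> = integral {lo..hi} h" by (rule Hdiff[OF lohi])
          also have "\<dots> \<le> integral {p..q} (\<lambda>t. (h (v t) + e) * \<bar>f t\<bar>)"
          proof -
            \<comment> \<open>Multiplying by \<open>\<bar>f t\<bar>\<close> and integrating in
              \<open>t\<close> yields the factor \<open>X\<close> on the left against
              \<open>hi - lo\<close>, which is at most \<open>X\<close>. Cancelling \<open>X\<close>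
              then gives the local estimate.\<close>
            have "integral {lo..hi} h * \<bar>f t\<bar> \<le> (hi - lo) * ((h (v t) + e) * \<bar>f t\<bar>)" if "t \<in> {p..q}" for t
            proof -
              have "integral {lo..hi} h \<le> integral {lo..hi} (\<lambda>_. h (v t) + e)"
                using ivt near that lohi h(1)
                by (intro integral_le integrable_continuous_real) (auto intro: continuous_on_subset, metis atLeastAtMost_iff)
              then have "integral {lo..hi} h \<le> (hi - lo) * (h (v t) + e)" using lohi by simp
              from mult_right_mono[OF this, of "\<bar>f t\<bar>"] show ?thesis by (simp add: mult.assoc)
            qed
            then have "integral {p..q} (\<lambda>t. integral {lo..hi} h * \<bar>f t\<bar>)
                \<le> integral {p..q} (\<lambda>t. (hi - lo) * ((h (v t) + e) * \<bar>f t\<bar>))"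
              using ab absf by (intro integral_le integrable_on_mult_right pe)
                (auto simp: absolutely_integrable_on_def intro: integrable_on_subinterval)
            then have *: "integral {lo..hi} h * X \<le> (hi - lo) * integral {p..q} (\<lambda>t. (h (v t) + e) * \<bar>f t\<bar>)"
              by (simp add: X_def)
            have I0: "0 \<le> integral {p..q} (\<lambda>t. (h (v t) + e) * \<bar>f t\<bar>)"
              using ab h(2) im \<open>e > 0\<close> by (intro integral_nonneg pe) (auto intro!: mult_nonneg_nonneg add_nonneg_nonneg)
            show ?thesis
            proof (cases "X = 0")
              case True
              then have "lo = hi" using vd lohi by simp
              then show ?thesis using I0 by simp
            next
              case False
              then have "X > 0" using X0 by simp
              have "integral {lo..hi} h * X \<le> X * integral {p..q} (\<lambda>t. (h (v t) + e) * \<bar>f t\<bar>)"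
                using * mult_right_mono[OF vd I0] by linarith
              then show ?thesis using \<open>X > 0\<close> by (simp add: mult.commute)
            qed
          qed
          finally show "\<bar>H (v q) - H (v p)\<bar> \<le> integral {p..q} (\<lambda>t. (h (v t) + e) * \<bar>f t\<bar>)" .
        qed
      qed
    qed
    then show ?thesis using xy by (simp add: P_def)
  qed
  have split: "integral {x..y} (\<lambda>t. (h (v t) + e) * \<bar>f t\<bar>) =
      integral {x..y} (\<lambda>t. h (v t) * \<bar>f t\<bar>) + e * integral {x..y} (\<lambda>t. \<bar>f t\<bar>)" for e
  proof -
    have "(\<lambda>t. h (v t) * \<bar>f t\<bar>) integrable_on {x..y}" "(\<lambda>t. e * \<bar>f t\<bar>) integrable_on {x..y}"
      using prod absf xy
      by (auto simp: absolutely_integrable_on_def intro!: integrable_on_mult_right intro: integrable_on_subinterval)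
    then show ?thesis by (simp add: distrib_right integral_add)
  qed
  show ?thesis
  proof (rule field_le_epsilon)
    fix e :: real assume "e > 0"
    define Y where "Y = integral {x..y} (\<lambda>t. \<bar>f t\<bar>)"
    have "Y \<ge> 0" unfolding Y_def by (rule integral_nonneg)
      (use absf xy in \<open>auto simp: absolutely_integrable_on_def intro: integrable_on_subinterval\<close>)
    then have "e / (Y + 1) > 0" "e / (Y + 1) * Y \<le> e"
      using \<open>e > 0\<close> by (auto simp: field_simps)
    then show "\<bar>integral {c..v y} h - integral {c..v x} h\<bar> \<le> integral {x..y} (\<lambda>t. h (v t) * \<bar>f t\<bar>) + e"
      using main[of "e / (Y + 1)"] split[of "e / (Y + 1)"] by (simp add: H_def Y_def)
  qed
qed

text \<open>Cauchy-Schwarz for the vector \<open>(sqrt \<theta> * p, sqrt w * \<bar>q\<bar>)\<close>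
  against the unit vector with first component \<open>c / sqrt \<theta>\<close>. The truncation by
  \<open>max\<close> is written so that the coefficient of \<open>\<bar>q\<bar>\<close> has the
  shape of \<open>k\<close>.\<close>

lemma calibration_inequality:
  fixes c \<theta> w p q :: real
  assumes "0 \<le> c" "c\<^sup>2 \<le> \<theta>" "0 \<le> w"
  shows "c * p + sqrt (w * max 0 (1 - c\<^sup>2 / \<theta>)) * \<bar>q\<bar> \<le> sqrt (\<theta> * p\<^sup>2 + w * q\<^sup>2)"
proof (cases "\<theta> = 0")
  \<comment> \<open>Division by zero makes the quotient 0 and the coefficient of
    \<open>\<bar>q\<bar>\<close> equal to \<open>sqrt w\<close>, which is the right value for
    \<open>c = 0\<close>.\<close>
  case True
  then have "c = 0" using assms by simp
  then show ?thesis using True assms by (simp add: real_sqrt_mult)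
next
  case False
  then have "\<theta> > 0" using assms by (metis zero_le_power2 order_le_less order_trans)
  define \<beta> where "\<beta> = sqrt (1 - c\<^sup>2 / \<theta>)"
  have b: "0 \<le> 1 - c\<^sup>2 / \<theta>" using \<open>\<theta> > 0\<close> assms by simp
  have \<beta>2: "\<beta>\<^sup>2 = 1 - c\<^sup>2 / \<theta>" using b by (simp add: \<beta>_def)
  have "sqrt (w * max 0 (1 - c\<^sup>2 / \<theta>)) = sqrt w * \<beta>" using b by (simp add: \<beta>_def real_sqrt_mult max_def)
  define A B where "A = sqrt \<theta> * p" and "B = sqrt w * \<bar>q\<bar>"
  define \<alpha> where "\<alpha> = c / sqrt \<theta>"
  have \<alpha>2: "\<alpha>\<^sup>2 + \<beta>\<^sup>2 = 1" using \<open>\<theta> > 0\<close> \<beta>2 by (simp add: \<alpha>_def power_divide)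
  have "(\<alpha> * A + \<beta> * B)\<^sup>2 + (\<alpha> * B - \<beta> * A)\<^sup>2 = (\<alpha>\<^sup>2 + \<beta>\<^sup>2) * (A\<^sup>2 + B\<^sup>2)" by (simp add: power2_eq_square algebra_simps)
  then have "(\<alpha> * A + \<beta> * B)\<^sup>2 \<le> A\<^sup>2 + B\<^sup>2" using \<alpha>2 by (metis le_add_same_cancel1 mult_1 zero_le_power2)
  then have "\<alpha> * A + \<beta> * B \<le> sqrt (A\<^sup>2 + B\<^sup>2)" by (rule real_le_rsqrt)
  moreover have "A\<^sup>2 + B\<^sup>2 = \<theta> * p\<^sup>2 + w * q\<^sup>2"
    using \<open>\<theta> > 0\<close> assms by (simp add: A_def B_def power_mult_distrib)
  moreover have "\<alpha> * A = c * p" using \<open>\<theta> > 0\<close> by (simp add: \<alpha>_def A_def)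
  ultimately show ?thesis
    using \<open>sqrt (w * max 0 (1 - c\<^sup>2 / \<theta>)) = sqrt w * \<beta>\<close> by (simp add: B_def algebra_simps)
qed

text \<open>Tangent line of the concave function \<open>c \<mapsto> sqrt (1 - c\<^sup>2 / r)\<close> at \<open>d\<close>.\<close>

lemma sqrt_tangent_inequality:
  fixes c d r :: real
  assumes "0 \<le> c" "0 \<le> d" "c\<^sup>2 \<le> r" "d\<^sup>2 < r"
  shows "sqrt (1 - c\<^sup>2 / r) - sqrt (1 - d\<^sup>2 / r) \<le> - (c - d) * (d / sqrt (r * (r - d\<^sup>2)))"
proof -
  have r: "r > 0" using assms(4) by (smt (verit) zero_le_power2)
  define X Y where "X = sqrt (1 - c\<^sup>2 / r)" and "Y = sqrt (1 - d\<^sup>2 / r)"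
  have Y0: "Y > 0" using r assms by (simp add: Y_def)
  have X2: "X\<^sup>2 = 1 - c\<^sup>2 / r" "Y\<^sup>2 = 1 - d\<^sup>2 / r" using r assms by (simp_all add: X_def Y_def)
  \<comment> \<open>\<open>(X, c / sqrt r)\<close> and \<open>(Y, d / sqrt r)\<close> are unit
    vectors; their squared distance is nonnegative, so their inner product is at most 1.\<close>
  have "0 \<le> (X - Y)\<^sup>2 + (c - d)\<^sup>2 / r" using r by simp
  then have "2 * (X * Y) \<le> X\<^sup>2 + Y\<^sup>2 + (c - d)\<^sup>2 / r" by (simp add: power2_eq_square algebra_simps)
  also have "\<dots> = 2 - 2 * c * d / r" unfolding X2 using r by (simp add: power2_eq_square field_simps)
  finally have "X * Y \<le> 1 - c * d / r" by simp
  then have "(X - Y) * Y \<le> - (c - d) * d / r" using X2 r by (simp add: power2_eq_square field_simps)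
  then have "X - Y \<le> - (c - d) * d / r / Y" by (simp only: pos_le_divide_eq[OF Y0])
  also have "\<dots> = - (c - d) * (d / (r * Y))" by simp
  also have "r * Y = sqrt (r * (r - d\<^sup>2))"
  proof -
    have "r * Y = sqrt (r\<^sup>2 * (1 - d\<^sup>2 / r))" using r by (simp add: Y_def real_sqrt_mult)
    also have "r\<^sup>2 * (1 - d\<^sup>2 / r) = r * (r - d\<^sup>2)" using r by (simp add: power2_eq_square field_simps)
    finally show ?thesis .
  qed
  finally show ?thesis by (simp add: X_def Y_def)
qed

section \<open>The length function of regular data\<close>

lemma esqrt_ennreal: "esqrt (ennreal x) = ennreal (sqrt x)"
  by (cases "0 \<le> x") (simp_all add: esqrt_def ennreal_neg real_sqrt_le_0_iff)

lemma esqrt_mono: "x \<le> y \<Longrightarrow> esqrt x \<le> esqrt y"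
  by (cases x; cases y) (auto simp: esqrt_def top_unique)

lemma esqrt_square: "esqrt (x * x) = x"
  by (cases x) (auto simp: esqrt_def ennreal_mult[symmetric])

locale regular =
  fixes l Q \<omega> \<phi> :: "real \<Rightarrow> real"
  assumes regular: "regular_data l Q \<omega> \<phi>"
begin

abbreviation \<theta> :: "real \<Rightarrow> real" where "\<theta> \<equiv> theta0 l Q \<omega>"

lemma
  shows l_continuous: "continuous_on {0..1} l" and l_nonneg: "t \<in> {0..1} \<Longrightarrow> 0 \<le> l t"
    and l_1: "l 1 = 1" and l_0: "l 0 = 0"
    and Q_continuous: "continuous_on {0..1} Q" and Q_pos: "t \<in> {0<..1} \<Longrightarrow> 0 < Q t" and Q_0: "Q 0 = 0"
    and \<omega>_continuous: "continuous_on {0..1} \<omega>" and \<omega>_nonneg: "t \<in> {0..1} \<Longrightarrow> 0 \<le> \<omega> t"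
    and \<omega>_0: "\<omega> 0 = 0" and \<omega>_pos: "t \<in> {0<..1} \<Longrightarrow> 0 < \<omega> t"
    and sigma_limit: "\<exists>L. ((\<lambda>t. ennreal (sqrt (\<omega> t / Q t))) \<longlongrightarrow> L) (at_right 0)"
proof -
  note r = regular[unfolded regular_data_def]
  show "continuous_on {0..1} l" "t \<in> {0..1} \<Longrightarrow> 0 \<le> l t" "l 1 = 1"
    "continuous_on {0..1} Q" "continuous_on {0..1} \<omega>" "t \<in> {0..1} \<Longrightarrow> 0 \<le> \<omega> t"
    "\<exists>L. ((\<lambda>t. ennreal (sqrt (\<omega> t / Q t))) \<longlongrightarrow> L) (at_right 0)"
    using r by auto
  have l0: "{t \<in> {0..1}. l t = 0} = {0}" and Q0: "{t \<in> {0..1}. Q t = 0} = {0}"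
    and w0: "{t \<in> {0..1}. \<omega> t = 0} = {0}" using r by auto
  show "l 0 = 0" "Q 0 = 0" "\<omega> 0 = 0" using l0 Q0 w0 by blast+
  have nonneg: "\<forall>t\<in>{0..1}. 0 \<le> Q t" "\<forall>t\<in>{0..1}. 0 \<le> \<omega> t" using r by simp_all
  have pos: "0 < f t" if "{t \<in> {0..1}. f t = 0} = {0}" "\<forall>t\<in>{0..1}. 0 \<le> f t" "t \<in> {0<..1}" for f :: "real \<Rightarrow> real" and t
  proof -
    have "t \<notin> {t \<in> {0..1}. f t = 0}" unfolding that(1) using that(3) by simp
    then show ?thesis using that(2,3) by (simp add: order_less_le)
  qed
  show "t \<in> {0<..1} \<Longrightarrow> 0 < Q t" "t \<in> {0<..1} \<Longrightarrow> 0 < \<omega> t"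
    using pos[OF Q0 nonneg(1)] pos[OF w0 nonneg(2)] by blast+
qed

lemma \<theta>_derivative:
  obtains \<theta>' where "\<And>t. t \<in> {0<..<1} \<Longrightarrow> (\<theta> has_real_derivative \<theta>' t) (at t)" "\<And>t. t \<in> {0<..<1} \<Longrightarrow> 0 < \<theta>' t"
proof -
  have "\<exists>\<theta>'. continuous_on {0<..<1} \<theta>' \<and>
        (\<forall>t\<in>{0<..<1}. (\<theta> has_real_derivative \<theta>' t) (at t) \<and> 0 < \<theta>' t)"
    using regular[unfolded regular_data_def] by (elim conjE) assumption
  then obtain \<theta>' where "\<forall>t\<in>{0<..<1}. (\<theta> has_real_derivative \<theta>' t) (at t) \<and> 0 < \<theta>' t"
    by (elim exE conjE) rule
  then show thesis by (intro that[of \<theta>']) simp_all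
qed

lemma \<theta>_0: "\<theta> 0 = 0" by (simp add: theta0_def l_0)

text \<open>A default value produced by the division by \<open>Q 0 = 0\<close>. The true end value
  is the limit stored in \<open>theta l Q \<omega> 1\<close>.\<close>

lemma \<theta>_1: "\<theta> 1 = 0" by (simp add: theta0_def Q_0)

lemma \<omega>_reflected_continuous: "continuous_on {0..1} (\<lambda>t. \<omega> (1 - t))"
  by (rule continuous_on_compose2[OF \<omega>_continuous]) (auto intro!: continuous_intros)

lemma \<theta>_continuous: "continuous_on {0..<1} \<theta>"
proof -
  have "continuous_on {0..<1} (\<lambda>t. Q (1 - t))"
    by (rule continuous_on_compose2[OF Q_continuous]) (auto intro!: continuous_intros)
  moreover have "Q (1 - t) \<noteq> 0" if "t \<in> {0..<1}" for t using Q_pos[of "1 - t"] that by auto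
  moreover have "continuous_on {0..<1} (\<lambda>t. \<omega> (1 - t))" "continuous_on {0..<1} l"
    using \<omega>_reflected_continuous l_continuous by (auto intro: continuous_on_subset)
  ultimately show ?thesis unfolding theta0_def[abs_def] by (intro continuous_intros) auto
qed

lemma \<theta>_strict_mono:
  assumes "0 \<le> x" "x < y" "y < 1"
  shows "\<theta> x < \<theta> y"
proof (rule DERIV_pos_imp_increasing_open[OF assms(2)])
  obtain \<theta>' where "\<And>t. t \<in> {0<..<1} \<Longrightarrow> (\<theta> has_real_derivative \<theta>' t) (at t)" "\<And>t. t \<in> {0<..<1} \<Longrightarrow> 0 < \<theta>' t"
    using \<theta>_derivative by blast
  then show "\<exists>d. (\<theta> has_real_derivative d) (at t) \<and> 0 < d" if "x < t" "t < y" for t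
    using that assms by (intro exI[of _ "\<theta>' t"]) auto
  show "continuous_on {x..y} \<theta>" using assms by (intro continuous_on_subset[OF \<theta>_continuous]) auto
qed

lemma \<theta>_mono: "0 \<le> x \<Longrightarrow> x \<le> y \<Longrightarrow> y < 1 \<Longrightarrow> \<theta> x \<le> \<theta> y"
  using \<theta>_strict_mono[of x y] by (cases "x = y") auto

lemma \<theta>_pos: "0 < x \<Longrightarrow> x < 1 \<Longrightarrow> 0 < \<theta> x"
  using \<theta>_strict_mono[of 0 x] \<theta>_0 by simp

lemma \<theta>_ne_0: "0 < x \<Longrightarrow> x < 1 \<Longrightarrow> \<theta> x \<noteq> 0"
  using \<theta>_pos[of x] by simp

lemma \<theta>_nonneg: "0 \<le> x \<Longrightarrow> x \<le> 1 \<Longrightarrow> 0 \<le> \<theta> x"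
  using \<theta>_pos[of x] \<theta>_0 \<theta>_1 by (cases "x = 0 \<or> x = 1") auto

lemma \<omega>_bound: obtains W where "\<And>t. t \<in> {0..1} \<Longrightarrow> \<omega> t \<le> W" "0 < W"
proof -
  have "compact (\<omega> ` {0..1})" by (intro compact_continuous_image \<omega>_continuous) simp
  then obtain W where W: "\<And>t. t \<in> {0..1} \<Longrightarrow> \<bar>\<omega> t\<bar> \<le> W"
    by (fastforce dest!: compact_imp_bounded simp: bounded_iff)
  then have "\<omega> t \<le> W + 1" if "t \<in> {0..1}" for t using W[OF that] by linarith
  moreover have "0 < W + 1" using W[of 0] by simp
  ultimately show thesis by (rule that)
qed

abbreviation \<sigma> :: ennreal where "\<sigma> \<equiv> sigma_bar Q \<omega>"

lemma filterlim_reflect: "filterlim (\<lambda>t. 1 - t) (at_right 0) (at_left (1::real))"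
  unfolding filterlim_at
  by (intro conjI) (auto simp: eventually_at_left_field intro!: tendsto_eq_intros exI[of _ 0])

lemma sqrt_ratio_tendsto: "((\<lambda>t. ennreal (sqrt (\<omega> (1 - t) / Q (1 - t)))) \<longlongrightarrow> \<sigma>) (at_left 1)"
proof -
  obtain L where L: "((\<lambda>t. ennreal (sqrt (\<omega> t / Q t))) \<longlongrightarrow> L) (at_right 0)" using sigma_limit by blast
  then have "\<sigma> = L" unfolding sigma_bar_def by (intro tendsto_Lim) (auto simp: trivial_limit_at_right_real)
  then show ?thesis using filterlim_compose[OF L filterlim_reflect] by simp
qed

lemma l_tendsto: "(l \<longlongrightarrow> 1) (at_left 1)"
  using continuous_on_Icc_at_leftD[OF l_continuous] l_1 by simp

text \<open>The factor coming from \<open>l\<close> tends to 1, so the product of the limits is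
  harmless even if \<open>\<sigma>\<close> is infinite.\<close>

lemma sqrt_\<theta>_tendsto: "((\<lambda>t. ennreal (sqrt (\<theta> t))) \<longlongrightarrow> \<sigma>) (at_left 1)"
proof -
  have lim: "((\<lambda>t. ennreal (sqrt (\<omega> (1 - t) / Q (1 - t))) * ennreal (sqrt (l t))) \<longlongrightarrow> \<sigma> * ennreal (sqrt 1)) (at_left 1)"
    by (intro tendsto_mult_ennreal sqrt_ratio_tendsto tendsto_ennrealI tendsto_real_sqrt l_tendsto) auto
  have ev: "eventually (\<lambda>t. ennreal (sqrt (\<omega> (1 - t) / Q (1 - t))) * ennreal (sqrt (l t)) = ennreal (sqrt (\<theta> t))) (at_left 1)"
  proof -
    have "eventually (\<lambda>t. t \<in> {0<..<1}) (at_left (1::real))" by (rule eventually_at_leftI[of 0]) auto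
    then show ?thesis
    proof eventually_elim
      case (elim t)
      then have "0 \<le> \<omega> (1 - t) / Q (1 - t)" "0 \<le> l t"
        using \<omega>_nonneg[of "1 - t"] Q_pos[of "1 - t"] l_nonneg[of t] by auto
      moreover have "sqrt (\<theta> t) = sqrt (\<omega> (1 - t) / Q (1 - t)) * sqrt (l t)"
        by (simp only: theta0_def real_sqrt_mult)
      ultimately show ?case by (simp only: ennreal_mult real_sqrt_ge_zero)
    qed
  qed
  from Lim_transform_eventually[OF lim ev] show ?thesis by simp
qed

lemma \<theta>_tendsto: "((\<lambda>t. ennreal (\<theta> t)) \<longlongrightarrow> theta l Q \<omega> 1) (at_left 1)"
  and theta_1: "theta l Q \<omega> 1 = \<sigma> * \<sigma>"
proof -
  have lim: "((\<lambda>t. ennreal (sqrt (\<theta> t)) * ennreal (sqrt (\<theta> t))) \<longlongrightarrow> \<sigma> * \<sigma>) (at_left 1)"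
    by (intro tendsto_mult_ennreal sqrt_\<theta>_tendsto) auto
  have "eventually (\<lambda>t. ennreal (sqrt (\<theta> t)) * ennreal (sqrt (\<theta> t)) = ennreal (\<theta> t)) (at_left 1)"
  proof -
    have "eventually (\<lambda>t. t \<in> {0<..<1}) (at_left (1::real))" by (rule eventually_at_leftI[of 0]) auto
    then show ?thesis
      by eventually_elim (use \<theta>_pos in \<open>simp add: less_imp_le flip: ennreal_mult\<close>)
  qed
  from Lim_transform_eventually[OF lim this]
  have lim: "((\<lambda>t. ennreal (\<theta> t)) \<longlongrightarrow> \<sigma> * \<sigma>) (at_left 1)" .
  then show "theta l Q \<omega> 1 = \<sigma> * \<sigma>"
    unfolding theta_def by (auto intro!: tendsto_Lim simp: trivial_limit_at_left_real)
  with lim show "((\<lambda>t. ennreal (\<theta> t)) \<longlongrightarrow> theta l Q \<omega> 1) (at_left 1)" by simp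
qed

lemma esqrt_theta_1: "esqrt (theta l Q \<omega> 1) = \<sigma>"
  by (simp add: theta_1 esqrt_square)

lemma theta_eq: "t < 1 \<Longrightarrow> theta l Q \<omega> t = ennreal (\<theta> t)"
  by (simp add: theta_def)

lemma theta_mono: "0 \<le> x \<Longrightarrow> x \<le> y \<Longrightarrow> y \<le> 1 \<Longrightarrow> theta l Q \<omega> x \<le> theta l Q \<omega> y"
proof (cases "y < 1")
  case True
  then show "0 \<le> x \<Longrightarrow> x \<le> y \<Longrightarrow> ?thesis" using \<theta>_mono[of x y] by (simp add: theta_eq ennreal_leI)
next
  case False
  assume xy: "0 \<le> x" "x \<le> y" "y \<le> 1"
  show ?thesis
  proof (cases "x < 1")
    case True
    have "ennreal (\<theta> x) \<le> theta l Q \<omega> 1"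
    proof (rule tendsto_lowerbound[OF \<theta>_tendsto])
      show "eventually (\<lambda>t. ennreal (\<theta> x) \<le> ennreal (\<theta> t)) (at_left 1)"
        using True xy(1) by (intro eventually_at_leftI[of x]) (auto intro!: ennreal_leI \<theta>_mono)
    qed (simp add: trivial_limit_at_left_real)
    then show ?thesis using True False xy by (simp add: theta_eq)
  qed (use xy False in simp)
qed

lemma \<sigma>_pos: "0 < \<sigma>"
proof -
  have "0 < theta l Q \<omega> (1/2)" using \<theta>_pos[of "1/2"] by (simp add: theta_eq)
  also have "\<dots> \<le> theta l Q \<omega> 1" by (rule theta_mono) auto
  finally show ?thesis using theta_1 by (metis mult_zero_left not_gr_zero)
qed

text \<open>The truncation makes the domain of integration in \<open>F\<close> independent of \<open>m\<close>, so that continuity and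
  limits of \<open>F\<close> follow by dominated convergence.  At \<open>t = 1\<close> the junk value \<open>\<theta> 1 = 0\<close> is harmless because \<open>\<omega> 0 = 0\<close>.\<close>

definition k :: "real \<Rightarrow> real \<Rightarrow> real" where
  "k m t = sqrt (\<omega> (1 - t) * max 0 (1 - \<theta> m / \<theta> t))"

definition F :: "real \<Rightarrow> real \<Rightarrow> real" where
  "F s m = sqrt (\<theta> m) * s + 2 * integral {0..1} (k m)"

lemma k_nonneg: "t \<in> {0..1} \<Longrightarrow> 0 \<le> k m t"
  using \<omega>_nonneg[of "1 - t"] by (simp add: k_def)

lemma k_le: "0 \<le> m \<Longrightarrow> m \<le> 1 \<Longrightarrow> t \<in> {0..1} \<Longrightarrow> k m t \<le> sqrt (\<omega> (1 - t))"
  unfolding k_def using \<omega>_nonneg[of "1 - t"] \<theta>_nonneg[of m] \<theta>_nonneg[of t]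
  by (intro real_sqrt_le_mono mult_left_le) auto

text \<open>The point \<open>t = 0\<close> is excluded: there \<open>\<theta> m / \<theta> t\<close>
  is a division by zero and \<open>k m t\<close> takes the value \<open>sqrt (\<omega> 1)\<close>.
  This single point is the reason for working on open intervals below.\<close>

lemma k_eq_0: "0 \<le> t \<Longrightarrow> t \<le> m \<Longrightarrow> 0 < m \<Longrightarrow> m < 1 \<Longrightarrow> 0 < t \<Longrightarrow> k m t = 0"
  using \<theta>_mono[of t m] \<theta>_pos[of t] by (simp add: k_def)

lemma k_0: "k 0 t = sqrt (\<omega> (1 - t))"
  by (simp add: k_def \<theta>_0)

lemma k_1: "k m 1 = 0"
  by (simp add: k_def \<omega>_0)

lemma k_continuous_on_Ioo: "continuous_on {0<..<1} (k m)"
proof -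
  have "continuous_on {0<..<1} (\<lambda>t. \<omega> (1 - t))" "continuous_on {0<..<1} \<theta>"
    using \<omega>_reflected_continuous \<theta>_continuous by (auto intro: continuous_on_subset)
  then show ?thesis
    unfolding k_def[abs_def] by (intro continuous_intros) (use \<theta>_ne_0 in auto)
qed

lemma sqrt_\<omega>_tendsto: "((\<lambda>t. sqrt (\<omega> (1 - t))) \<longlongrightarrow> 0) (at_left 1)"
  using continuous_on_Icc_at_leftD[OF continuous_on_real_sqrt[OF \<omega>_reflected_continuous]] by (simp add: \<omega>_0)

text \<open>At \<open>t = 1\<close> the quotient of \<open>\<theta>\<close>-values says nothing,
  since \<open>\<theta> 1\<close> is a default value; continuity there comes from the factor
  \<open>sqrt (\<omega> (1 - t))\<close>, which tends to 0.\<close>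

lemma k_continuous_on: "0 \<le> m \<Longrightarrow> m < 1 \<Longrightarrow> continuous_on {m..1} (k m)"
proof -
  assume m: "0 \<le> m" "m < 1"
  show ?thesis
  proof (cases "m = 0")
    case True
    then show ?thesis using continuous_on_real_sqrt[OF \<omega>_reflected_continuous] by (simp add: k_0[abs_def])
  next
    case False
    then have "continuous_on {m..<1} (k m)"
      using m by (intro continuous_on_subset[OF k_continuous_on_Ioo]) auto
    show ?thesis
      unfolding continuous_on_def
    proof
      fix t assume t: "t \<in> {m..1}"
      show "(k m \<longlongrightarrow> k m t) (at t within {m..1})"
      proof (cases "t = 1")
        case True
        have "(k m \<longlongrightarrow> 0) (at_left 1)"
        proof (rule tendsto_sandwich[OF _ _ tendsto_const sqrt_\<omega>_tendsto])
          show "eventually (\<lambda>t. 0 \<le> k m t) (at_left 1)"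
            by (intro eventually_at_leftI[of 0] k_nonneg) auto
          show "eventually (\<lambda>t. k m t \<le> sqrt (\<omega> (1 - t))) (at_left 1)"
            using m by (intro eventually_at_leftI[of 0] k_le) auto
        qed
        then show ?thesis using True m by (simp add: k_1 at_within_Icc_at_left)
      next
        case False
        then have "isCont (k m) t"
          using t \<open>m \<noteq> 0\<close> m k_continuous_on_Ioo[of m] by (intro continuous_on_interior[of "{0<..<1}"]) auto
        then show ?thesis by (auto simp: isCont_def intro: tendsto_within_subset)
      qed
    qed
  qed
qed

lemma k_bound: "\<exists>W>0. (\<forall>m\<in>{0..1}. \<forall>t\<in>{0..1}. \<bar>k m t\<bar> \<le> W) \<and> (\<forall>t\<in>{0..1}. \<omega> t \<le> W\<^sup>2)"
proof -
  obtain W where W: "\<And>t. t \<in> {0..1} \<Longrightarrow> \<omega> t \<le> W" "0 < W" using \<omega>_bound by blast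
  have "\<bar>k m t\<bar> \<le> sqrt W" if "0 \<le> m" "m \<le> 1" "t \<in> {0..1}" for m t
    using k_nonneg[of t m] k_le[OF that] that W(1)[of "1 - t"] by (auto intro: order_trans real_sqrt_le_mono)
  then show ?thesis using W by (intro exI[of _ "sqrt W"]) auto
qed

lemma k_abs_integrable: "0 \<le> m \<Longrightarrow> m \<le> 1 \<Longrightarrow> k m absolutely_integrable_on {0..1}"
proof -
  assume m: "0 \<le> m" "m \<le> 1"
  obtain W where "\<forall>m\<in>{0..1}. \<forall>t\<in>{0..1}. \<bar>k m t\<bar> \<le> W" using k_bound by blast
  then show ?thesis
    unfolding absolutely_integrable_Icc_iff_Ioo using m
    by (intro absolutely_integrable_bounded_continuous[where B = W] k_continuous_on_Ioo) auto
qed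

lemma k_integrable: "0 \<le> m \<Longrightarrow> m \<le> 1 \<Longrightarrow> 0 \<le> a \<Longrightarrow> b \<le> 1 \<Longrightarrow> k m integrable_on {a..b}"
  using set_lebesgue_integral_eq_integral(1)[OF k_abs_integrable[of m]]
  by (auto intro: integrable_on_subinterval)

lemma integral_k_tendsto:
  assumes "\<And>n. X n \<in> {0..<1}"
    "\<And>t. t \<in> {0<..<1} \<Longrightarrow> (\<lambda>n. k (X n) t) \<longlonglongrightarrow> g t"
  shows "(\<lambda>n. integral {0..1} (k (X n))) \<longlonglongrightarrow> integral {0..1} g"
proof -
  obtain W where W: "\<forall>m\<in>{0..1}. \<forall>t\<in>{0..1}. \<bar>k m t\<bar> \<le> W" using k_bound by blast
  have "(\<lambda>n. integral {0<..<1} (k (X n))) \<longlonglongrightarrow> integral {0<..<1} g"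
  proof (rule dominated_convergence(2)[where h = "\<lambda>_. W"])
    show "k (X n) integrable_on {0<..<1}" for n
      using k_integrable[of "X n" 0 1] assms(1)[of n] by (simp add: integrable_on_Icc_iff_Ioo)
    show "(\<lambda>_. W) integrable_on {0<..<1::real}"
      using integrable_on_Icc_iff_Ioo[of "\<lambda>_. W" 0 1] by auto
    show "norm (k (X n) t) \<le> W" if "t \<in> {0<..<1}" for n t
      using W assms(1)[of n] that by auto
  qed (use assms in auto)
  then show ?thesis by (simp add: integral_open_interval_real)
qed

lemma integral_k_continuous: "continuous_on {0..<1} (\<lambda>m. integral {0..1} (k m))"
  unfolding continuous_on_sequentially comp_def
proof (intro ballI allI impI)
  fix x X assume x: "x \<in> {0..<1::real}" and X: "(\<forall>n. X n \<in> {0..<1::real}) \<and> X \<longlonglongrightarrow> x"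
  have "(\<lambda>n. \<theta> (X n)) \<longlonglongrightarrow> \<theta> x"
    using \<theta>_continuous x X unfolding continuous_on_sequentially comp_def by blast
  then have "(\<lambda>n. k (X n) t) \<longlonglongrightarrow> k x t" if "t \<in> {0<..<1}" for t
    unfolding k_def using \<theta>_pos[of t] that by (intro tendsto_intros) auto
  then show "(\<lambda>n. integral {0..1} (k (X n))) \<longlonglongrightarrow> integral {0..1} (k x)"
    using x X by (intro integral_k_tendsto) auto
qed

lemma F_continuous: "continuous_on {0..<1} (F s)"
  unfolding F_def[abs_def] by (intro continuous_intros \<theta>_continuous integral_k_continuous)

lemma integral_k_tendsto_0: "((\<lambda>m. integral {0..1} (k m)) \<longlongrightarrow> 0) (at_left 1)"
proof (rule tendsto_at_left_sequentially[of 0])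
  fix X :: "nat \<Rightarrow> real" assume X: "\<And>n. X n < 1" "\<And>n. 0 < X n" "incseq X" "X \<longlonglongrightarrow> 1"
  have "(\<lambda>n. integral {0..1} (k (X n))) \<longlonglongrightarrow> integral {0..1} (\<lambda>_::real. 0)"
  proof (rule integral_k_tendsto)
    show "X n \<in> {0..<1}" for n using X(1,2)[of n] by simp
    fix t :: real assume t: "t \<in> {0<..<1}"
    then have "eventually (\<lambda>n. t < X n) sequentially" using X(4) by (intro order_tendstoD) auto
    then show "(\<lambda>n. k (X n) t) \<longlonglongrightarrow> 0"
      by (intro tendsto_eventually) (elim eventually_mono, use k_eq_0[of t] X t in auto)
  qed
  then show "(\<lambda>n. integral {0..1} (k (X n))) \<longlonglongrightarrow> 0" by simp
qed simp

lemma F_nonneg: "0 \<le> s \<Longrightarrow> 0 \<le> m \<Longrightarrow> m \<le> 1 \<Longrightarrow> 0 \<le> F s m"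
  unfolding F_def using \<theta>_nonneg[of m] k_nonneg
  by (intro add_nonneg_nonneg mult_nonneg_nonneg integral_nonneg k_integrable) auto

text \<open>\<open>ennreal s\<close> enters as a constant finite factor, so the limit passes through
  the product even for \<open>s = 0\<close> and infinite \<open>\<sigma>\<close>, in accordance with
  \<open>0 * \<infinity> = 0\<close>.\<close>

lemma F_tendsto: "0 \<le> s \<Longrightarrow> ((\<lambda>m. ennreal (F s m)) \<longlongrightarrow> \<sigma> * ennreal s) (at_left 1)"
proof -
  assume s: "0 \<le> s"
  have lim: "((\<lambda>m. ennreal s * ennreal (sqrt (\<theta> m)) + ennreal (2 * integral {0..1} (k m))) \<longlongrightarrow> ennreal s * \<sigma> + ennreal (2 * 0)) (at_left 1)"
    by (intro tendsto_add tendsto_ennrealI tendsto_mult tendsto_const integral_k_tendsto_0 ennreal_tendsto_cmult sqrt_\<theta>_tendsto) simp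
  have ev: "eventually (\<lambda>m. ennreal s * ennreal (sqrt (\<theta> m)) + ennreal (2 * integral {0..1} (k m)) = ennreal (F s m)) (at_left 1)"
  proof -
    have "eventually (\<lambda>t. t \<in> {0<..<1}) (at_left (1::real))" by (rule eventually_at_leftI[of 0]) auto
    then show ?thesis
    proof eventually_elim
      case (elim m)
      have "0 \<le> integral {0..1} (k m)" using elim by (intro integral_nonneg k_integrable k_nonneg) auto
      then show ?case using s \<theta>_nonneg[of m] elim
        by (simp add: F_def ennreal_plus ennreal_mult mult.commute)
    qed
  qed
  from Lim_transform_eventually[OF lim ev] show ?thesis by (simp add: mult.commute)
qed

lemma F_0: "F s 0 = 2 * Psi \<omega> 1"
  by (simp add: F_def \<theta>_0 Psi_def k_0[abs_def])

end

section \<open>Critical points of the length function\<close>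

text \<open>Pointwise bounds are asked for on the open interval only, because at end points
  \<open>k\<close> and \<open>P\<close> may take values that stem from division by zero.\<close>

lemma integral_le_Ioo:
  fixes f g :: "real \<Rightarrow> real"
  assumes "f integrable_on {a..b}" "g integrable_on {a..b}" "\<And>x. x \<in> {a<..<b} \<Longrightarrow> f x \<le> g x"
  shows "integral {a..b} f \<le> integral {a..b} g"
  unfolding integral_open_interval_real
  by (rule integral_le) (use assms in \<open>auto simp: integrable_on_Icc_iff_Ioo\<close>)

context regular
begin

text \<open>The slope \<open>du/dv\<close>, at height \<open>t\<close>, of the geodesic that turns
  at height \<open>y\<close>; its Clairaut constant is \<open>sqrt (\<theta> y)\<close>.\<close>

definition P :: "real \<Rightarrow> real \<Rightarrow> real" where
  "P y t = sqrt (\<theta> y * \<omega> (1 - t) / (\<theta> t * (\<theta> t - \<theta> y)))"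

lemma Phi_eq: "Phi l Q \<omega> y = 2 * (\<integral>\<^sup>+ t\<in>{y<..<1}. ennreal (P y t) \<partial>lebesgue)"
  by (simp add: Phi_def P_def)

lemma P_eq: "P y t = sqrt (\<omega> (1 - t)) * (sqrt (\<theta> y) / sqrt (\<theta> t * (\<theta> t - (sqrt (\<theta> y))\<^sup>2)))"
  if "0 \<le> y" "y \<le> 1"
  using \<theta>_nonneg[OF that] by (simp add: P_def real_sqrt_mult real_sqrt_divide)

lemma P_nonneg: "0 < y \<Longrightarrow> y < t \<Longrightarrow> t < 1 \<Longrightarrow> 0 \<le> P y t"
  using \<theta>_strict_mono[of y t] \<theta>_pos[of y] \<theta>_pos[of t] \<omega>_nonneg[of "1 - t"] by (simp add: P_def)

lemma P_continuous: "0 < y \<Longrightarrow> continuous_on {y<..<1} (P y)"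
proof -
  assume y: "0 < y"
  have "continuous_on {y<..<1} (\<lambda>t. \<omega> (1 - t))" "continuous_on {y<..<1} \<theta>"
    using \<omega>_reflected_continuous \<theta>_continuous y by (auto intro: continuous_on_subset)
  moreover have "\<theta> t * (\<theta> t - \<theta> y) \<noteq> 0" if "t \<in> {y<..<1}" for t
    using \<theta>_strict_mono[of y t] \<theta>_pos[of t] y that by simp
  ultimately show ?thesis unfolding P_def[abs_def] by (intro continuous_intros) blast+
qed

lemma P_measurable: "0 < y \<Longrightarrow> (\<lambda>t. indicator {y<..<1} t *\<^sub>R P y t) \<in> borel_measurable borel"
  by (intro borel_measurable_continuous_on_indicator P_continuous) auto

lemma P_bounded:
  assumes "0 < y" "y < x" "x < 1"
  obtains B where "\<And>t. t \<in> {x<..<1} \<Longrightarrow> \<bar>P y t\<bar> \<le> B"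
proof -
  obtain W where W: "\<And>t. t \<in> {0..1} \<Longrightarrow> \<omega> t \<le> W" "0 < W" using \<omega>_bound by blast
  have "\<bar>P y t\<bar> \<le> sqrt (\<theta> y * W / (\<theta> x * (\<theta> x - \<theta> y)))" if t: "t \<in> {x<..<1}" for t
  proof -
    have th: "0 < \<theta> y" "\<theta> y < \<theta> x" "\<theta> x < \<theta> t"
      using \<theta>_pos[of y] \<theta>_strict_mono[of y x] \<theta>_strict_mono[of x t] assms t by auto
    have "\<theta> y * \<omega> (1 - t) / (\<theta> t * (\<theta> t - \<theta> y)) \<le> \<theta> y * W / (\<theta> x * (\<theta> x - \<theta> y))"
      using th W(1)[of "1 - t"] W(2) \<omega>_nonneg[of "1 - t"] t assms
      by (intro frac_le mult_left_mono mult_mono mult_pos_pos) auto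
    then show ?thesis using P_nonneg[of y t] t assms by (simp add: P_def)
  qed
  then show thesis by (rule that)
qed

lemma P_abs_integrable: "0 < y \<Longrightarrow> y < x \<Longrightarrow> x < 1 \<Longrightarrow> P y absolutely_integrable_on {x<..<1}"
proof -
  assume yx: "0 < y" "y < x" "x < 1"
  obtain B where "\<And>t. t \<in> {x<..<1} \<Longrightarrow> \<bar>P y t\<bar> \<le> B" using P_bounded[OF yx] by blast
  then show ?thesis
    using yx by (intro absolutely_integrable_bounded_continuous continuous_on_subset[OF P_continuous]) auto
qed

text \<open>For fixed \<open>t\<close>, \<open>k m t\<close> is a concave function of
  \<open>c = sqrt (\<theta> m)\<close> with derivative \<open>- P m t\<close>. The tangent line at
  \<open>y\<close> does the work of differentiating \<open>F\<close> under the integral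
  sign.\<close>

lemma k_tangent:
  assumes "0 \<le> x" "0 < y" "x \<le> t" "y < t" "t < 1"
  shows "k x t \<le> k y t + - (sqrt (\<theta> x) - sqrt (\<theta> y)) * P y t"
proof -
  have th: "0 \<le> \<theta> x" "\<theta> x \<le> \<theta> t" "0 < \<theta> y" "\<theta> y < \<theta> t"
    using assms \<theta>_nonneg[of x] \<theta>_mono[of x t] \<theta>_pos[of y] \<theta>_strict_mono[of y t] by auto
  have kk: "k z t = sqrt (\<omega> (1 - t)) * sqrt (1 - (sqrt (\<theta> z))\<^sup>2 / \<theta> t)" if "0 \<le> \<theta> z" "\<theta> z \<le> \<theta> t" for z
    using that th by (simp add: k_def real_sqrt_mult max_def)
  have "sqrt (1 - (sqrt (\<theta> x))\<^sup>2 / \<theta> t) - sqrt (1 - (sqrt (\<theta> y))\<^sup>2 / \<theta> t)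
      \<le> - (sqrt (\<theta> x) - sqrt (\<theta> y)) * (sqrt (\<theta> y) / sqrt (\<theta> t * (\<theta> t - (sqrt (\<theta> y))\<^sup>2)))"
    using th by (intro sqrt_tangent_inequality) auto
  moreover have "0 \<le> sqrt (\<omega> (1 - t))" using \<omega>_nonneg[of "1 - t"] assms by simp
  ultimately have "sqrt (\<omega> (1 - t)) * (sqrt (1 - (sqrt (\<theta> x))\<^sup>2 / \<theta> t) - sqrt (1 - (sqrt (\<theta> y))\<^sup>2 / \<theta> t))
      \<le> sqrt (\<omega> (1 - t)) * (- (sqrt (\<theta> x) - sqrt (\<theta> y)) * (sqrt (\<theta> y) / sqrt (\<theta> t * (\<theta> t - (sqrt (\<theta> y))\<^sup>2))))"
    by (rule mult_left_mono)
  also have "\<dots> = - (sqrt (\<theta> x) - sqrt (\<theta> y)) * P y t"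
    using assms by (simp add: P_eq)
  finally show ?thesis using th by (simp add: kk right_diff_distrib)
qed

lemma integral_k_split:
  assumes "0 \<le> m" "m \<le> 1" "0 \<le> x" "x \<le> 1"
  shows "integral {0..1} (k m) = integral {0..x} (k m) + integral {x..1} (k m)"
  using Henstock_Kurzweil_Integration.integral_combine[OF assms(3,4) k_integrable[OF assms(1,2)]] by simp

text \<open>\<open>P y\<close> is singular at \<open>t = y\<close>, perhaps not even integrable. By
  monotone convergence the finite integrals over \<open>{x<..<1}\<close> still exceed any real
  number below \<open>Phi\<close>, with \<open>x\<close> as close to \<open>y\<close> as desired; an
  infinite \<open>Phi\<close> is included.\<close>

lemma Phi_approximation:
  assumes y: "0 < y" "y < 1" and s: "0 \<le> s" "ennreal s < Phi l Q \<omega> y" and b: "y < b"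
  obtains x where "y < x" "x < b" "x < 1" "s < 2 * integral {x<..<1} (P y)"
proof -
  define f where "f n t = ennreal (indicator {y<..<1} t *\<^sub>R P y t) * indicator {y + 1 / Suc n<..} t" for n t
  have "Phi l Q \<omega> y = 2 * (\<integral>\<^sup>+ t. (SUP n. f n t) \<partial>lebesgue)"
  proof -
    have "ennreal (P y t) * indicator {y<..<1} t = (SUP n. f n t)" for t
    proof (cases "y < t")
      case True
      then obtain n where n: "1 / real (Suc n) < t - y" using nat_approx_posE[of "t - y"] by auto
      have "(SUP n. f n t) = ennreal (indicator {y<..<1} t *\<^sub>R P y t)"
      proof (rule antisym)
        show "(SUP n. f n t) \<le> ennreal (indicator {y<..<1} t *\<^sub>R P y t)"
          by (intro SUP_least) (auto simp: f_def split: split_indicator)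
        have "ennreal (indicator {y<..<1} t *\<^sub>R P y t) = f n t" using n by (simp add: f_def)
        also have "\<dots> \<le> (SUP n. f n t)" by (rule SUP_upper) simp
        finally show "ennreal (indicator {y<..<1} t *\<^sub>R P y t) \<le> (SUP n. f n t)" .
      qed
      then show ?thesis by (auto split: split_indicator)
    next
      case False
      then show ?thesis by (simp add: f_def)
    qed
    then show ?thesis by (simp add: Phi_eq)
  qed
  also have "(\<integral>\<^sup>+ t. (SUP n. f n t) \<partial>lebesgue) = (SUP n. \<integral>\<^sup>+ t. f n t \<partial>lebesgue)"
  proof (rule nn_integral_monotone_convergence_SUP)
    show "incseq f"
    proof (intro incseq_SucI le_funI)
      fix n t
      have "1 / real (Suc (Suc n)) \<le> 1 / real (Suc n)" by (simp add: field_simps)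
      then show "f n t \<le> f (Suc n) t" by (auto simp: f_def split: split_indicator)
    qed
    show "f n \<in> borel_measurable lebesgue" for n
      unfolding f_def using P_measurable[OF y(1)] by (intro measurable_completion) simp
  qed
  also have "2 * \<dots> = (SUP n. 2 * (\<integral>\<^sup>+ t. f n t \<partial>lebesgue))" by (rule SUP_mult_left_ennreal)
  finally obtain n where n: "ennreal s < 2 * (\<integral>\<^sup>+ t. f n t \<partial>lebesgue)"
    using s(2) by (auto simp: less_SUP_iff)
  define e where "e = 1 / real (Suc n)"
  have e: "0 < e" by (simp add: e_def)
  \<comment> \<open>Below \<open>b\<close> and 1 by the midpoint, and at most \<open>y + e\<close>,
    so that \<open>{x<..<1}\<close> contains the support of \<open>f n\<close>.\<close>
  define x where "x = min ((y + min b 1) / 2) (y + e)"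
  have x: "y < x" "x < b" "x < 1" "x \<le> y + e"
    using y b e by (auto simp: x_def min_def)
  define A where "A = integral {x<..<1} (P y)"
  have "(\<integral>\<^sup>+ t. f n t \<partial>lebesgue) \<le> (\<integral>\<^sup>+ t\<in>{x<..<1}. ennreal (P y t) \<partial>lebesgue)"
    using x by (intro nn_integral_mono) (auto simp: f_def e_def split: split_indicator)
  also have "\<dots> = ennreal A"
    unfolding A_def using y x P_nonneg by (intro nn_integral_eq_ennreal_integral P_abs_integrable) auto
  finally have "ennreal s < 2 * ennreal A" using n by (metis mult_left_mono less_le_trans zero_le)
  also have "2 * ennreal A = ennreal (2 * A)" by (simp add: ennreal_mult')
  finally have sA: "s < 2 * A" using s(1) by (simp add: ennreal_less_iff)
  with x show thesis using that A_def by blast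
qed

text \<open>When the level is raised from \<open>y\<close> to \<open>x\<close>, the tangent bound is
  used only on \<open>{x<..<1}\<close>, away from the singularity of \<open>P y\<close>; below
  \<open>x\<close> the new integrand vanishes. The change of \<open>F\<close> is then at most the
  increase of \<open>sqrt \<theta>\<close> times \<open>s - 2 * A\<close>, which is negative for a
  suitable \<open>x\<close>.\<close>

lemma F_decreases_to_the_right:
  assumes y: "0 < y" "y < 1" and s: "0 \<le> s" "ennreal s < Phi l Q \<omega> y" and b: "y < b"
  obtains x where "y < x" "x < b" "x < 1" "F s x < F s y"
proof -
  obtain x where x: "y < x" "x < b" "x < 1" and sA': "s < 2 * integral {x<..<1} (P y)"
    using Phi_approximation[OF assms] by blast
  define A where "A = integral {x<..<1} (P y)"
  have sA: "s < 2 * A" using sA' by (simp add: A_def)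
  have Pi: "P y integrable_on {x..1}"
    using set_lebesgue_integral_eq_integral(1)[OF P_abs_integrable[OF y(1) x(1,3)]]
    by (simp add: integrable_on_Icc_iff_Ioo)
  have 1: "integral {0..x} (k x) \<le> integral {0..x} (k y)"
    using x y k_eq_0[of _ x] k_nonneg[of _ y] by (intro integral_le_Ioo k_integrable) auto
  have "integral {x..1} (k x) \<le> integral {x..1} (\<lambda>t. k y t + - (sqrt (\<theta> x) - sqrt (\<theta> y)) * P y t)"
    using x y by (intro integral_le_Ioo k_integrable integrable_add integrable_on_mult_right Pi k_tangent) auto
  also have "\<dots> = integral {x..1} (k y) + - (sqrt (\<theta> x) - sqrt (\<theta> y)) * A"
    using x y by (subst integral_add) (auto simp: A_def integral_open_interval_real intro!: k_integrable integrable_on_mult_right Pi)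
  finally have "integral {0..1} (k x) \<le> integral {0..1} (k y) - (sqrt (\<theta> x) - sqrt (\<theta> y)) * A"
    using 1 integral_k_split[of x x] integral_k_split[of y x] x y by (simp add: algebra_simps)
  then have "F s x \<le> F s y + (sqrt (\<theta> x) - sqrt (\<theta> y)) * (s - 2 * A)"
    by (simp add: F_def algebra_simps)
  moreover have "(sqrt (\<theta> x) - sqrt (\<theta> y)) * (s - 2 * A) < 0"
    using sA \<theta>_strict_mono[of y x] x y by (intro mult_pos_neg) auto
  ultimately show thesis using that x by auto
qed

lemma Phi_finite:
  assumes y: "0 < y" "y < 1" and fin: "Phi l Q \<omega> y < top"
  shows "P y absolutely_integrable_on {y<..<1}" "Phi l Q \<omega> y = ennreal (2 * integral {y<..<1} (P y))"
proof -
  have eq: "(\<integral>\<^sup>+ t. ennreal (indicator {y<..<1} t *\<^sub>R P y t) \<partial>lebesgue) = (\<integral>\<^sup>+ t\<in>{y<..<1}. ennreal (P y t) \<partial>lebesgue)"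
    by (intro nn_integral_cong) (auto split: split_indicator)
  have fin': "(\<integral>\<^sup>+ t\<in>{y<..<1}. ennreal (P y t) \<partial>lebesgue) < \<infinity>"
  proof (rule ccontr)
    assume "\<not> ?thesis"
    then have "(\<integral>\<^sup>+ t\<in>{y<..<1}. ennreal (P y t) \<partial>lebesgue) = top" by (simp add: not_less top_unique)
    then show False using fin by (simp add: Phi_eq ennreal_mult_top)
  qed
  show Pa: "P y absolutely_integrable_on {y<..<1}"
    unfolding set_integrable_def
  proof (rule integrableI_nonneg)
    show "(\<lambda>t. indicator {y<..<1} t *\<^sub>R P y t) \<in> borel_measurable lebesgue"
      using P_measurable[OF y(1)] by (intro measurable_completion) simp
    show "AE t in lebesgue. 0 \<le> indicator {y<..<1} t *\<^sub>R P y t"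
      using P_nonneg y by (auto split: split_indicator)
  qed (use eq fin' in simp)
  have "(\<integral>\<^sup>+ t\<in>{y<..<1}. ennreal (P y t) \<partial>lebesgue) = ennreal (integral {y<..<1} (P y))"
    using P_nonneg y by (intro nn_integral_eq_ennreal_integral Pa) auto
  then show "Phi l Q \<omega> y = ennreal (2 * integral {y<..<1} (P y))"
    by (simp add: Phi_eq ennreal_mult')
qed

lemma F_decreases_to_the_left:
  assumes y: "0 < y" "y < 1" and s: "0 \<le> s" "Phi l Q \<omega> y < ennreal s" and a: "a < y"
  obtains x where "a < x" "0 < x" "x < y" "F s x < F s y"
proof -
  define A where "A = integral {y<..<1} (P y)"
  have Pa: "P y absolutely_integrable_on {y<..<1}" and "Phi l Q \<omega> y = ennreal (2 * A)"
    unfolding A_def using Phi_finite[OF y] s(2) order_less_trans[OF s(2) ennreal_less_top] by auto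
  then have "ennreal (2 * A) < ennreal s" using s(2) by simp
  then have sA: "0 < s - 2 * A" using ennreal_leI[of s "2 * A"] by (cases "s \<le> 2 * A") auto
  define D where "D = s - 2 * A"
  have Pi: "P y integrable_on {y..1}"
    using set_lebesgue_integral_eq_integral(1)[OF Pa] by (simp add: integrable_on_Icc_iff_Ioo)
  obtain W where W: "W > 0" "\<And>t. t \<in> {0..1} \<Longrightarrow> \<omega> t \<le> W\<^sup>2" using k_bound by blast
  have bound: "F s x \<le> F s y - (sqrt (\<theta> y) - sqrt (\<theta> x)) * D + 2 * ((y - x) * (W * sqrt (1 - \<theta> x / \<theta> y)))"
    if x: "0 < x" "x < y" for x
  proof -
    have 1: "integral {0..x} (k x) \<le> integral {0..x} (k y)"
      using x y k_eq_0[of _ x] k_nonneg[of _ y] by (intro integral_le_Ioo k_integrable) auto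
    have "k x t \<le> k y t + W * sqrt (1 - \<theta> x / \<theta> y)" if t: "t \<in> {x<..<y}" for t
    proof -
      have th: "0 < \<theta> x" "\<theta> x < \<theta> t" "\<theta> t < \<theta> y"
        using \<theta>_pos[of x] \<theta>_strict_mono[of x t] \<theta>_strict_mono[of t y] x y t by auto
      have "k x t = sqrt (\<omega> (1 - t)) * sqrt (1 - \<theta> x / \<theta> t)" using th by (simp add: k_def real_sqrt_mult max_def)
      also have "\<dots> \<le> W * sqrt (1 - \<theta> x / \<theta> y)"
      proof (intro mult_mono)
        show "sqrt (\<omega> (1 - t)) \<le> W" using W(2)[of "1 - t"] W(1) t x y by (auto intro: real_le_lsqrt)
        show "sqrt (1 - \<theta> x / \<theta> t) \<le> sqrt (1 - \<theta> x / \<theta> y)"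
          using th by (intro real_sqrt_le_mono diff_left_mono divide_left_mono) auto
        show "0 \<le> sqrt (1 - \<theta> x / \<theta> t)" using th by simp
      qed (use W in simp)
      also have "\<dots> \<le> k y t + W * sqrt (1 - \<theta> x / \<theta> y)" using k_nonneg[of t y] t x y by simp
      finally show ?thesis .
    qed
    then have "integral {x..y} (k x) \<le> integral {x..y} (\<lambda>t. k y t + W * sqrt (1 - \<theta> x / \<theta> y))"
      using x y by (intro integral_le_Ioo k_integrable integrable_add) auto
    also have "\<dots> = integral {x..y} (k y) + (y - x) * (W * sqrt (1 - \<theta> x / \<theta> y))"
      using x y by (subst integral_add) (auto intro!: k_integrable)
    finally have 2: "integral {x..y} (k x) \<le> integral {x..y} (k y) + (y - x) * (W * sqrt (1 - \<theta> x / \<theta> y))" .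
    have "integral {y..1} (k x) \<le> integral {y..1} (\<lambda>t. k y t + - (sqrt (\<theta> x) - sqrt (\<theta> y)) * P y t)"
      using x y by (intro integral_le_Ioo k_integrable integrable_add integrable_on_mult_right Pi k_tangent) auto
    also have "\<dots> = integral {y..1} (k y) + - (sqrt (\<theta> x) - sqrt (\<theta> y)) * A"
      using x y by (subst integral_add) (auto simp: A_def integral_open_interval_real intro!: k_integrable integrable_on_mult_right Pi)
    finally have 3: "integral {y..1} (k x) \<le> integral {y..1} (k y) + (sqrt (\<theta> y) - sqrt (\<theta> x)) * A" by simp
    have split: "integral {0..1} (k m) = integral {0..x} (k m) + integral {x..y} (k m) + integral {y..1} (k m)"
      if "0 \<le> m" "m \<le> 1" for m
      using Henstock_Kurzweil_Integration.integral_combine[of 0 x y "k m"] integral_k_split[OF that, of y]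
        k_integrable[OF that, of 0 y] x y by simp
    show ?thesis
      using 1 2 3 split[of x] split[of y] x y by (simp add: F_def D_def algebra_simps)
  qed
  obtain \<kappa> where \<kappa>: "(\<theta> has_real_derivative \<kappa>) (at y)" "0 < \<kappa>"
    using \<theta>_derivative y by (metis greaterThanLessThan_iff)
  have "((\<lambda>x. (\<theta> x - \<theta> y) / (x - y)) \<longlongrightarrow> \<kappa>) (at_left y)"
    using \<kappa>(1) unfolding has_field_derivative_iff by (rule tendsto_within_subset) simp
  then have ev1: "eventually (\<lambda>x. \<kappa> / 2 < (\<theta> x - \<theta> y) / (x - y)) (at_left y)"
    using \<kappa>(2) by (intro order_tendstoD) auto
  have "((\<lambda>x. 4 * W * sqrt (y - x)) \<longlongrightarrow> 4 * W * sqrt (y - y)) (at_left y)"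
    by (intro tendsto_intros)
  \<comment> \<open>Chosen to give \<open>key\<close>: the slab cost is
    \<open>4 * W * (y - x)\<close> times \<open>sqrt d / (2 * sqrt (\<theta> y))\<close>, the gain
    is at least \<open>sqrt d * D\<close> times the same factor, and \<open>\<kappa> / 2\<close>
    bounds the difference quotient of \<open>\<theta>\<close> from below.\<close>
  then have ev2: "eventually (\<lambda>x. 4 * W * sqrt (y - x) < sqrt (\<kappa> / 2) * D) (at_left y)"
    using \<kappa>(2) sA by (intro order_tendstoD) (auto simp: D_def)
  have ev3: "eventually (\<lambda>x. x \<in> {max 0 a<..<y}) (at_left y)"
    using y a by (intro eventually_at_leftI[of "max 0 a"]) auto
  obtain x where x: "\<kappa> / 2 < (\<theta> x - \<theta> y) / (x - y)" "4 * W * sqrt (y - x) < sqrt (\<kappa> / 2) * D" "x \<in> {max 0 a<..<y}"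
    using eventually_happens[OF eventually_conj[OF ev1 eventually_conj[OF ev2 ev3]]]
    by (auto simp: trivial_limit_at_left_real)
  define d where "d = \<theta> y - \<theta> x"
  have th: "0 < \<theta> x" "\<theta> x < \<theta> y" using \<theta>_pos[of x] \<theta>_strict_mono[of x y] x(3) y by auto
  have d: "\<kappa> / 2 * (y - x) \<le> d"
    using x(1,3) by (simp add: d_def field_simps)
  have "4 * W * (y - x) = 4 * W * sqrt (y - x) * sqrt (y - x)" using x(3) by simp
  also have "\<dots> < sqrt (\<kappa> / 2) * D * sqrt (y - x)"
    using x(2,3) by (intro mult_strict_right_mono) auto
  also have "\<dots> = sqrt (\<kappa> / 2 * (y - x)) * D" by (simp only: real_sqrt_mult ac_simps)
  also have "\<dots> \<le> sqrt d * D" using d sA by (intro mult_right_mono) (auto simp: D_def)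
  finally have key: "4 * W * (y - x) < sqrt d * D" .
  have d0: "0 < d" using th by (simp add: d_def)
  have cd: "sqrt d * sqrt d / (2 * sqrt (\<theta> y)) \<le> sqrt (\<theta> y) - sqrt (\<theta> x)"
  proof -
    have "sqrt d * sqrt d = (sqrt (\<theta> y) - sqrt (\<theta> x)) * (sqrt (\<theta> y) + sqrt (\<theta> x))"
      using th d0 by (simp add: d_def algebra_simps)
    also have "\<dots> \<le> (sqrt (\<theta> y) - sqrt (\<theta> x)) * (2 * sqrt (\<theta> y))"
      using th by (intro mult_left_mono) auto
    finally show ?thesis using th by (simp add: field_simps)
  qed
  have "2 * ((y - x) * (W * sqrt (1 - \<theta> x / \<theta> y))) = 4 * W * (y - x) * (sqrt d / (2 * sqrt (\<theta> y)))"
  proof -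
    have "1 - \<theta> x / \<theta> y = d / \<theta> y" using th by (simp add: d_def field_simps)
    then show ?thesis by (simp add: real_sqrt_divide)
  qed
  also have "\<dots> < sqrt d * D * (sqrt d / (2 * sqrt (\<theta> y)))"
    using key d0 th by (intro mult_strict_right_mono) auto
  also have "\<dots> = sqrt d * sqrt d / (2 * sqrt (\<theta> y)) * D" by simp
  also have "\<dots> \<le> (sqrt (\<theta> y) - sqrt (\<theta> x)) * D"
    using cd sA by (intro mult_right_mono) (auto simp: D_def)
  finally have "F s x < F s y" using bound[of x] x(3) by simp
  then show thesis using that[of x] x(3) by auto
qed

text \<open>As \<open>F s m\<close> lies below the limit of \<open>F s\<close> at 1, some
  \<open>b\<close> beyond \<open>m\<close> has a larger value. A minimizer on \<open>{a..b}\<close>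
  therefore differs from \<open>b\<close> and has room on its right for a descent step.\<close>

lemma F_local_minimum:
  assumes s: "0 \<le> s" and am: "0 \<le> a" "a \<le> m" "m < 1" and lt: "ennreal (F s m) < \<sigma> * ennreal s"
  obtains y b where "a \<le> y" "y < b" "b < 1" "F s y \<le> F s m" "\<And>z. z \<in> {a..b} \<Longrightarrow> F s y \<le> F s z"
proof -
  have "eventually (\<lambda>x. ennreal (F s m) < ennreal (F s x)) (at_left 1)"
    using F_tendsto[OF s] lt by (rule order_tendstoD(1))
  moreover have "eventually (\<lambda>x. x \<in> {m<..<1}) (at_left 1)"
    using am by (intro eventually_at_leftI[of m]) auto
  ultimately have "eventually (\<lambda>x. ennreal (F s m) < ennreal (F s x) \<and> x \<in> {m<..<1}) (at_left 1)"
    by (rule eventually_conj)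
  then obtain b where b: "ennreal (F s m) < ennreal (F s b)" "m < b" "b < 1"
    using eventually_happens by (fastforce simp: trivial_limit_at_left_real)
  have "continuous_on {a..b} (F s)" using am b by (intro continuous_on_subset[OF F_continuous]) auto
  then obtain y where y: "y \<in> {a..b}" "\<And>z. z \<in> {a..b} \<Longrightarrow> F s y \<le> F s z"
    using continuous_attains_inf[of "{a..b}" "F s"] am b by auto
  have "F s y \<le> F s m" using y(2)[of m] am b by simp
  moreover have "y \<noteq> b"
  proof
    assume "y = b"
    then show False using \<open>F s y \<le> F s m\<close> b(1) by (meson ennreal_leI not_le)
  qed
  ultimately show thesis using that[of y b] y b by auto
qed

text \<open>At a minimizer with value below \<open>R\<close>, height 0 and every solution of
  \<open>Phi l Q \<omega> y = ennreal s\<close> are excluded by assumption, all other heights by one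
  of the two descent lemmas. With an arbitrary bound \<open>R\<close> the solution set may be
  empty.\<close>

lemma F_lower_bound:
  assumes s: "0 \<le> s" and R: "R \<le> ennreal (F s 0)" "R \<le> \<sigma> * ennreal s"
    "\<And>y. 0 < y \<Longrightarrow> y < 1 \<Longrightarrow> Phi l Q \<omega> y = ennreal s \<Longrightarrow> R \<le> ennreal (F s y)"
    and m: "0 \<le> m" "m < 1"
  shows "R \<le> ennreal (F s m)"
proof (rule ccontr)
  assume "\<not> ?thesis"
  then have lt: "ennreal (F s m) < R" by simp
  obtain y b where y: "0 \<le> y" "y < b" "b < 1" "F s y \<le> F s m" "\<And>z. z \<in> {0..b} \<Longrightarrow> F s y \<le> F s z"
    using F_local_minimum[OF s _ m less_le_trans[OF lt R(2)]] by auto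
  have ltR: "ennreal (F s y) < R" using y(4) lt by (meson ennreal_leI order_le_less_trans)
  then have "0 < y" using R(1) y(1) by (cases "y = 0") auto
  moreover have "\<not> Phi l Q \<omega> y < ennreal s"
  proof
    assume "Phi l Q \<omega> y < ennreal s"
    then obtain x where "0 < x" "x < y" "F s x < F s y"
      using F_decreases_to_the_left[of y s 0] \<open>0 < y\<close> y s by auto
    then show False using y(5)[of x] y(2) by auto
  qed
  moreover have "\<not> ennreal s < Phi l Q \<omega> y"
  proof
    assume "ennreal s < Phi l Q \<omega> y"
    then obtain x where "y < x" "x < b" "F s x < F s y"
      using F_decreases_to_the_right[of y s b] \<open>0 < y\<close> y s by auto
    then show False using y(5)[of x] y(1) by auto
  qed
  ultimately have "R \<le> ennreal (F s y)" using y by (intro R(3)) auto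
  then show False using ltR by simp
qed

text \<open>Only descent to the right is available, so the minimization starts at \<open>m\<close>
  itself: a minimizer at the left end of \<open>{m..b}\<close> still has room on its right.\<close>

lemma F_lower_bound_small:
  assumes s: "0 \<le> s" "\<And>y. 0 < y \<Longrightarrow> y < 1 \<Longrightarrow> ennreal s < Phi l Q \<omega> y" and m: "0 < m" "m < 1"
  shows "\<sigma> * ennreal s \<le> ennreal (F s m)"
proof (rule ccontr)
  assume "\<not> ?thesis"
  then have lt: "ennreal (F s m) < \<sigma> * ennreal s" by simp
  obtain y b where y: "m \<le> y" "y < b" "b < 1" "\<And>z. z \<in> {m..b} \<Longrightarrow> F s y \<le> F s z"
    using F_local_minimum[OF s(1) _ _ m(2) lt, of m] m by auto
  obtain x where "y < x" "x < b" "F s x < F s y"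
    using F_decreases_to_the_right[of y s b] s y m by auto
  then show False using y(4)[of x] y(1) by auto
qed

text \<open>Here descent to the left is always possible, and \<open>{0..m}\<close> offers it at
  every positive height, which forces the minimizer to 0. The behaviour of \<open>F\<close> near 1
  does not enter.\<close>

lemma F_lower_bound_large:
  assumes s: "0 \<le> s" "\<And>y. 0 < y \<Longrightarrow> y < 1 \<Longrightarrow> Phi l Q \<omega> y < ennreal s" and m: "0 \<le> m" "m < 1"
  shows "F s 0 \<le> F s m"
proof -
  have "continuous_on {0..m} (F s)" using m by (intro continuous_on_subset[OF F_continuous]) auto
  then obtain y where y: "y \<in> {0..m}" "\<And>z. z \<in> {0..m} \<Longrightarrow> F s y \<le> F s z"
    using continuous_attains_inf[of "{0..m}" "F s"] m by auto
  have "y = 0"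
  proof (rule ccontr)
    assume "y \<noteq> 0"
    then obtain x where "0 < x" "x < y" "F s x < F s y"
      using F_decreases_to_the_left[of y s 0] s y(1) m by auto
    then show False using y by (meson atLeastAtMost_iff less_imp_le not_le order_trans)
  qed
  then show ?thesis using y(2)[of m] m by simp
qed

end

section \<open>The surface energy density\<close>

context regular
begin

lemma
  assumes "0 \<le> m"
  shows \<theta>_indicator_measurable: "(\<lambda>t. indicator {m<..<1} t *\<^sub>R \<theta> t) \<in> borel_measurable borel"
    and \<omega>_indicator_measurable: "(\<lambda>t. indicator {m<..<1} t *\<^sub>R \<omega> (1 - t)) \<in> borel_measurable borel"
    and k_indicator_measurable: "(\<lambda>t. indicator {m<..<1} t *\<^sub>R k n t) \<in> borel_measurable borel"
proof -
  have *: "(\<lambda>t. indicator {m<..<1} t *\<^sub>R f t) \<in> borel_measurable borel" if "continuous_on {0<..<1} f" for f :: "real \<Rightarrow> real"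
    using assms by (intro borel_measurable_continuous_on_indicator continuous_on_subset[OF that]) auto
  show "(\<lambda>t. indicator {m<..<1} t *\<^sub>R \<theta> t) \<in> borel_measurable borel"
    by (rule *[OF continuous_on_subset[OF \<theta>_continuous]]) auto
  show "(\<lambda>t. indicator {m<..<1} t *\<^sub>R \<omega> (1 - t)) \<in> borel_measurable borel"
    by (rule *[OF continuous_on_subset[OF \<omega>_reflected_continuous]]) auto
  show "(\<lambda>t. indicator {m<..<1} t *\<^sub>R k n t) \<in> borel_measurable borel"
    by (rule *[OF k_continuous_on_Ioo])
qed

lemma integral_k_from: "0 \<le> m \<Longrightarrow> m < 1 \<Longrightarrow> integral {m..1} (k m) = integral {0..1} (k m)"
proof -
  assume m: "0 \<le> m" "m < 1"
  have "integral {0..m} (k m) = integral {0<..<m} (\<lambda>_. 0)"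
    unfolding integral_open_interval_real using m k_eq_0[of _ m] by (intro integral_cong) auto
  then show ?thesis using integral_k_split[of m m] m by simp
qed

text \<open>Pointwise calibration with the extended real weight. Where \<open>v = 1\<close> the real
  \<open>\<theta>\<close> has only a default value; there \<open>k\<close> vanishes and monotonicity
  of \<open>theta\<close> suffices, also when the weight is infinite.\<close>

lemma theta_integrand_lower_bound:
  assumes "0 \<le> m" "m \<le> v" "v \<le> 1" "m < 1"
  shows "ennreal (sqrt (\<theta> m) * p + k m v * \<bar>q\<bar>) \<le> esqrt (theta l Q \<omega> v * ennreal (p\<^sup>2) + ennreal (\<omega> (1 - v) * q\<^sup>2))"
proof (cases "v < 1")
  case True
  have th: "0 \<le> \<theta> m" "\<theta> m \<le> \<theta> v" using \<theta>_nonneg[of m] \<theta>_mono[of m v] assms True by auto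
  have w: "0 \<le> \<omega> (1 - v)" using \<omega>_nonneg[of "1 - v"] assms by simp
  have "ennreal (sqrt (\<theta> m) * p + k m v * \<bar>q\<bar>) \<le> ennreal (sqrt (\<theta> v * p\<^sup>2 + \<omega> (1 - v) * q\<^sup>2))"
    using calibration_inequality[of "sqrt (\<theta> m)" "\<theta> v" "\<omega> (1 - v)" p q] th w
    by (intro ennreal_leI) (simp add: k_def)
  also have "\<dots> = esqrt (theta l Q \<omega> v * ennreal (p\<^sup>2) + ennreal (\<omega> (1 - v) * q\<^sup>2))"
    using True th w by (simp add: theta_eq esqrt_ennreal flip: ennreal_mult ennreal_plus)
  finally show ?thesis .
next
  case False
  then have "v = 1" using assms by simp
  have "ennreal (sqrt (\<theta> m) * p + k m v * \<bar>q\<bar>) \<le> ennreal (sqrt (\<theta> m * p\<^sup>2))"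
    using \<theta>_nonneg[of m] assms by (intro ennreal_leI) (simp add: \<open>v = 1\<close> k_1 real_sqrt_mult mult_left_mono)
  also have "\<dots> = esqrt (theta l Q \<omega> m * ennreal (p\<^sup>2))"
    using assms \<theta>_nonneg[of m] by (simp add: theta_eq esqrt_ennreal flip: ennreal_mult)
  also have "\<dots> \<le> esqrt (theta l Q \<omega> v * ennreal (p\<^sup>2) + ennreal (\<omega> (1 - v) * q\<^sup>2))"
    by (rule esqrt_mono, rule add_increasing2[OF zero_le], rule mult_right_mono[OF theta_mono])
      (use assms in auto)
  finally show ?thesis .
qed

abbreviation energy :: "(real \<Rightarrow> real) \<Rightarrow> (real \<Rightarrow> real) \<Rightarrow> ennreal" where
  "energy u v \<equiv> (\<integral>\<^sup>+ x\<in>{0<..<1}. esqrt (theta l Q \<omega> (v x) * ennreal ((weak_deriv 0 1 u x)\<^sup>2)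
        + ennreal (\<omega> (1 - v x) * (weak_deriv 0 1 v x)\<^sup>2)) \<partial>lebesgue)"

text \<open>The case where the minimum of \<open>v\<close> is 1 and no height \<open>m < 1\<close>
  can calibrate. The energy is \<open>\<sigma>\<close> times the length of \<open>u\<close>,
  computed in \<open>ennreal\<close> because \<open>\<sigma>\<close> may be infinite.\<close>

lemma energy_lower_bound_constant:
  assumes uv: "admissible s u v" and v: "\<And>x. x \<in> {0..1} \<Longrightarrow> v x = 1"
  shows "\<sigma> * ennreal s \<le> energy u v"
proof -
  define f where "f = weak_deriv 0 1 u"
  have f: "f absolutely_integrable_on {0<..<1}"
    unfolding f_def using uv by (intro weak_deriv_absolutely_integrable) (simp add: admissible_def)
  have "u 1 = u 0 + integral {0..1} f"
    unfolding f_def using uv by (intro H1_on_absolutely_continuous) (auto simp: admissible_def)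
  then have s: "s = integral {0<..<1} f"
    using uv by (simp add: admissible_def integral_open_interval_real)
  have fm: "(\<lambda>x. indicator {0<..<1} x *\<^sub>R f x) \<in> borel_measurable lebesgue"
    using f by (auto simp: set_integrable_def)
  have "\<sigma> * ennreal s \<le> \<sigma> * (\<integral>\<^sup>+ x\<in>{0<..<1}. ennreal \<bar>f x\<bar> \<partial>lebesgue)"
    unfolding s by (intro mult_left_mono ennreal_integral_le_nn_integral f ennreal_leI) auto
  also have "(\<integral>\<^sup>+ x\<in>{0<..<1}. ennreal \<bar>f x\<bar> \<partial>lebesgue) = (\<integral>\<^sup>+ x. ennreal \<bar>indicator {0<..<1} x *\<^sub>R f x\<bar> \<partial>lebesgue)"
    by (intro nn_integral_cong) (auto split: split_indicator)
  also have "\<sigma> * \<dots> = (\<integral>\<^sup>+ x. \<sigma> * ennreal \<bar>indicator {0<..<1} x *\<^sub>R f x\<bar> \<partial>lebesgue)"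
    using fm by (intro nn_integral_cmult[symmetric]) auto
  also have "\<dots> \<le> energy u v"
  proof (intro nn_integral_mono)
    fix x
    show "\<sigma> * ennreal \<bar>indicator {0<..<1} x *\<^sub>R f x\<bar> \<le> esqrt (theta l Q \<omega> (v x) * ennreal ((weak_deriv 0 1 u x)\<^sup>2)
        + ennreal (\<omega> (1 - v x) * (weak_deriv 0 1 v x)\<^sup>2)) * indicator {0<..<1} x"
    proof (cases "x \<in> {0<..<1}")
      case True
      have "\<sigma> * ennreal \<bar>f x\<bar> = esqrt ((\<sigma> * ennreal \<bar>f x\<bar>) * (\<sigma> * ennreal \<bar>f x\<bar>))" by (simp add: esqrt_square)
      also have "(\<sigma> * ennreal \<bar>f x\<bar>) * (\<sigma> * ennreal \<bar>f x\<bar>) = theta l Q \<omega> 1 * ennreal ((f x)\<^sup>2)"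
        by (simp add: theta_1 ac_simps power2_eq_square flip: ennreal_mult)
      finally show ?thesis using True v[of x] by (simp add: f_def \<omega>_0)
    qed simp
  qed
  finally show ?thesis .
qed

text \<open>Calibrate with \<open>m\<close> the minimum of \<open>v\<close>. The horizontal term
  keeps the sign of the derivative of \<open>u\<close>, so it integrates exactly to
  \<open>sqrt (\<theta> m) * s\<close>. The vertical term is split at a minimum point
  \<open>x0\<close>: both the descent from 1 to \<open>m\<close> and the ascent back contribute at
  least the integral of \<open>k m\<close>.\<close>

lemma energy_lower_bound:
  assumes s: "0 \<le> s" and uv: "admissible s u v"
  shows "\<sigma> * ennreal s \<le> energy u v \<or> (\<exists>m. 0 \<le> m \<and> m < 1 \<and> ennreal (F s m) \<le> energy u v)"
proof -
  have H: "H1_on 0 1 u" "H1_on 0 1 v" and c: "continuous_on {0..1} u" "continuous_on {0..1} v"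
    and b: "u 0 = 0" "u 1 = s" "\<And>x. x \<in> {0..1} \<Longrightarrow> 0 \<le> v x \<and> v x \<le> 1" "v 0 = 1" "v 1 = 1"
    using uv by (auto simp: admissible_def)
  define f g where "f = weak_deriv 0 1 u" and "g = weak_deriv 0 1 v"
  obtain x0 where x0: "x0 \<in> {0..1}" "\<And>x. x \<in> {0..1} \<Longrightarrow> v x0 \<le> v x"
    using continuous_attains_inf[OF _ _ c(2)] by auto
  define m where "m = v x0"
  show ?thesis
  proof (cases "m < 1")
    case False
    then have "v x = 1" if "x \<in> {0..1}" for x using x0(2)[OF that] b(3)[OF that] by (auto simp: m_def)
    then show ?thesis using energy_lower_bound_constant[OF uv] by blast
  next
    case True
    have m0: "0 \<le> m" using b(3)[OF x0(1)] by (simp add: m_def)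
    have fa: "f absolutely_integrable_on {0<..<1}" "g absolutely_integrable_on {0..1}"
      unfolding f_def g_def absolutely_integrable_Icc_iff_Ioo by (intro weak_deriv_absolutely_integrable H)+
    have v: "v x = v 0 + integral {0..x} g" if "x \<in> {0..1}" for x
      unfolding g_def by (rule H1_on_absolutely_continuous[OF _ H(2) c(2) that]) simp
    have im: "v x \<in> {m..1}" if "x \<in> {0..1}" for x using x0(2)[OF that] b(3)[OF that] by (simp add: m_def)
    have kc: "continuous_on {m..1} (k m)" using m0 True by (rule k_continuous_on)
    have kn: "0 \<le> k m y" if "y \<in> {m..1}" for y using that m0 by (intro k_nonneg) auto
    have kv: "continuous_on {0..1} (\<lambda>x. k m (v x))" by (rule continuous_on_compose2[OF kc c(2)]) (use im in auto)
    have kg: "(\<lambda>x. k m (v x) * \<bar>g x\<bar>) absolutely_integrable_on {0..1}"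
      by (rule absolutely_integrable_continuous_mult_abs[OF kv fa(2)])
    note bound = integral_composition_bound[OF fa(2) v im kc kn]
    \<comment> \<open>At \<open>x0\<close> the primitive of \<open>k m\<close> is 0 because
      \<open>v x0 = m\<close>; at both ends of the interval it is the full integral.\<close>
    have "\<bar>integral {m..v x0} (k m) - integral {m..v 0} (k m)\<bar> \<le> integral {0..x0} (\<lambda>x. k m (v x) * \<bar>g x\<bar>)"
      using x0(1) by (intro bound) auto
    moreover have "\<bar>integral {m..v 1} (k m) - integral {m..v x0} (k m)\<bar> \<le> integral {x0..1} (\<lambda>x. k m (v x) * \<bar>g x\<bar>)"
      using x0(1) by (intro bound) auto
    moreover have "integral {0..x0} (\<lambda>x. k m (v x) * \<bar>g x\<bar>) + integral {x0..1} (\<lambda>x. k m (v x) * \<bar>g x\<bar>)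
        = integral {0..1} (\<lambda>x. k m (v x) * \<bar>g x\<bar>)"
      using x0(1) set_lebesgue_integral_eq_integral(1)[OF kg]
      by (intro Henstock_Kurzweil_Integration.integral_combine) auto
    ultimately have K: "2 * integral {0..1} (k m) \<le> integral {0..1} (\<lambda>x. k m (v x) * \<bar>g x\<bar>)"
      using integral_k_from[OF m0 True] b(4,5) by (simp add: m_def)
    have fs: "integral {0..1} f = s"
      using H1_on_absolutely_continuous[OF _ H(1) c(1), of 1] b(1,2) by (simp add: f_def)
    have kg': "(\<lambda>x. k m (v x) * \<bar>g x\<bar>) absolutely_integrable_on {0<..<1}"
      using kg by (simp add: absolutely_integrable_Icc_iff_Ioo)
    have a1: "(\<lambda>x. sqrt (\<theta> m) * f x) absolutely_integrable_on {0<..<1}"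
      using fa(1) by (intro set_integrable_mult_right) auto
    have "F s m \<le> integral {0<..<1} (\<lambda>x. sqrt (\<theta> m) * f x) + integral {0<..<1} (\<lambda>x. k m (v x) * \<bar>g x\<bar>)"
      using K fs by (simp add: F_def integral_open_interval_real[symmetric])
    also have "\<dots> = integral {0<..<1} (\<lambda>x. sqrt (\<theta> m) * f x + k m (v x) * \<bar>g x\<bar>)"
      using a1 kg' by (intro integral_add[symmetric] set_lebesgue_integral_eq_integral(1))
    finally have "ennreal (F s m) \<le> ennreal (integral {0<..<1} (\<lambda>x. sqrt (\<theta> m) * f x + k m (v x) * \<bar>g x\<bar>))"
      by (rule ennreal_leI)
    also have "\<dots> \<le> energy u v"
      unfolding f_def[symmetric] g_def[symmetric]
      by (intro ennreal_integral_le_nn_integral set_integral_add(1) a1 kg' theta_integrand_lower_bound m0 True)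
         (use im in auto)
    finally show ?thesis using m0 True by blast
  qed
qed

end

section \<open>Explicit competitors for the surface energy\<close>

lemma nn_integral_affine_image:
  fixes f :: "real \<Rightarrow> ennreal"
  assumes [measurable]: "f \<in> borel_measurable borel" and "c \<noteq> 0"
  shows "(\<integral>\<^sup>+ x. ennreal \<bar>c\<bar> * f (a + c * x) \<partial>lborel) = (\<integral>\<^sup>+ x. f x \<partial>lborel)"
  using nn_integral_real_affine[OF assms, of a] by (simp add: nn_integral_cmult)

lemma nn_integral_lebesgue_lborel:
  "(\<integral>\<^sup>+ x. f x \<partial>lebesgue) = (\<integral>\<^sup>+ x. f x \<partial>lborel)"
  by (rule nn_integral_completion)

lemma esqrt_mult_square: "0 \<le> r \<Longrightarrow> esqrt (a * ennreal (r\<^sup>2)) = esqrt a * ennreal r"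
proof (cases a)
  case (real x)
  assume "0 \<le> r"
  then show ?thesis using real by (simp add: esqrt_ennreal real_sqrt_mult flip: ennreal_mult)
next
  case top
  assume "0 \<le> r"
  then show ?thesis using top by (cases "r = 0") (auto simp: esqrt_def ennreal_top_mult)
qed

text \<open>A trapezoidal dip with constant speed on each outer third. Written as a maximum of
  affine functions it is visibly continuous, and the pieces are recovered in
  \<open>profile_cases\<close>.\<close>

definition profile :: "real \<Rightarrow> real \<Rightarrow> real" where
  "profile m x = max m (max (1 - 3 * (1 - m) * x) (1 - 3 * (1 - m) + 3 * (1 - m) * x))"

definition profile_deriv :: "real \<Rightarrow> real \<Rightarrow> real" where
  "profile_deriv m x = (if x < 1/3 then - 3 * (1 - m) else if x \<le> 2/3 then 0 else 3 * (1 - m))"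

lemma profile_cases:
  assumes "m \<le> 1"
  shows "x \<le> 1/3 \<Longrightarrow> profile m x = 1 - 3 * (1 - m) * x"
    "1/3 \<le> x \<Longrightarrow> x \<le> 2/3 \<Longrightarrow> profile m x = m"
    "2/3 \<le> x \<Longrightarrow> profile m x = 1 - 3 * (1 - m) + 3 * (1 - m) * x"
proof -
  have e: "1 - 3 * (1 - m) * x - m = (1 - m) * (1 - 3 * x)" "1 - 3 * (1 - m) + 3 * (1 - m) * x - m = (1 - m) * (3 * x - 2)"
    by (simp_all add: algebra_simps)
  have s: "0 \<le> y \<Longrightarrow> 0 \<le> (1 - m) * y" "y \<le> 0 \<Longrightarrow> (1 - m) * y \<le> 0" for y
    using assms by (simp_all add: mult_nonneg_nonpos)
  have gen: "m \<le> A \<Longrightarrow> B \<le> m \<Longrightarrow> max m (max A B) = A" "A \<le> m \<Longrightarrow> B \<le> m \<Longrightarrow> max m (max A B) = m"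
    "A \<le> m \<Longrightarrow> m \<le> B \<Longrightarrow> max m (max A B) = B" for A B :: real by auto
  show "profile m x = 1 - 3 * (1 - m) * x" if "x \<le> 1/3"
    unfolding profile_def
  proof (rule gen(1))
    show "m \<le> 1 - 3 * (1 - m) * x" using s(1)[of "1 - 3 * x"] e(1) that by linarith
    show "1 - 3 * (1 - m) + 3 * (1 - m) * x \<le> m" using s(2)[of "3 * x - 2"] e(2) that by linarith
  qed
  show "profile m x = m" if "1/3 \<le> x" "x \<le> 2/3"
    unfolding profile_def
  proof (rule gen(2))
    show "1 - 3 * (1 - m) * x \<le> m" using s(2)[of "1 - 3 * x"] e(1) that by linarith
    show "1 - 3 * (1 - m) + 3 * (1 - m) * x \<le> m" using s(2)[of "3 * x - 2"] e(2) that by linarith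
  qed
  show "profile m x = 1 - 3 * (1 - m) + 3 * (1 - m) * x" if "2/3 \<le> x"
    unfolding profile_def
  proof (rule gen(3))
    show "1 - 3 * (1 - m) * x \<le> m" using s(2)[of "1 - 3 * x"] e(1) that by linarith
    show "m \<le> 1 - 3 * (1 - m) + 3 * (1 - m) * x" using s(1)[of "3 * x - 2"] e(2) that by linarith
  qed
qed

lemma profile_range: "0 \<le> m \<Longrightarrow> m \<le> 1 \<Longrightarrow> x \<in> {0..1} \<Longrightarrow> m \<le> profile m x \<and> profile m x \<le> 1"
  using mult_left_mono[of x 1 "3 * (1 - m)"] mult_nonneg_nonneg[of "3 * (1 - m)" x] by (simp add: profile_def)

lemma profile_integral:
  assumes "m \<le> 1" "x \<in> {0..1}"
  shows "profile m x = 1 + integral {0..x} (profile_deriv m)"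
proof -
  have cont: "continuous_on {0..x} (profile m)"
    unfolding profile_def[abs_def] by (intro continuous_intros)
  have der: "(profile m has_real_derivative profile_deriv m y) (at y)" if y: "y \<noteq> 1/3" "y \<noteq> 2/3" for y
  proof -
    consider "y < 1/3" | "1/3 < y" "y < 2/3" | "2/3 < y" using y by linarith
    then show ?thesis
    proof cases
      case 1
      then have "eventually (\<lambda>z. z \<in> {..<1/3}) (nhds y)" by (intro eventually_nhds_in_open) auto
      then have "eventually (\<lambda>z. profile m z = 1 - 3 * (1 - m) * z) (nhds y)"
        by eventually_elim (use profile_cases(1)[OF assms(1)] in auto)
      then have "(profile m has_real_derivative - 3 * (1 - m)) (at y) \<longleftrightarrow>
          ((\<lambda>z. 1 - 3 * (1 - m) * z) has_real_derivative - 3 * (1 - m)) (at y)"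
        by (intro DERIV_cong_ev) auto
      moreover have "((\<lambda>z. 1 - 3 * (1 - m) * z) has_real_derivative - 3 * (1 - m)) (at y)"
        by (auto intro!: derivative_eq_intros)
      ultimately show ?thesis using 1 by (simp add: profile_deriv_def)
    next
      case 2
      then have "eventually (\<lambda>z. z \<in> {1/3<..<2/3}) (nhds y)" by (intro eventually_nhds_in_open) auto
      then have "eventually (\<lambda>z. profile m z = m) (nhds y)"
        by eventually_elim (use profile_cases(2)[OF assms(1)] in auto)
      then have "(profile m has_real_derivative 0) (at y) \<longleftrightarrow> ((\<lambda>z. m) has_real_derivative 0) (at y)"
        by (intro DERIV_cong_ev) auto
      then show ?thesis using 2 by (simp add: profile_deriv_def)
    next
      case 3
      then have "eventually (\<lambda>z. z \<in> {2/3<..}) (nhds y)" by (intro eventually_nhds_in_open) auto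
      then have "eventually (\<lambda>z. profile m z = 1 - 3 * (1 - m) + 3 * (1 - m) * z) (nhds y)"
        by eventually_elim (use profile_cases(3)[OF assms(1)] in auto)
      then have "(profile m has_real_derivative 3 * (1 - m)) (at y) \<longleftrightarrow>
          ((\<lambda>z. 1 - 3 * (1 - m) + 3 * (1 - m) * z) has_real_derivative 3 * (1 - m)) (at y)"
        by (intro DERIV_cong_ev) auto
      moreover have "((\<lambda>z. 1 - 3 * (1 - m) + 3 * (1 - m) * z) has_real_derivative 3 * (1 - m)) (at y)"
        by (auto intro!: derivative_eq_intros)
      ultimately show ?thesis using 3 by (simp add: profile_deriv_def)
    qed
  qed
  have "(profile_deriv m has_integral (profile m x - profile m 0)) {0..x}"
    using assms(2) cont der
    by (intro fundamental_theorem_of_calculus_strong[of "{1/3, 2/3}"])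
       (auto simp: has_real_derivative_iff_has_vector_derivative intro: has_vector_derivative_at_within)
  then show ?thesis using profile_cases(1)[OF assms(1), of 0] by (simp add: integral_unique)
qed

context regular
begin

text \<open>On the two outer thirds the competitor follows the graph with slope \<open>p\<close> over the \<open>v\<close>-axis,
  on the middle third it covers the remaining horizontal distance at height \<open>m\<close>.\<close>

lemma g_surf_upper_bound:
  fixes p :: "real \<Rightarrow> real"
  assumes m: "0 \<le> m" "m \<le> 1" and p [measurable]: "p \<in> borel_measurable borel"
    and p0: "\<And>t. 0 \<le> p t" "\<And>t. p t \<le> B" "\<And>t. t \<notin> {m<..<1} \<Longrightarrow> p t = 0"
    and J: "(\<integral>\<^sup>+ t. ennreal (p t) \<partial>lborel) = ennreal J" "0 \<le> J" "2 * J \<le> s"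
  shows "g_surf l Q \<omega> s \<le>
    2 * (\<integral>\<^sup>+ t\<in>{m<..<1}. ennreal (sqrt (\<theta> t * (p t)\<^sup>2 + \<omega> (1 - t))) \<partial>lebesgue)
      + esqrt (theta l Q \<omega> m) * ennreal (s - 2 * J)"
proof -
  \<comment> \<open>The speed of \<open>profile m\<close> on the outer thirds. It is 0 for
    \<open>m = 1\<close>, a case that has to be carried along because it yields the bound by
    \<open>\<sigma>\<close>.\<close>
  define c where "c = 3 * (1 - m)"
  have c0: "0 \<le> c" using m by (simp add: c_def)
  \<comment> \<open>As \<open>p\<close> vanishes outside \<open>{m<..<1}\<close>, the first and last
    summands live on the outer thirds by themselves, so a sum replaces a case distinction. The
    factor 3 spreads the missing distance \<open>s - 2 * J\<close> over the middle third.\<close>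
  define q where "q x = c * p (1 + (- c) * x) + 3 * (s - 2 * J) * indicator {1/3..2/3} x + c * p (1 - c + c * x)" for x
  have qm [measurable]: "q \<in> borel_measurable borel" unfolding q_def[abs_def] by measurable
  have q0: "0 \<le> q x" for x using p0(1) c0 J by (simp add: q_def)
  have "B \<ge> 0" using order_trans[OF p0(1,2)] .
  have "q x \<le> c * B + 3 * (s - 2 * J) + c * B" for x
    unfolding q_def using c0 J p0(2)
    by (intro add_mono mult_left_mono) (auto split: split_indicator)
  then have qB: "\<bar>q x\<bar> \<le> c * B + 3 * (s - 2 * J) + c * B" for x
    using q0 by simp
  \<comment> \<open>Change of variables on one outer third. An inequality is enough and also covers
    \<open>d = 0\<close>, where the left side is 0.\<close>
  have piece: "(\<integral>\<^sup>+ x. ennreal \<bar>d\<bar> * h (a + d * x) \<partial>lborel) \<le> (\<integral>\<^sup>+ x. h x \<partial>lborel)"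
    if "h \<in> borel_measurable borel" for h a d
    using nn_integral_affine_image[OF that, of d a] by (cases "d = 0") auto
  have piece_eq: "(\<integral>\<^sup>+ x. ennreal (c * p (a + d * x)) \<partial>lborel) = ennreal J" if "\<bar>d\<bar> = c" for a d
  proof (cases "c = 0")
    case True
    then have "p t = 0" for t using p0(3)[of t] m by (simp add: c_def)
    then have "ennreal J = 0" using J(1) by simp
    then show ?thesis using True by simp
  next
    case False
    then have "(\<integral>\<^sup>+ x. ennreal \<bar>d\<bar> * ennreal (p (a + d * x)) \<partial>lborel) = ennreal J"
      unfolding J(1)[symmetric] using that by (intro nn_integral_affine_image) auto
    then show ?thesis using that c0 p0(1) by (simp add: ennreal_mult')
  qed
  define u where "u x = integral {0..x} q" for x
  have qa: "q absolutely_integrable_on {0<..<1}"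
  proof -
    have "set_borel_measurable lebesgue {0<..<1} q"
      unfolding set_borel_measurable_def by (intro measurable_completion) simp
    then show ?thesis using qB by (intro L2_on_imp_set_integrable L2_on_bounded) auto
  qed
  have supp: "p (1 + (- c) * x) = 0" "p (1 - c + c * x) = 0" if "x \<notin> {0<..<1}" for x
  proof -
    have "x \<le> 0 \<or> 1 \<le> x" using that by auto
    have cm: "1 - c \<le> m" using m by (simp add: c_def)
    from \<open>x \<le> 0 \<or> 1 \<le> x\<close> show "p (1 + (- c) * x) = 0"
    proof
      assume "x \<le> 0"
      then have "c * x \<le> 0" using c0 by (simp add: mult_nonneg_nonpos)
      then show ?thesis by (intro p0(3)) auto
    next
      assume "1 \<le> x"
      then have "c * 1 \<le> c * x" using c0 by (intro mult_left_mono) auto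
      then show ?thesis using cm by (intro p0(3)) auto
    qed
    from \<open>x \<le> 0 \<or> 1 \<le> x\<close> show "p (1 - c + c * x) = 0"
    proof
      assume "x \<le> 0"
      then have "c * x \<le> 0" using c0 by (simp add: mult_nonneg_nonpos)
      then show ?thesis using cm by (intro p0(3)) auto
    next
      assume "1 \<le> x"
      then have "c * 1 \<le> c * x" using c0 by (intro mult_left_mono) auto
      then show ?thesis by (intro p0(3)) auto
    qed
  qed
  have "ennreal (integral {0<..<1} q) = (\<integral>\<^sup>+ x\<in>{0<..<1}. ennreal (q x) \<partial>lebesgue)"
    using qa q0 by (intro nn_integral_eq_ennreal_integral[symmetric]) auto
  also have "\<dots> = (\<integral>\<^sup>+ x. ennreal (q x) \<partial>lborel)"
    unfolding nn_integral_lebesgue_lborel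
    by (intro nn_integral_cong) (use supp in \<open>auto simp: q_def split: split_indicator\<close>)
  also have "\<dots> = (\<integral>\<^sup>+ x. ennreal (c * p (1 + (- c) * x)) + ennreal (3 * (s - 2 * J)) * indicator {1/3..2/3} x
      + ennreal (c * p (1 - c + c * x)) \<partial>lborel)"
    using c0 p0(1) J by (intro nn_integral_cong) (auto simp: q_def ennreal_plus split: split_indicator)
  also have "\<dots> = ennreal J + ennreal (3 * (s - 2 * J)) * emeasure lborel {1/3..2/3::real} + ennreal J"
    using c0 by (simp add: nn_integral_add nn_integral_cmult_indicator piece_eq[of "- c" 1, simplified] piece_eq[of c])
  also have "\<dots> = ennreal s"
    using J by (simp flip: ennreal_mult ennreal_plus) (simp add: field_simps)
  finally have "integral {0<..<1} q = s"
    using q0 J by (subst (asm) ennreal_inj) (auto intro!: integral_nonneg set_lebesgue_integral_eq_integral(1) qa)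
  then have u1: "u 1 = s" by (simp add: u_def integral_open_interval_real)
  have U: "H1_on 0 1 u" "continuous_on {0..1} u" "AE x in lebesgue. x \<in> {0<..<1} \<longrightarrow> weak_deriv 0 1 u x = q x"
  proof -
    have qs: "set_borel_measurable lebesgue {0<..<1} q"
      unfolding set_borel_measurable_def by (intro measurable_completion) simp
    show "H1_on 0 1 u" "continuous_on {0..1} u" "AE x in lebesgue. x \<in> {0<..<1} \<longrightarrow> weak_deriv 0 1 u x = q x"
      using absolutely_continuous_H1[of 0 1 q "c * B + 3 * (s - 2 * J) + c * B" u 0] qs qB by (auto simp: u_def)
  qed
  have V: "H1_on 0 1 (profile m)" "continuous_on {0..1} (profile m)"
    "AE x in lebesgue. x \<in> {0<..<1} \<longrightarrow> weak_deriv 0 1 (profile m) x = profile_deriv m x"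
  proof -
    have rs: "set_borel_measurable lebesgue {0<..<1} (profile_deriv m)"
      unfolding set_borel_measurable_def profile_deriv_def[abs_def] by (intro measurable_completion) simp
    have rB: "\<bar>profile_deriv m x\<bar> \<le> 3 * (1 - m)" for x using m by (simp add: profile_deriv_def)
    show "H1_on 0 1 (profile m)" "continuous_on {0..1} (profile m)"
      "AE x in lebesgue. x \<in> {0<..<1} \<longrightarrow> weak_deriv 0 1 (profile m) x = profile_deriv m x"
      using absolutely_continuous_H1[of 0 1 "profile_deriv m" "3 * (1 - m)" "profile m" 1] rs rB profile_integral[OF m(2)]
      by auto
  qed
  have adm: "admissible s u (profile m)"
    unfolding admissible_def using U V u1 profile_range[OF m] m profile_cases(1,3)[OF m(2)]
    by (auto simp: u_def intro: order_trans)
  define h where "h t = ennreal (sqrt (\<theta> t * (p t)\<^sup>2 + \<omega> (1 - t))) * indicator {m<..<1} t" for t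
  have hm [measurable]: "h \<in> borel_measurable borel"
  proof -
    have "h = (\<lambda>t. ennreal (sqrt ((indicator {m<..<1} t *\<^sub>R \<theta> t) * (p t)\<^sup>2 + indicator {m<..<1} t *\<^sub>R \<omega> (1 - t))))"
      by (rule ext) (simp add: h_def split: split_indicator)
    also have "\<dots> \<in> borel_measurable borel" using \<theta>_indicator_measurable[OF m(1)] \<omega>_indicator_measurable[OF m(1)] by measurable
    finally show ?thesis .
  qed
  \<comment> \<open>The integrand is homogeneous of degree one in the two derivatives, so the speed
    \<open>c\<close> comes out as a factor and is cancelled by the change of variables.\<close>
  have outer: "esqrt (theta l Q \<omega> t * ennreal ((c * p t)\<^sup>2) + ennreal (\<omega> (1 - t) * c\<^sup>2)) = ennreal c * h t"
    if t: "t \<in> {m<..<1}" for t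
  proof -
    have th: "0 \<le> \<theta> t" "0 \<le> \<omega> (1 - t)" using t m \<theta>_nonneg[of t] \<omega>_nonneg[of "1 - t"] by auto
    have eq: "theta l Q \<omega> t * ennreal ((c * p t)\<^sup>2) + ennreal (\<omega> (1 - t) * c\<^sup>2) = ennreal (c\<^sup>2 * (\<theta> t * (p t)\<^sup>2 + \<omega> (1 - t)))"
      using t th by (simp add: theta_eq algebra_simps flip: ennreal_mult ennreal_plus)
    have "sqrt (c\<^sup>2 * (\<theta> t * (p t)\<^sup>2 + \<omega> (1 - t))) = c * sqrt (\<theta> t * (p t)\<^sup>2 + \<omega> (1 - t))"
      using c0 by (simp add: real_sqrt_mult)
    then show ?thesis using t c0 by (simp only: eq esqrt_ennreal) (simp add: h_def ennreal_mult')
  qed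
  have "g_surf l Q \<omega> s \<le> energy u (profile m)"
    unfolding g_surf_def by (rule INF_lower2[of "(u, profile m)"]) (use adm in auto)
  also have "\<dots> \<le> (\<integral>\<^sup>+ x. ennreal c * h (1 + (- c) * x) + esqrt (theta l Q \<omega> m) * ennreal (3 * (s - 2 * J)) * indicator {1/3..2/3} x
      + ennreal c * h (1 - c + c * x) \<partial>lebesgue)"
  proof (rule nn_integral_mono_AE)
    have ne: "AE x in lebesgue. x \<noteq> 1/3" "AE x in lebesgue. x \<noteq> (2/3::real)"
      by (rule AE_completion[OF AE_lborel_singleton])+
    show "AE x in lebesgue. esqrt (theta l Q \<omega> (profile m x) * ennreal ((weak_deriv 0 1 u x)\<^sup>2)
        + ennreal (\<omega> (1 - profile m x) * (weak_deriv 0 1 (profile m) x)\<^sup>2)) * indicator {0<..<1} x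
      \<le> ennreal c * h (1 + (- c) * x) + esqrt (theta l Q \<omega> m) * ennreal (3 * (s - 2 * J)) * indicator {1/3..2/3} x
      + ennreal c * h (1 - c + c * x)"
      using U(3) V(3) ne
    proof eventually_elim
      case (elim x)
      show ?case
      proof (cases "x \<in> {0<..<1}")
        case True
        then have w: "weak_deriv 0 1 u x = q x" "weak_deriv 0 1 (profile m) x = profile_deriv m x" using elim by auto
        have c3: "m = 1 - c / 3" by (simp add: c_def field_simps)
        have mono: "c * y \<le> c * z" if "y \<le> z" for y z using c0 that by (intro mult_left_mono) auto
        have smono: "c * y < c * z" if "y < z" "c > 0" for y z using that by (intro mult_strict_left_mono) auto
        consider "x < 1/3" | "1/3 < x" "x < 2/3" | "2/3 < x" using elim by linarith
        then show ?thesis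
        proof cases
          case 1
          have v: "profile m x = 1 + (- c) * x" "profile_deriv m x = - c"
            using 1 profile_cases(1)[OF m(2), of x] by (simp_all add: c_def profile_deriv_def algebra_simps)
          have "1 - c + c * x \<le> m"
            using mono[of x "1/3"] 1 c0 unfolding c3 by linarith
          then have "q x = c * p (1 + (- c) * x)" using 1 p0(3)[of "1 - c + c * x"] by (simp add: q_def)
          moreover have "m < 1 + (- c) * x \<and> 1 + (- c) * x < 1" if "c > 0"
          proof -
            have "c * x < c * (1/3)" "c * 0 < c * x" by (rule smono[OF _ that], use 1 True in simp)+
            then show ?thesis unfolding c3 by (intro conjI; linarith)
          qed
          ultimately show ?thesis
            using True w v outer[of "1 + (- c) * x"] c0
            by (cases "c = 0") (auto simp: esqrt_def intro!: add_increasing2)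
        next
          case 2
          have v: "profile m x = m" "profile_deriv m x = 0"
            using 2 profile_cases(2)[OF m(2), of x] by (simp_all add: profile_deriv_def algebra_simps)
          have "1 + (- c) * x \<le> m" "1 - c + c * x \<le> m"
            using mono[of "1/3" x] mono[of x "2/3"] 2 c0 unfolding c3 by linarith+
          then have "q x = 3 * (s - 2 * J)"
            using 2 p0(3)[of "1 - c + c * x"] p0(3)[of "1 + (- c) * x"] by (simp add: q_def)
          then have "esqrt (theta l Q \<omega> (profile m x) * ennreal ((q x)\<^sup>2)) = esqrt (theta l Q \<omega> m) * ennreal (3 * (s - 2 * J))"
            using v J by (simp add: esqrt_mult_square del: power_mult_distrib)
          then show ?thesis using True 2 w v by (auto intro!: add_increasing add_increasing2)
        next
          case 3
          have v: "profile m x = 1 - c + c * x" "profile_deriv m x = c"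
            using 3 profile_cases(3)[OF m(2), of x] by (simp_all add: c_def profile_deriv_def algebra_simps)
          have "1 + (- c) * x \<le> m"
            using mono[of "2/3" x] 3 c0 unfolding c3 by linarith
          then have "q x = c * p (1 - c + c * x)" using 3 p0(3)[of "1 + (- c) * x"] by (simp add: q_def)
          moreover have "m < 1 - c + c * x \<and> 1 - c + c * x < 1" if "c > 0"
          proof -
            have "c * (2/3) < c * x" "c * x < c * 1" by (rule smono[OF _ that], use 3 True in simp)+
            then show ?thesis unfolding c3 by (intro conjI; linarith)
          qed
          ultimately show ?thesis
            using True w v outer[of "1 - c + c * x"] c0
            by (cases "c = 0") (auto simp: esqrt_def intro!: add_increasing)
        qed
      qed simp
    qed
  qed
  also have "\<dots> = (\<integral>\<^sup>+ x. ennreal c * h (1 + (- c) * x) \<partial>lborel)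
      + esqrt (theta l Q \<omega> m) * ennreal (3 * (s - 2 * J)) * emeasure lborel {1/3..2/3::real}
      + (\<integral>\<^sup>+ x. ennreal c * h (1 - c + c * x) \<partial>lborel)"
    unfolding nn_integral_lebesgue_lborel
    by (subst nn_integral_add, simp, simp)+ (simp add: nn_integral_cmult_indicator)
  also have "\<dots> \<le> (\<integral>\<^sup>+ t. h t \<partial>lborel) + esqrt (theta l Q \<omega> m) * ennreal (s - 2 * J) + (\<integral>\<^sup>+ t. h t \<partial>lborel)"
  proof (intro add_mono)
    show "(\<integral>\<^sup>+ x. ennreal c * h (1 + (- c) * x) \<partial>lborel) \<le> (\<integral>\<^sup>+ t. h t \<partial>lborel)"
      using piece[OF hm, of "- c" 1] c0 by simp
    show "(\<integral>\<^sup>+ x. ennreal c * h (1 - c + c * x) \<partial>lborel) \<le> (\<integral>\<^sup>+ t. h t \<partial>lborel)"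
      using piece[OF hm, of c "1 - c"] c0 by simp
    show "esqrt (theta l Q \<omega> m) * ennreal (3 * (s - 2 * J)) * emeasure lborel {1/3..2/3::real} \<le> esqrt (theta l Q \<omega> m) * ennreal (s - 2 * J)"
    proof -
      have "ennreal (3 * (s - 2 * J)) * emeasure lborel {1/3..2/3::real} = ennreal (3 * (s - 2 * J)) * ennreal (1/3)"
        by simp
      also have "\<dots> = ennreal (3 * (s - 2 * J) * (1/3))" using J by (intro ennreal_mult[symmetric]) auto
      also have "3 * (s - 2 * J) * (1/3) = s - 2 * J" by simp
      finally show ?thesis by (simp only: mult.assoc order_refl)
    qed
  qed
  also have "\<dots> = 2 * (\<integral>\<^sup>+ t. h t \<partial>lborel) + esqrt (theta l Q \<omega> m) * ennreal (s - 2 * J)"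
    by (simp only: mult_2 add.assoc add.left_commute add.commute)
  finally show ?thesis by (simp add: h_def nn_integral_lebesgue_lborel)
qed

end

section \<open>The relaxed functional on graphs\<close>

lemma ennreal_add_le: "ennreal (a + b) \<le> ennreal a + ennreal b"
proof (cases "0 \<le> a \<and> 0 \<le> b")
  case False
  then consider "a \<le> 0" | "b \<le> 0" by linarith
  then show ?thesis
  proof cases
    case 1
    then have "ennreal (a + b) \<le> ennreal b" by (intro ennreal_leI) simp
    then show ?thesis by (rule order_trans) simp
  next
    case 2
    then have "ennreal (a + b) \<le> ennreal a" by (intro ennreal_leI) simp
    then show ?thesis by (rule order_trans) simp
  qed
qed simp

lemma esqrt_0: "esqrt 0 = 0"
  by (simp add: esqrt_def)

lemma tendsto_at_right_0:
  fixes f :: "real \<Rightarrow> real"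
  assumes "continuous_on {0..<1} f"
  shows "(f \<longlongrightarrow> f 0) (at_right 0)"
proof -
  have "continuous_on {0..1/2} f" by (rule continuous_on_subset[OF assms]) auto
  then show ?thesis using continuous_on_Icc_at_rightD[of 0 "1/2" f] by simp
qed

text \<open>Measurability is required only on \<open>{m<..<1}\<close>, where the functions built
  from the data are under control. The reflected half is the affine image with slope -1, and the
  point \<open>t = m\<close> is a null set.\<close>

lemma nn_integral_reflected:
  fixes f :: "real \<Rightarrow> ennreal"
  assumes f: "(\<lambda>t. f t * indicator {m<..<1} t) \<in> borel_measurable borel" and m: "m < 1"
  shows "(\<integral>\<^sup>+ t\<in>{2 * m - 1<..<1}. f (m + \<bar>t - m\<bar>) \<partial>lebesgue) = 2 * (\<integral>\<^sup>+ t\<in>{m<..<1}. f t \<partial>lebesgue)"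
proof -
  define h where "h t = f t * indicator {m<..<1} t" for t
  have [measurable]: "h \<in> borel_measurable borel" using f by (simp add: h_def[abs_def])
  have "(\<integral>\<^sup>+ t\<in>{2 * m - 1<..<1}. f (m + \<bar>t - m\<bar>) \<partial>lebesgue) = (\<integral>\<^sup>+ t. h t + h (2 * m + (- 1) * t) \<partial>lebesgue)"
  proof (rule nn_integral_cong_AE)
    have "AE t in lebesgue. t \<noteq> m" by (rule AE_completion[OF AE_lborel_singleton])
    then show "AE t in lebesgue. f (m + \<bar>t - m\<bar>) * indicator {2 * m - 1<..<1} t = h t + h (2 * m + (- 1) * t)"
    proof eventually_elim
      case (elim t)
      consider "m < t" | "t < m" using elim by linarith
      then show ?case
      proof cases
        case 1
        then have "h (2 * m + (- 1) * t) = 0" by (simp add: h_def)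
        then show ?thesis using 1 m by (auto simp: h_def split: split_indicator)
      next
        case 2
        then have "m + \<bar>t - m\<bar> = 2 * m + (- 1) * t" "h t = 0" by (simp_all add: h_def)
        then show ?thesis using 2 m by (auto simp: h_def split: split_indicator)
      qed
    qed
  qed
  also have "\<dots> = (\<integral>\<^sup>+ t. h t \<partial>lborel) + (\<integral>\<^sup>+ t. h (2 * m + (- 1) * t) \<partial>lborel)"
    unfolding nn_integral_lebesgue_lborel by (rule nn_integral_add) simp_all
  also have "(\<integral>\<^sup>+ t. h (2 * m + (- 1) * t) \<partial>lborel) = (\<integral>\<^sup>+ t. h t \<partial>lborel)"
    using nn_integral_affine_image[of h "- 1" "2 * m"] by simp
  finally show ?thesis by (simp only: h_def nn_integral_lebesgue_lborel mult_2)
qed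

context regular
begin

lemma nn_integral_k:
  assumes "0 \<le> n" "n \<le> 1" "0 \<le> m"
  shows "(\<integral>\<^sup>+ t\<in>{m<..<1}. ennreal (k n t) \<partial>lebesgue) = ennreal (integral {m..1} (k n))"
proof -
  have "k n absolutely_integrable_on {m<..<1}"
    by (rule set_integrable_subset[OF k_abs_integrable[OF assms(1,2)]]) (use assms in auto)
  then show ?thesis
    unfolding integral_open_interval_real using assms k_nonneg
    by (intro nn_integral_eq_ennreal_integral) auto
qed

lemma sqrt_\<omega>_integral: "(\<integral>\<^sup>+ t\<in>{m<..<1}. ennreal (sqrt (\<omega> (1 - t))) \<partial>lebesgue) = ennreal (integral {m..1} (k 0))"
  if "0 \<le> m"
  using nn_integral_k[of 0 m] that by (simp add: k_0)

section \<open>Upper bounds for the surface energy\<close>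

lemma Psi_eq: "Psi \<omega> 1 = integral {0..1} (k 0)"
  using F_0[of 0] by (simp add: F_def)

text \<open>The competitor goes down to height 0, where \<open>\<theta> 0 = 0\<close> makes
  horizontal displacement free.\<close>

lemma g_surf_le_Psi: "0 \<le> s \<Longrightarrow> g_surf l Q \<omega> s \<le> ennreal (2 * Psi \<omega> 1)"
  using g_surf_upper_bound[of 0 "\<lambda>_. 0" 0 0 s]
  by (simp add: theta_eq \<theta>_0 esqrt_0 sqrt_\<omega>_integral Psi_eq ennreal_mult' zero_ennreal_def[symmetric])

text \<open>The competitor with \<open>v = 1\<close> throughout: for \<open>m = 1\<close> the
  vertical part is an integral over an empty interval and all of \<open>s\<close> is covered at unit
  cost \<open>\<sigma>\<close>.\<close>

lemma g_surf_le_sigma: "0 \<le> s \<Longrightarrow> g_surf l Q \<omega> s \<le> \<sigma> * ennreal s"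
  using g_surf_upper_bound[of 1 "\<lambda>_. 0" 0 0 s] by (simp add: esqrt_theta_1)

text \<open>The equality case of \<open>calibration_inequality\<close>: with the common factor
  \<open>X\<close>, slope, \<open>k\<close> and energy density are \<open>sqrt e * X\<close>,
  \<open>(r - e) * X\<close> and \<open>r * X\<close>.\<close>

lemma geodesic_energy:
  assumes "0 < y" "y < t" "t < 1"
  shows "sqrt (\<theta> t * (P y t)\<^sup>2 + \<omega> (1 - t)) = sqrt (\<theta> y) * P y t + k y t"
proof -
  define r e w where "r = \<theta> t" and "e = \<theta> y" and "w = \<omega> (1 - t)"
  have pos: "0 < e" "e < r" "0 \<le> w"
    using \<theta>_pos[of y] \<theta>_strict_mono[of y t] \<omega>_nonneg[of "1 - t"] assms by (auto simp: r_def e_def w_def)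
  define X where "X = sqrt (w / (r * (r - e)))"
  have X0: "0 \<le> X" using pos by (simp add: X_def)
  have X2: "r * (r - e) * X\<^sup>2 = w" using pos by (simp add: X_def)
  have P: "P y t = sqrt e * X" by (simp add: P_def X_def e_def r_def w_def flip: real_sqrt_mult)
  have "1 - e / r = (r - e) / r" using pos by (simp add: field_simps)
  then have "k y t = sqrt (w * ((r - e) / r))" using pos by (simp add: k_def e_def r_def w_def max_def)
  also have "w * ((r - e) / r) = ((r - e) * X)\<^sup>2"
    unfolding X2[symmetric] using pos by (simp add: power2_eq_square field_simps)
  finally have k: "k y t = (r - e) * X" using pos X0 by simp
  have "\<theta> t * (P y t)\<^sup>2 + \<omega> (1 - t) = r * (e * X\<^sup>2) + r * (r - e) * X\<^sup>2"
    using pos by (simp add: P r_def[symmetric] w_def[symmetric] X2 power_mult_distrib)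
  also have "\<dots> = (r * X)\<^sup>2" by (simp add: power2_eq_square algebra_simps)
  finally have "sqrt (\<theta> t * (P y t)\<^sup>2 + \<omega> (1 - t)) = r * X" using pos X0 by simp
  also have "\<dots> = sqrt e * (sqrt e * X) + (r - e) * X" using pos by (simp add: algebra_simps)
  finally show ?thesis by (simp add: P k e_def)
qed

text \<open>Since \<open>Phi\<close> is twice the integral of the slope, the horizontal part of the
  geodesic covers exactly \<open>s\<close> and nothing is left for the turning height; its length is
  thus \<open>F s y\<close>.\<close>

lemma geodesic_energy_integral:
  assumes y: "0 < y" "y < 1" and s: "0 \<le> s" "Phi l Q \<omega> y = ennreal s"
  shows "2 * (\<integral>\<^sup>+ t\<in>{y<..<1}. ennreal (sqrt (\<theta> t * (P y t)\<^sup>2 + \<omega> (1 - t))) \<partial>lebesgue) = ennreal (F s y)"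
proof -
  have Pa: "P y absolutely_integrable_on {y<..<1}" and Pi: "ennreal s = ennreal (2 * integral {y<..<1} (P y))"
    using Phi_finite[OF y] s by auto
  have P0: "0 \<le> integral {y<..<1} (P y)"
    using P_nonneg y by (intro integral_nonneg set_lebesgue_integral_eq_integral(1) Pa) auto
  then have s2: "s = 2 * integral {y<..<1} (P y)" using Pi s(1) by simp
  have ka: "k y absolutely_integrable_on {y<..<1}"
    by (rule set_integrable_subset[OF k_abs_integrable[of y]]) (use y in auto)
  have a: "(\<lambda>t. sqrt (\<theta> y) * P y t) absolutely_integrable_on {y<..<1}"
    using Pa by (intro set_integrable_mult_right) auto
  have "(\<integral>\<^sup>+ t\<in>{y<..<1}. ennreal (sqrt (\<theta> t * (P y t)\<^sup>2 + \<omega> (1 - t))) \<partial>lebesgue)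
      = (\<integral>\<^sup>+ t\<in>{y<..<1}. ennreal (sqrt (\<theta> y) * P y t + k y t) \<partial>lebesgue)"
    by (intro nn_integral_cong) (use geodesic_energy y in \<open>auto split: split_indicator\<close>)
  also have "\<dots> = ennreal (integral {y<..<1} (\<lambda>t. sqrt (\<theta> y) * P y t + k y t))"
    using y P_nonneg k_nonneg \<theta>_nonneg[of y]
    by (intro nn_integral_eq_ennreal_integral set_integral_add(1) a ka) (auto intro!: add_nonneg_nonneg mult_nonneg_nonneg)
  also have "integral {y<..<1} (\<lambda>t. sqrt (\<theta> y) * P y t + k y t) = sqrt (\<theta> y) * integral {y<..<1} (P y) + integral {y<..<1} (k y)"
    using a ka by (subst integral_add) (auto intro: set_lebesgue_integral_eq_integral(1))
  also have "\<dots> = F s y / 2"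
    using y integral_k_from[of y] by (simp add: F_def s2 integral_open_interval_real)
  finally show ?thesis using F_nonneg[of s y] s y by (simp add: ennreal_mult'[symmetric] flip: ennreal_numeral)
qed

text \<open>This excludes \<open>s = 0\<close> on the level sets of \<open>Phi\<close>, so a
  truncated target distance can be taken strictly below \<open>s\<close>.\<close>

lemma Phi_pos: "0 < y \<Longrightarrow> y < 1 \<Longrightarrow> 0 < Phi l Q \<omega> y"
proof (rule ccontr)
  assume y: "0 < y" "y < 1" "\<not> 0 < Phi l Q \<omega> y"
  then have "(\<integral>\<^sup>+ t\<in>{y<..<1}. ennreal (P y t) \<partial>lebesgue) = 0" by (simp add: Phi_eq)
  moreover have "(\<integral>\<^sup>+ t\<in>{y<..<1}. ennreal (P y t) \<partial>lebesgue) = (\<integral>\<^sup>+ t. ennreal (indicator {y<..<1} t *\<^sub>R P y t) \<partial>lebesgue)"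
    by (intro nn_integral_cong) (auto split: split_indicator)
  moreover have "(\<lambda>t. ennreal (indicator {y<..<1} t *\<^sub>R P y t)) \<in> borel_measurable lebesgue"
    using P_measurable[OF y(1)] by (intro measurable_completion) simp
  ultimately have "AE t in lebesgue. ennreal (indicator {y<..<1} t *\<^sub>R P y t) = 0"
    using nn_integral_0_iff_AE by metis
  then have "AE t in lebesgue. t \<in> {y<..<1} \<longrightarrow> P y t \<le> 0"
    by eventually_elim (auto simp: ennreal_eq_0_iff)
  from AE_lebesgue_interval_ex[OF this y(2)] obtain t where t: "t \<in> {y<..<1}" "P y t \<le> 0" .
  then have "0 < P y t"
    using \<theta>_pos[of y] \<theta>_pos[of t] \<theta>_strict_mono[of y t] \<omega>_pos[of "1 - t"] y by (simp add: P_def)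
  then show False using t(2) by simp
qed

text \<open>The geodesic slope is unbounded near its turning height, whereas
  \<open>g_surf_upper_bound\<close> asks for a bounded slope. The slope is therefore set to 0 below
  some \<open>x > y\<close>, which does not raise the energy there, and the small distance lost is
  covered horizontally at height \<open>y\<close>.\<close>

lemma g_surf_le_F:
  assumes y: "0 < y" "y < 1" and s: "0 \<le> s" "Phi l Q \<omega> y = ennreal s"
  shows "g_surf l Q \<omega> s \<le> ennreal (F s y)"
proof (rule ennreal_le_epsilon)
  fix e :: real assume "0 < e"
  have spos: "0 < s" using Phi_pos[OF y] s by (cases "s = 0") auto
  have th: "0 < \<theta> y" using \<theta>_pos y by simp
  \<comment> \<open>Covering the distance \<open>\<delta>\<close> at height \<open>y\<close> costs
    exactly \<open>e\<close>.\<close>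
  define \<delta> where "\<delta> = e / sqrt (\<theta> y)"
  have \<delta>: "0 < \<delta>" "sqrt (\<theta> y) * \<delta> = e" using th \<open>0 < e\<close> by (simp_all add: \<delta>_def)
  have "ennreal (max 0 (s - \<delta>)) < Phi l Q \<omega> y" using \<delta> spos s(2) by (simp add: ennreal_less_iff)
  then obtain x where x: "y < x" "x < 1" "max 0 (s - \<delta>) < 2 * integral {x<..<1} (P y)"
    using Phi_approximation[OF y _ _ y(2), of "max 0 (s - \<delta>)"] by auto
  define J where "J = integral {x<..<1} (P y)"
  define p where "p t = P y t * indicator {x<..<1} t" for t
  have pm: "p \<in> borel_measurable borel"
  proof -
    have "p = (\<lambda>t. (indicator {y<..<1} t *\<^sub>R P y t) * indicator {x<..<1} t)"
      using x by (auto simp: p_def split: split_indicator)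
    then show ?thesis using P_measurable[OF y(1)] by simp
  qed
  have p0: "0 \<le> p t" for t using P_nonneg[of y t] x y by (simp add: p_def split: split_indicator)
  obtain B where B: "\<And>t. t \<in> {x<..<1} \<Longrightarrow> \<bar>P y t\<bar> \<le> B" using P_bounded[OF y(1) x(1,2)] by blast
  have J: "(\<integral>\<^sup>+ t\<in>{x<..<1}. ennreal (P y t) \<partial>lebesgue) = ennreal J"
    unfolding J_def using y x P_nonneg by (intro nn_integral_eq_ennreal_integral P_abs_integrable) auto
  have J0: "0 \<le> J" using x(3) by (simp add: J_def)
  have "ennreal (2 * J) = 2 * (\<integral>\<^sup>+ t\<in>{x<..<1}. ennreal (P y t) \<partial>lebesgue)" by (simp add: J ennreal_mult')
  also have "\<dots> \<le> ennreal s"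
    unfolding s(2)[symmetric] Phi_eq using x
    by (intro mult_left_mono nn_integral_mono) (auto split: split_indicator)
  finally have Js: "2 * J \<le> s" using s(1) by (simp add: ennreal_le_iff)
  have "(\<integral>\<^sup>+ t. ennreal (p t) \<partial>lborel) = ennreal J"
    unfolding J[symmetric] nn_integral_lebesgue_lborel by (intro nn_integral_cong) (auto simp: p_def split: split_indicator)
  then have "g_surf l Q \<omega> s \<le> 2 * (\<integral>\<^sup>+ t\<in>{y<..<1}. ennreal (sqrt (\<theta> t * (p t)\<^sup>2 + \<omega> (1 - t))) \<partial>lebesgue)
      + esqrt (theta l Q \<omega> y) * ennreal (s - 2 * J)"
    using y x J0 Js p0 B by (intro g_surf_upper_bound[where B = "max 0 B"] pm) (auto simp: p_def abs_le_iff le_max_iff_disj split: split_indicator)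
  also have "\<dots> \<le> ennreal (F s y) + ennreal e"
  proof (intro add_mono)
    have "(\<integral>\<^sup>+ t\<in>{y<..<1}. ennreal (sqrt (\<theta> t * (p t)\<^sup>2 + \<omega> (1 - t))) \<partial>lebesgue)
        \<le> (\<integral>\<^sup>+ t\<in>{y<..<1}. ennreal (sqrt (\<theta> t * (P y t)\<^sup>2 + \<omega> (1 - t))) \<partial>lebesgue)"
      using y \<theta>_nonneg
      by (intro nn_integral_mono) (auto simp: p_def intro!: ennreal_leI split: split_indicator)
    then show "2 * (\<integral>\<^sup>+ t\<in>{y<..<1}. ennreal (sqrt (\<theta> t * (p t)\<^sup>2 + \<omega> (1 - t))) \<partial>lebesgue) \<le> ennreal (F s y)"
      unfolding geodesic_energy_integral[OF assms, symmetric] by (intro mult_left_mono) auto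
    have "esqrt (theta l Q \<omega> y) * ennreal (s - 2 * J) = ennreal (sqrt (\<theta> y) * (s - 2 * J))"
      using y th Js by (simp add: theta_eq esqrt_ennreal ennreal_mult)
    also have "\<dots> \<le> ennreal (sqrt (\<theta> y) * \<delta>)"
      using th x(3) by (intro ennreal_leI mult_left_mono) (auto simp: J_def)
    finally show "esqrt (theta l Q \<omega> y) * ennreal (s - 2 * J) \<le> ennreal e" by (simp add: \<delta>)
  qed
  finally show "g_surf l Q \<omega> s \<le> ennreal (F s y) + ennreal e" .
qed

section \<open>Bounds for the relaxed functional on graphs\<close>

lemma reflected_k_integral:
  assumes "0 < m" "m < 1"
  shows "(\<lambda>t. k m (m + \<bar>t - m\<bar>)) absolutely_integrable_on {2 * m - 1<..<1}"
    "integral {2 * m - 1<..<1} (\<lambda>t. k m (m + \<bar>t - m\<bar>)) = 2 * integral {0..1} (k m)"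
proof -
  have range: "m + \<bar>t - m\<bar> \<in> {m..1}" if "t \<in> {2 * m - 1..1}" for t using that by (auto simp: abs_if)
  have "continuous_on {2 * m - 1..1} (\<lambda>t. k m (m + \<bar>t - m\<bar>))"
    by (rule continuous_on_compose2[OF k_continuous_on[of m]]) (use assms range in \<open>auto intro!: continuous_intros\<close>)
  then show abs: "(\<lambda>t. k m (m + \<bar>t - m\<bar>)) absolutely_integrable_on {2 * m - 1<..<1}"
    using absolutely_integrable_continuous_real absolutely_integrable_Icc_iff_Ioo by blast
  have k0: "0 \<le> k m (m + \<bar>t - m\<bar>)" if "t \<in> {2 * m - 1<..<1}" for t
    using range[of t] that assms by (intro k_nonneg) auto
  have meas: "(\<lambda>t. ennreal (k m t) * indicator {m<..<1} t) \<in> borel_measurable borel"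
  proof -
    have "(\<lambda>t. ennreal (k m t) * indicator {m<..<1} t) = (\<lambda>t. ennreal (indicator {m<..<1} t *\<^sub>R k m t))"
      by (auto split: split_indicator)
    then show ?thesis using k_indicator_measurable[of m m] assms by simp
  qed
  have "ennreal (integral {2 * m - 1<..<1} (\<lambda>t. k m (m + \<bar>t - m\<bar>))) =
      (\<integral>\<^sup>+ t\<in>{2 * m - 1<..<1}. ennreal (k m (m + \<bar>t - m\<bar>)) \<partial>lebesgue)"
    by (rule nn_integral_eq_ennreal_integral[symmetric]) (use abs k0 in auto)
  also have "\<dots> = 2 * (\<integral>\<^sup>+ t\<in>{m<..<1}. ennreal (k m t) \<partial>lebesgue)"
    by (rule nn_integral_reflected[OF meas assms(2)])
  also have "\<dots> = ennreal (2 * integral {0..1} (k m))"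
    using assms nn_integral_k[of m m] integral_k_from[of m] by (simp add: ennreal_mult')
  finally show "integral {2 * m - 1<..<1} (\<lambda>t. k m (m + \<bar>t - m\<bar>)) = 2 * integral {0..1} (k m)"
    using assms k_nonneg k0
    by (subst (asm) ennreal_inj) (auto intro!: integral_nonneg k_integrable set_lebesgue_integral_eq_integral(1)[OF abs])
qed

text \<open>All four terms are calibrated by the same constant \<open>c = sqrt (\<theta> m)\<close>,
  which is below the square root of every weight that occurs. The increments from 0 to the left
  trace, through the regular and singular parts, and from the right trace to \<open>s\<close> add up
  to \<open>s\<close>.\<close>

lemma scG_lower_bound:
  assumes m: "0 < m" "m < 1" and s: "0 \<le> s"
  shows "ennreal (F s m) \<le> scG l Q \<omega> m s w"
proof (cases "BV_on (2 * m - 1) 1 w")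
  case False
  then show ?thesis by (simp add: scG_def)
next
  case True
  define a where "a = 2 * m - 1"
  have ab: "a < 1" using m by (simp add: a_def)
  have bv: "BV_on a 1 w" using True by (simp add: a_def)
  define M where "M = sing_variation a 1 w"
  obtain f \<tau> where D: "BV_decomposition a 1 w f M \<tau>" and f: "AE x in lebesgue. x \<in> {a<..<1} \<longrightarrow> ac_deriv a 1 w x = f x"
    using BV_on_ac_deriv_sing_variation[OF ab bv] unfolding M_def by blast
  have tr: "trace_right_end a 1 w - trace_left_end a 1 w = (LINT x:{a<..<1}|lebesgue. f x) + (LINT x|M. \<tau> x)"
    by (rule BV_on_trace_difference[OF ab bv D])
  have fa: "f absolutely_integrable_on {a<..<1}" and pol: "polar_signed_measure a 1 M \<tau>"
    using D by (auto simp: BV_decomposition_def)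
  interpret finite_measure M by (rule finite_measure_polar[OF pol])
  define c where "c = sqrt (\<theta> m)"
  have c0: "0 \<le> c" using \<theta>_nonneg[of m] m by (simp add: c_def)
  have range: "m + \<bar>t - m\<bar> \<in> {m..<1}" if "t \<in> {a<..<1}" for t using that by (auto simp: abs_if a_def)
  have cle: "ennreal c \<le> esqrt (theta l Q \<omega> x)" if "m \<le> x" "x \<le> 1" for x
    using esqrt_mono[OF theta_mono[of m x]] that m by (simp add: theta_eq esqrt_ennreal c_def)
  have 1: "ennreal (c * integral {a<..<1} f + 2 * integral {0..1} (k m)) \<le>
      (\<integral>\<^sup>+ t\<in>{a<..<1}. esqrt (theta_refl l Q \<omega> m t * ennreal ((ac_deriv a 1 w t)\<^sup>2) + ennreal (omega_refl \<omega> m t)) \<partial>lebesgue)"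
  proof -
    have cf: "(\<lambda>t. c * f t) absolutely_integrable_on {a<..<1}" using fa by (intro set_integrable_mult_right) auto
    note kr = reflected_k_integral[OF m, folded a_def]
    have eq: "c * integral {a<..<1} f + 2 * integral {0..1} (k m) = integral {a<..<1} (\<lambda>t. c * f t + k m (m + \<bar>t - m\<bar>))"
      using cf kr(1) by (subst integral_add) (auto intro: set_lebesgue_integral_eq_integral(1) simp: kr(2))
    have "ennreal (integral {a<..<1} (\<lambda>t. c * f t + k m (m + \<bar>t - m\<bar>)))
        \<le> (\<integral>\<^sup>+ t\<in>{a<..<1}. esqrt (theta_refl l Q \<omega> m t * ennreal ((f t)\<^sup>2) + ennreal (omega_refl \<omega> m t)) \<partial>lebesgue)"
    proof (rule ennreal_integral_le_nn_integral)
      show "(\<lambda>t. c * f t + k m (m + \<bar>t - m\<bar>)) absolutely_integrable_on {a<..<1}"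
        by (intro set_integral_add(1) cf kr(1))
      fix t assume "t \<in> {a<..<1}"
      \<comment> \<open>A graph over the vertical axis has vertical speed 1, so the pointwise bound
        is used with \<open>q = 1\<close>.\<close>
      then show "ennreal (c * f t + k m (m + \<bar>t - m\<bar>)) \<le> esqrt (theta_refl l Q \<omega> m t * ennreal ((f t)\<^sup>2) + ennreal (omega_refl \<omega> m t))"
        using theta_integrand_lower_bound[of m "m + \<bar>t - m\<bar>" "f t" 1] range[of t] m
        by (simp add: theta_refl_def omega_refl_def c_def algebra_simps)
    qed
    also have "\<dots> = (\<integral>\<^sup>+ t\<in>{a<..<1}. esqrt (theta_refl l Q \<omega> m t * ennreal ((ac_deriv a 1 w t)\<^sup>2) + ennreal (omega_refl \<omega> m t)) \<partial>lebesgue)"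
    proof (rule nn_integral_cong_AE)
      show "AE t in lebesgue. esqrt (theta_refl l Q \<omega> m t * ennreal ((f t)\<^sup>2) + ennreal (omega_refl \<omega> m t)) * indicator {a<..<1} t
        = esqrt (theta_refl l Q \<omega> m t * ennreal ((ac_deriv a 1 w t)\<^sup>2) + ennreal (omega_refl \<omega> m t)) * indicator {a<..<1} t"
        using f
      proof eventually_elim
        case (elim t)
        then show ?case by (cases "t \<in> {a<..<1}") simp_all
      qed
    qed
    finally show ?thesis unfolding eq .
  qed
  have 2: "ennreal (c * (LINT x|M. \<tau> x)) \<le> (\<integral>\<^sup>+ t. esqrt (theta_refl l Q \<omega> m t) \<partial>M)"
  proof -
    have "\<tau> x \<le> 1" if "x \<in> space M" for x
      using abs_ge_self[of "\<tau> x"] polar_abs[OF pol, of x] space_polar[OF pol] that by simp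
    then have "(LINT x|M. \<tau> x) \<le> (LINT x|M. 1)"
      by (intro integral_mono polar_integrable[OF pol]) simp_all
    then have "ennreal (c * (LINT x|M. \<tau> x)) \<le> ennreal (c * measure M (space M))"
      using c0 by (intro ennreal_leI mult_left_mono) auto
    also have "\<dots> = (\<integral>\<^sup>+ t. ennreal c \<partial>M)" using c0 by (simp add: emeasure_eq_measure ennreal_mult)
    also have "\<dots> \<le> (\<integral>\<^sup>+ t. esqrt (theta_refl l Q \<omega> m t) \<partial>M)"
    proof (rule nn_integral_mono)
      fix t assume "t \<in> space M"
      then have "m + \<bar>t - m\<bar> \<in> {m..<1}" using range space_polar[OF pol] by simp
      then show "ennreal c \<le> esqrt (theta_refl l Q \<omega> m t)" unfolding theta_refl_def by (intro cle) auto
    qed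
    finally show ?thesis .
  qed
  have 3: "ennreal (c * \<bar>r\<bar>) \<le> esqrt (theta l Q \<omega> 1) * ennreal \<bar>r\<bar>" for r
    using mult_right_mono[OF cle[of 1], of "ennreal \<bar>r\<bar>"] m c0 by (simp add: ennreal_mult)
  define L R where "L = trace_left_end a 1 w" and "R = trace_right_end a 1 w"
  have "R - L = integral {a<..<1} f + (LINT x|M. \<tau> x)"
    using tr set_lebesgue_integral_eq_integral(2)[OF fa] by (simp add: L_def R_def)
  then have "c * s = c * integral {a<..<1} f + c * (LINT x|M. \<tau> x) + c * L + c * (s - R)"
    by (simp add: algebra_simps)
  also have "\<dots> \<le> c * integral {a<..<1} f + c * (LINT x|M. \<tau> x) + c * \<bar>L\<bar> + c * \<bar>R - s\<bar>"
    using c0 by (intro add_mono mult_left_mono) auto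
  finally have "ennreal (F s m) \<le> ennreal ((c * integral {a<..<1} f + 2 * integral {0..1} (k m)) + c * (LINT x|M. \<tau> x) + c * \<bar>L\<bar> + c * \<bar>R - s\<bar>)"
    by (intro ennreal_leI) (simp add: F_def c_def)
  also have "\<dots> \<le> ennreal (c * integral {a<..<1} f + 2 * integral {0..1} (k m)) + ennreal (c * (LINT x|M. \<tau> x)) + ennreal (c * \<bar>L\<bar>) + ennreal (c * \<bar>R - s\<bar>)"
    by (intro order_trans[OF ennreal_add_le] add_right_mono ennreal_add_le)
  also have "\<dots> \<le> scG l Q \<omega> m s w"
    unfolding scG_def a_def[symmetric] if_P[OF bv] M_def[symmetric] L_def[symmetric] R_def[symmetric]
    by (intro add_mono 1 2 3)
  finally show ?thesis .
qed

lemma min_scG_lower_bound: "0 < m \<Longrightarrow> m < 1 \<Longrightarrow> 0 \<le> s \<Longrightarrow> ennreal (F s m) \<le> min_scG l Q \<omega> s m"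
  unfolding min_scG_def by (intro INF_greatest scG_lower_bound)

text \<open>The primitive of \<open>p\<close> has traces 0 and \<open>s\<close> and a null singular
  part. The boundary terms vanish even for infinite \<open>\<sigma>\<close>, thanks to
  \<open>0 * \<infinity> = 0\<close>.\<close>

lemma min_scG_upper_bound:
  assumes m: "0 < m" "m < 1" and p: "p absolutely_integrable_on {2 * m - 1<..<1}"
    and s: "integral {2 * m - 1<..<1} p = s"
  shows "min_scG l Q \<omega> s m \<le>
    (\<integral>\<^sup>+ t\<in>{2 * m - 1<..<1}. ennreal (sqrt (\<theta> (m + \<bar>t - m\<bar>) * (p t)\<^sup>2 + \<omega> (1 - (m + \<bar>t - m\<bar>)))) \<partial>lebesgue)"
proof -
  define a where "a = 2 * m - 1"
  have ab: "a < 1" using m by (simp add: a_def)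
  define w where "w t = integral {a..t} p" for t
  note ac = absolutely_continuous_BV[OF ab, of p w 0]
  have p': "set_integrable lebesgue {a<..<1} p" using p by (simp add: a_def)
  have w: "w absolutely_integrable_on {a<..<1}" "BV_on a 1 w"
    "AE x in lebesgue. x \<in> {a<..<1} \<longrightarrow> ac_deriv a 1 w x = p x"
    "emeasure (sing_variation a 1 w) (space (sing_variation a 1 w)) = 0"
    "trace_left_end a 1 w = 0" "trace_right_end a 1 w = s"
    using ac[OF p'] s by (simp_all add: w_def integral_open_interval_real a_def)
  define M where "M = sing_variation a 1 w"
  have "min_scG l Q \<omega> s m \<le> scG l Q \<omega> m s w"
    unfolding min_scG_def using w(1) by (intro INF_lower) (simp add: a_def)
  also have "\<dots> = (\<integral>\<^sup>+ t\<in>{a<..<1}. esqrt (theta_refl l Q \<omega> m t * ennreal ((ac_deriv a 1 w t)\<^sup>2) + ennreal (omega_refl \<omega> m t)) \<partial>lebesgue)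
      + (\<integral>\<^sup>+ t. esqrt (theta_refl l Q \<omega> m t) \<partial>M)"
    using w(2,5,6) by (simp add: scG_def a_def M_def)
  also have "(\<integral>\<^sup>+ t. esqrt (theta_refl l Q \<omega> m t) \<partial>M) = (\<integral>\<^sup>+ t. 0 \<partial>M)"
    by (intro nn_integral_cong_AE AE_I'[of "space M"]) (use w(4) in \<open>auto simp: M_def null_sets_def\<close>)
  also have "(\<integral>\<^sup>+ t\<in>{a<..<1}. esqrt (theta_refl l Q \<omega> m t * ennreal ((ac_deriv a 1 w t)\<^sup>2) + ennreal (omega_refl \<omega> m t)) \<partial>lebesgue)
     = (\<integral>\<^sup>+ t\<in>{a<..<1}. ennreal (sqrt (\<theta> (m + \<bar>t - m\<bar>) * (p t)\<^sup>2 + \<omega> (1 - (m + \<bar>t - m\<bar>)))) \<partial>lebesgue)"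
  proof (rule nn_integral_cong_AE)
    show "AE t in lebesgue. esqrt (theta_refl l Q \<omega> m t * ennreal ((ac_deriv a 1 w t)\<^sup>2) + ennreal (omega_refl \<omega> m t)) * indicator {a<..<1} t
      = ennreal (sqrt (\<theta> (m + \<bar>t - m\<bar>) * (p t)\<^sup>2 + \<omega> (1 - (m + \<bar>t - m\<bar>)))) * indicator {a<..<1} t"
      using w(3)
    proof eventually_elim
      case (elim t)
      show ?case
      proof (cases "t \<in> {a<..<1}")
        case True
        define x where "x = m + \<bar>t - m\<bar>"
        have x: "m \<le> x" "x < 1" using True by (auto simp: x_def abs_if a_def)
        have "theta_refl l Q \<omega> m t = ennreal (\<theta> x)" "omega_refl \<omega> m t = \<omega> (1 - x)"
          using x by (simp_all add: theta_refl_def omega_refl_def theta_eq flip: x_def) (simp add: x_def algebra_simps)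
        moreover have "0 \<le> \<theta> x" "0 \<le> \<omega> (1 - x)" using x m \<theta>_nonneg[of x] \<omega>_nonneg[of "1 - x"] by auto
        ultimately show ?thesis using elim True
          by (simp add: esqrt_ennreal flip: ennreal_mult ennreal_plus x_def)
      qed simp
    qed
  qed
  finally show ?thesis by (simp add: a_def)
qed

text \<open>A BV competitor only needs an integrable slope, so the whole geodesic can be inserted
  without truncation: its slope is reflected at \<open>m\<close> and its integral is
  \<open>Phi = s\<close>.\<close>

lemma min_scG_le_F:
  assumes m: "0 < m" "m < 1" and s: "0 \<le> s" "Phi l Q \<omega> m = ennreal s"
  shows "min_scG l Q \<omega> s m \<le> ennreal (F s m)"
proof -
  define p where "p t = P m (m + \<bar>t - m\<bar>)" for t
  define q where "q t = indicator {m<..<1} t *\<^sub>R P m t" for t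
  have qm [measurable]: "q \<in> borel_measurable borel" unfolding q_def[abs_def] by (rule P_measurable[OF m(1)])
  have range: "m + \<bar>t - m\<bar> \<in> {m..<1}" if "t \<in> {2 * m - 1<..<1}" for t using that by (auto simp: abs_if)
  \<comment> \<open>Default value of a division by zero at the turning point; with it
    \<open>p\<close> agrees with the measurable function \<open>q\<close> also at
    \<open>t = m\<close>.\<close>
  have Pm: "P m m = 0" by (simp add: P_def)
  have p0: "0 \<le> p t" if "t \<in> {2 * m - 1<..<1}" for t
    using range[OF that] P_nonneg[of m "m + \<bar>t - m\<bar>"] m Pm by (cases "t = m") (auto simp: p_def)
  have pq: "p t = q (m + \<bar>t - m\<bar>)" if "t \<in> {2 * m - 1<..<1}" for t
    using range[OF that] Pm by (cases "t = m") (auto simp: p_def q_def)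
  have Pmeas: "(\<lambda>t. ennreal (P m t) * indicator {m<..<1} t) \<in> borel_measurable borel"
  proof -
    have "(\<lambda>t. ennreal (P m t) * indicator {m<..<1} t) = (\<lambda>t. ennreal (q t))"
      by (auto simp: q_def split: split_indicator)
    then show ?thesis by simp
  qed
  have pI: "(\<integral>\<^sup>+ t\<in>{2 * m - 1<..<1}. ennreal (p t) \<partial>lebesgue) = ennreal s"
    unfolding p_def nn_integral_reflected[OF Pmeas m(2)] using s(2) by (simp add: Phi_eq)
  have pa: "p absolutely_integrable_on {2 * m - 1<..<1}"
    unfolding set_integrable_def
  proof (rule integrableI_nonneg)
    have "(\<lambda>t. indicator {2 * m - 1<..<1} t *\<^sub>R p t) = (\<lambda>t. indicator {2 * m - 1<..<1} t *\<^sub>R q (m + \<bar>t - m\<bar>))"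
      using pq by (auto split: split_indicator)
    also have "\<dots> \<in> borel_measurable lebesgue" by (intro measurable_completion) simp
    finally show "(\<lambda>t. indicator {2 * m - 1<..<1} t *\<^sub>R p t) \<in> borel_measurable lebesgue" .
    show "AE t in lebesgue. 0 \<le> indicator {2 * m - 1<..<1} t *\<^sub>R p t"
      using p0 by (auto split: split_indicator)
    have "(\<integral>\<^sup>+ t. ennreal (indicator {2 * m - 1<..<1} t *\<^sub>R p t) \<partial>lebesgue) = (\<integral>\<^sup>+ t\<in>{2 * m - 1<..<1}. ennreal (p t) \<partial>lebesgue)"
      by (intro nn_integral_cong) (auto split: split_indicator)
    then show "(\<integral>\<^sup>+ t. ennreal (indicator {2 * m - 1<..<1} t *\<^sub>R p t) \<partial>lebesgue) < \<infinity>" using pI by simp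
  qed
  have "ennreal (integral {2 * m - 1<..<1} p) = ennreal s"
    using nn_integral_eq_ennreal_integral[OF pa p0] pI by simp
  then have ps: "integral {2 * m - 1<..<1} p = s"
    using p0 s(1) by (subst (asm) ennreal_inj) (auto intro!: integral_nonneg set_lebesgue_integral_eq_integral(1) pa)
  define h where "h t = ennreal (sqrt (\<theta> t * (P m t)\<^sup>2 + \<omega> (1 - t)))" for t
  have hmeas: "(\<lambda>t. h t * indicator {m<..<1} t) \<in> borel_measurable borel"
  proof -
    have "(\<lambda>t. h t * indicator {m<..<1} t) =
        (\<lambda>t. ennreal (sqrt ((indicator {m<..<1} t *\<^sub>R \<theta> t) * (q t)\<^sup>2 + indicator {m<..<1} t *\<^sub>R \<omega> (1 - t))))"
      by (auto simp: h_def q_def split: split_indicator)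
    also have "\<dots> \<in> borel_measurable borel"
    proof -
      note [measurable] = \<theta>_indicator_measurable[OF less_imp_le[OF m(1)]] \<omega>_indicator_measurable[OF less_imp_le[OF m(1)]]
      show ?thesis by measurable
    qed
    finally show ?thesis .
  qed
  have "min_scG l Q \<omega> s m \<le> (\<integral>\<^sup>+ t\<in>{2 * m - 1<..<1}. h (m + \<bar>t - m\<bar>) \<partial>lebesgue)"
    using min_scG_upper_bound[OF m pa ps] by (simp add: h_def p_def)
  also have "\<dots> = 2 * (\<integral>\<^sup>+ t\<in>{m<..<1}. h t \<partial>lebesgue)"
    by (rule nn_integral_reflected[OF hmeas m(2)])
  also have "\<dots> = ennreal (F s m)"
    unfolding h_def by (rule geodesic_energy_integral[OF assms])
  finally show ?thesis .
qed

text \<open>The competitor climbs from 0 to \<open>s\<close> with constant slope within distance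
  \<open>\<delta>\<close> of \<open>m\<close> and is constant elsewhere; subadditivity of the square
  root separates the two costs. The bound is crude but sharp in both limits:
  \<open>\<delta> = m\<close> gives a vanishing \<open>E\<close> as \<open>m\<close> tends to 0, and
  \<open>\<delta> = 1 - m\<close> with \<open>E = \<sigma>\<close> serves the limit at 1.\<close>

lemma min_scG_ramp:
  assumes m: "0 < m" "m < 1" and \<delta>: "0 < \<delta>" "\<delta> \<le> 1 - m" and s: "0 \<le> s"
    and E: "\<And>t. m \<le> t \<Longrightarrow> t < m + \<delta> \<Longrightarrow> ennreal (sqrt (\<theta> t)) \<le> E"
  shows "min_scG l Q \<omega> s m \<le> 2 * ennreal (integral {m..1} (k 0)) + E * ennreal s"
proof -
  define I where "I = {m - \<delta><..<m + \<delta>}"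
  define p where "p t = s / (2 * \<delta>) * indicator I t" for t
  have I: "I \<subseteq> {2 * m - 1<..<1}" using \<delta> by (auto simp: I_def)
  have pI: "(p has_integral s) {2 * m - 1<..<1}"
  proof -
    have "((\<lambda>_. s / (2 * \<delta>)) has_integral (s / (2 * \<delta>) * (2 * \<delta>))) {m - \<delta>..m + \<delta>}"
      using has_integral_const_real[of "s / (2 * \<delta>)" "m - \<delta>" "m + \<delta>"] \<delta> by simp
    then have "((\<lambda>_. s / (2 * \<delta>)) has_integral s) I"
      using \<delta> by (simp add: I_def has_integral_Icc_iff_Ioo)
    then have "((\<lambda>t. if t \<in> I then s / (2 * \<delta>) else 0) has_integral s) {2 * m - 1<..<1}"
      using I by (simp add: has_integral_restrict)
    moreover have "(\<lambda>t. if t \<in> I then s / (2 * \<delta>) else 0) = p" by (auto simp: p_def)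
    ultimately show ?thesis by simp
  qed
  have p0: "0 \<le> p t" for t using s \<delta> by (simp add: p_def)
  have pa: "p absolutely_integrable_on {2 * m - 1<..<1}"
    using pI p0 by (intro nonnegative_absolutely_integrable_1) auto
  have wm: "(\<lambda>t. ennreal (sqrt (\<omega> (1 - t))) * indicator {m<..<1} t) \<in> borel_measurable borel"
  proof -
    have "(\<lambda>t. ennreal (sqrt (\<omega> (1 - t))) * indicator {m<..<1} t) = (\<lambda>t. ennreal (sqrt (indicator {m<..<1} t *\<^sub>R \<omega> (1 - t))))"
      by (auto split: split_indicator)
    then show ?thesis using \<omega>_indicator_measurable[of m] m by simp
  qed
  have "min_scG l Q \<omega> s m \<le>
    (\<integral>\<^sup>+ t\<in>{2 * m - 1<..<1}. ennreal (sqrt (\<theta> (m + \<bar>t - m\<bar>) * (p t)\<^sup>2 + \<omega> (1 - (m + \<bar>t - m\<bar>)))) \<partial>lebesgue)"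
    by (rule min_scG_upper_bound[OF m pa]) (use pI in \<open>simp add: integral_unique\<close>)
  also have "\<dots> \<le> (\<integral>\<^sup>+ t. ennreal (sqrt (\<omega> (1 - (m + \<bar>t - m\<bar>)))) * indicator {2 * m - 1<..<1} t + E * ennreal (p t) \<partial>lebesgue)"
  proof (rule nn_integral_mono)
    fix t
    show "ennreal (sqrt (\<theta> (m + \<bar>t - m\<bar>) * (p t)\<^sup>2 + \<omega> (1 - (m + \<bar>t - m\<bar>)))) * indicator {2 * m - 1<..<1} t
        \<le> ennreal (sqrt (\<omega> (1 - (m + \<bar>t - m\<bar>)))) * indicator {2 * m - 1<..<1} t + E * ennreal (p t)"
    proof (cases "t \<in> {2 * m - 1<..<1}")
      case True
      define x where "x = m + \<bar>t - m\<bar>"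
      have x: "m \<le> x" "x < 1" using True by (auto simp: x_def abs_if)
      have nn: "0 \<le> \<theta> x" "0 \<le> \<omega> (1 - x)" using x m \<theta>_nonneg[of x] \<omega>_nonneg[of "1 - x"] by auto
      have "sqrt (\<theta> x * (p t)\<^sup>2 + \<omega> (1 - x)) \<le> sqrt (\<theta> x) * p t + sqrt (\<omega> (1 - x))"
        using sqrt_add_le_add_sqrt[of "\<theta> x * (p t)\<^sup>2" "\<omega> (1 - x)"] nn p0[of t] by (simp add: real_sqrt_mult)
      then have "ennreal (sqrt (\<theta> x * (p t)\<^sup>2 + \<omega> (1 - x))) \<le> ennreal (sqrt (\<theta> x)) * ennreal (p t) + ennreal (sqrt (\<omega> (1 - x)))"
        using nn p0[of t] by (simp add: ennreal_leI flip: ennreal_mult ennreal_plus)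
      also have "ennreal (sqrt (\<theta> x)) * ennreal (p t) \<le> E * ennreal (p t)"
      proof (cases "t \<in> I")
        case True
        then have "x < m + \<delta>" by (auto simp: x_def I_def abs_if)
        then show ?thesis using E x by (intro mult_right_mono) auto
      qed (simp add: p_def)
      finally show ?thesis using True by (simp add: add.commute flip: x_def)
    qed simp
  qed
  also have "\<dots> = (\<integral>\<^sup>+ t\<in>{2 * m - 1<..<1}. ennreal (sqrt (\<omega> (1 - (m + \<bar>t - m\<bar>)))) \<partial>lebesgue) + (\<integral>\<^sup>+ t. E * ennreal (p t) \<partial>lebesgue)"
  proof (rule nn_integral_add)
    have "continuous_on {2 * m - 1<..<1} (\<lambda>t. sqrt (\<omega> (1 - (m + \<bar>t - m\<bar>))))"
      by (intro continuous_on_real_sqrt continuous_on_compose2[OF \<omega>_continuous] continuous_intros)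
        (use m in \<open>auto simp: abs_if\<close>)
    then have "(\<lambda>t. ennreal (indicator {2 * m - 1<..<1} t *\<^sub>R sqrt (\<omega> (1 - (m + \<bar>t - m\<bar>))))) \<in> borel_measurable borel"
      by (intro measurable_compose[OF _ measurable_ennreal] borel_measurable_continuous_on_indicator) auto
    moreover have "(\<lambda>t. ennreal (sqrt (\<omega> (1 - (m + \<bar>t - m\<bar>)))) * indicator {2 * m - 1<..<1} t) =
        (\<lambda>t. ennreal (indicator {2 * m - 1<..<1} t *\<^sub>R sqrt (\<omega> (1 - (m + \<bar>t - m\<bar>)))))"
      by (auto split: split_indicator)
    ultimately show "(\<lambda>t. ennreal (sqrt (\<omega> (1 - (m + \<bar>t - m\<bar>)))) * indicator {2 * m - 1<..<1} t) \<in> borel_measurable lebesgue"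
      by (intro measurable_completion) simp
    show "(\<lambda>t. E * ennreal (p t)) \<in> borel_measurable lebesgue"
      unfolding p_def I_def by (intro measurable_completion) simp
  qed
  also have "(\<integral>\<^sup>+ t\<in>{2 * m - 1<..<1}. ennreal (sqrt (\<omega> (1 - (m + \<bar>t - m\<bar>)))) \<partial>lebesgue) = 2 * ennreal (integral {m..1} (k 0))"
    using nn_integral_reflected[OF wm m(2)] sqrt_\<omega>_integral[of m] m by simp
  also have "(\<integral>\<^sup>+ t. E * ennreal (p t) \<partial>lebesgue) = E * (\<integral>\<^sup>+ t. ennreal (p t) \<partial>lebesgue)"
    unfolding p_def I_def by (rule nn_integral_cmult) (intro measurable_completion, simp)
  also have "(\<integral>\<^sup>+ t. ennreal (p t) \<partial>lebesgue) = (\<integral>\<^sup>+ t\<in>{2 * m - 1<..<1}. ennreal (p t) \<partial>lebesgue)"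
    by (intro nn_integral_cong) (use I in \<open>auto simp: p_def split: split_indicator\<close>)
  also have "\<dots> = ennreal s"
    using nn_integral_eq_ennreal_integral[OF pa] p0 pI by (simp add: integral_unique)
  finally show ?thesis .
qed

text \<open>Squeezed between the calibration bound, by continuity of \<open>F\<close> at 0, and a
  ramp on \<open>(0, 2 * m)\<close>, whose horizontal weight tends to
  \<open>\<theta> 0 = 0\<close>.\<close>

lemma Liminf_min_scG_0:
  assumes s: "0 \<le> s"
  shows "Liminf (at_right 0) (\<lambda>m. min_scG l Q \<omega> s m) = ennreal (2 * Psi \<omega> 1)"
proof (rule antisym)
  have tw: "((\<lambda>m. ennreal (2 * Psi \<omega> 1 + sqrt (\<theta> (2 * m)) * s)) \<longlongrightarrow> ennreal (2 * Psi \<omega> 1 + sqrt (\<theta> (2 * 0)) * s)) (at_right 0)"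
  proof -
    have "(\<theta> \<longlongrightarrow> \<theta> 0) (at_right 0)" by (rule tendsto_at_right_0[OF \<theta>_continuous])
    moreover have "filterlim (\<lambda>m. 2 * m) (at_right 0) (at_right (0::real))"
      unfolding filterlim_at
      by (intro conjI) (auto simp: eventually_at_right_field intro!: tendsto_eq_intros exI[of _ 1])
    ultimately have "((\<lambda>m. \<theta> (2 * m)) \<longlongrightarrow> \<theta> (2 * 0)) (at_right 0)" using filterlim_compose by fastforce
    then show ?thesis by (intro tendsto_intros)
  qed
  have "Liminf (at_right 0) (\<lambda>m. min_scG l Q \<omega> s m) \<le> Liminf (at_right 0) (\<lambda>m. ennreal (2 * Psi \<omega> 1 + sqrt (\<theta> (2 * m)) * s))"
  proof (rule Liminf_mono)
    have "eventually (\<lambda>m. m \<in> {0<..<1/2}) (at_right (0::real))" by (rule eventually_at_rightI[of 0 "1/2"]) auto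
    then show "eventually (\<lambda>m. min_scG l Q \<omega> s m \<le> ennreal (2 * Psi \<omega> 1 + sqrt (\<theta> (2 * m)) * s)) (at_right 0)"
    proof eventually_elim
      case (elim m)
      then have "min_scG l Q \<omega> s m \<le> 2 * ennreal (integral {m..1} (k 0)) + ennreal (sqrt (\<theta> (2 * m))) * ennreal s"
        by (intro min_scG_ramp[where \<delta> = m] s ennreal_leI real_sqrt_le_mono \<theta>_mono) auto
      also have "\<dots> = ennreal (2 * integral {m..1} (k 0) + sqrt (\<theta> (2 * m)) * s)"
      proof -
        have "0 \<le> integral {m..1} (k 0)" "0 \<le> sqrt (\<theta> (2 * m))"
          using elim k_nonneg \<theta>_nonneg[of "2 * m"] by (auto intro!: integral_nonneg k_integrable)
        then show ?thesis using s by (simp add: ennreal_mult ennreal_plus)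
      qed
      also have "\<dots> \<le> ennreal (2 * Psi \<omega> 1 + sqrt (\<theta> (2 * m)) * s)"
      proof -
        have "0 \<le> integral {0..m} (k 0)" using elim k_nonneg by (intro integral_nonneg k_integrable) auto
        then show ?thesis using integral_k_split[of 0 m] elim by (intro ennreal_leI) (simp add: Psi_eq)
      qed
      finally show ?case .
    qed
  qed
  also have "\<dots> = ennreal (2 * Psi \<omega> 1)"
    using lim_imp_Liminf[OF _ tw] by (simp add: \<theta>_0 trivial_limit_at_right_real)
  finally show "Liminf (at_right 0) (\<lambda>m. min_scG l Q \<omega> s m) \<le> ennreal (2 * Psi \<omega> 1)" .
  have "(F s \<longlongrightarrow> F s 0) (at_right 0)" by (rule tendsto_at_right_0[OF F_continuous])
  then have "((\<lambda>m. ennreal (F s m)) \<longlongrightarrow> ennreal (F s 0)) (at_right 0)" by (rule tendsto_ennrealI)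
  from lim_imp_Liminf[OF _ this]
  have "ennreal (2 * Psi \<omega> 1) = Liminf (at_right 0) (\<lambda>m. ennreal (F s m))"
    by (simp add: F_0 trivial_limit_at_right_real)
  also have "\<dots> \<le> Liminf (at_right 0) (\<lambda>m. min_scG l Q \<omega> s m)"
    using s by (intro Liminf_mono eventually_at_rightI[of 0 1] min_scG_lower_bound) auto
  finally show "ennreal (2 * Psi \<omega> 1) \<le> Liminf (at_right 0) (\<lambda>m. min_scG l Q \<omega> s m)" .
qed

lemma sqrt_\<theta>_le_\<sigma>: "0 \<le> t \<Longrightarrow> t < 1 \<Longrightarrow> ennreal (sqrt (\<theta> t)) \<le> \<sigma>"
  using esqrt_mono[OF theta_mono[of t 1]] by (simp add: theta_eq esqrt_ennreal esqrt_theta_1)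

text \<open>Squeezed as at 0: the interval \<open>(2 * m - 1, 1)\<close> shrinks, so the vertical
  cost of the ramp disappears, while its horizontal cost never exceeds \<open>\<sigma>\<close> per
  unit.\<close>

lemma Liminf_min_scG_1:
  assumes s: "0 \<le> s"
  shows "Liminf (at_left 1) (\<lambda>m. min_scG l Q \<omega> s m) = \<sigma> * ennreal s"
proof (rule antisym)
  have "((\<lambda>m. integral {m..1} (k 0)) \<longlongrightarrow> integral {1..1} (k 0)) (at_left 1)"
    by (rule continuous_on_Icc_at_leftD[of 0 1]) (auto intro!: indefinite_integral_continuous_1' k_integrable)
  then have tw: "((\<lambda>m. 2 * ennreal (integral {m..1} (k 0)) + \<sigma> * ennreal s) \<longlongrightarrow> 2 * ennreal (integral {1..1} (k 0)) + \<sigma> * ennreal s) (at_left 1)"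
    by (intro tendsto_add tendsto_const ennreal_tendsto_cmult tendsto_ennrealI) auto
  have "Liminf (at_left 1) (\<lambda>m. min_scG l Q \<omega> s m) \<le> Liminf (at_left 1) (\<lambda>m. 2 * ennreal (integral {m..1} (k 0)) + \<sigma> * ennreal s)"
  proof (intro Liminf_mono eventually_at_leftI[of 0])
    fix m :: real assume "m \<in> {0<..<1}"
    then show "min_scG l Q \<omega> s m \<le> 2 * ennreal (integral {m..1} (k 0)) + \<sigma> * ennreal s"
      using s by (intro min_scG_ramp[where \<delta> = "1 - m"] sqrt_\<theta>_le_\<sigma>) auto
  qed simp
  also have "\<dots> = \<sigma> * ennreal s"
    using lim_imp_Liminf[OF _ tw] by (simp add: trivial_limit_at_left_real)
  finally show "Liminf (at_left 1) (\<lambda>m. min_scG l Q \<omega> s m) \<le> \<sigma> * ennreal s" .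
  have "\<sigma> * ennreal s = Liminf (at_left 1) (\<lambda>m. ennreal (F s m))"
    using lim_imp_Liminf[OF _ F_tendsto[OF s]] by (simp add: trivial_limit_at_left_real)
  also have "\<dots> \<le> Liminf (at_left 1) (\<lambda>m. min_scG l Q \<omega> s m)"
    using s by (intro Liminf_mono eventually_at_leftI[of 0] min_scG_lower_bound) auto
  finally show "\<sigma> * ennreal s \<le> Liminf (at_left 1) (\<lambda>m. min_scG l Q \<omega> s m)" .
qed

end

section \<open>Proof of the proposition\<close>

context regular
begin

lemma g_surf_lower_bound:
  assumes s: "0 \<le> s" and R: "R \<le> \<sigma> * ennreal s" "\<And>m. 0 \<le> m \<Longrightarrow> m < 1 \<Longrightarrow> R \<le> ennreal (F s m)"
  shows "R \<le> g_surf l Q \<omega> s"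
  unfolding g_surf_def
proof (rule INF_greatest, clarify)
  fix u v assume "admissible s u v"
  then show "R \<le> energy u v" using energy_lower_bound[OF s] R order_trans by blast
qed

lemma le_F_0I:
  assumes "\<And>m. 0 < m \<Longrightarrow> m < 1 \<Longrightarrow> R \<le> ennreal (F s m)"
  shows "R \<le> ennreal (F s 0)"
proof (rule tendsto_lowerbound)
  show "((\<lambda>m. ennreal (F s m)) \<longlongrightarrow> ennreal (F s 0)) (at_right 0)"
    by (intro tendsto_ennrealI tendsto_at_right_0 F_continuous)
  show "eventually (\<lambda>m. R \<le> ennreal (F s m)) (at_right 0)"
    by (rule eventually_at_rightI[of 0 1]) (use assms in auto)
qed (simp add: trivial_limit_at_right_real)

text \<open>Varying \<open>s\<close> at fixed \<open>m\<close> is how strict comparisons with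
  \<open>Phi\<close> are turned into non-strict ones.\<close>

lemma F_linear: "F s m = F s' m + sqrt (\<theta> m) * (s - s')"
  by (simp add: F_def algebra_simps)

text \<open>At \<open>s\<close> equal to the infimum of \<open>Phi\<close> the strict inequality
  needed for descent can fail. It holds for every \<open>s' < s\<close>, and the bound survives the
  limit. If \<open>\<sigma>\<close> is infinite no limit is possible, but \<open>s / 2\<close>
  already gives the claim.\<close>

lemma sigma_le_F:
  assumes s: "0 \<le> s" "ennreal s \<le> inf_Phi l Q \<omega>" and m: "0 < m" "m < 1"
  shows "\<sigma> * ennreal s \<le> ennreal (F s m)"
proof (cases "s = 0")
  case False
  then have "0 < s" using s by simp
  have less: "\<sigma> * ennreal s' \<le> ennreal (F s m)" if s': "0 \<le> s'" "s' < s" for s'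
  proof -
    have "ennreal s' < Phi l Q \<omega> y" if "0 < y" "y < 1" for y
    proof -
      have "ennreal s' < ennreal s" using s' by (simp add: ennreal_less_iff)
      also have "\<dots> \<le> inf_Phi l Q \<omega>" by (rule s(2))
      also have "\<dots> \<le> Phi l Q \<omega> y" unfolding inf_Phi_def using that by (intro INF_lower) simp
      finally show ?thesis .
    qed
    then have "\<sigma> * ennreal s' \<le> ennreal (F s' m)" by (intro F_lower_bound_small s' m)
    also have "\<dots> \<le> ennreal (F s m)"
      using F_linear[of s m s'] s' \<theta>_nonneg[of m] m by (intro ennreal_leI) simp
    finally show ?thesis .
  qed
  show ?thesis
  proof (cases \<sigma>)
    case top
    then have "\<sigma> * ennreal (s / 2) = top" using \<open>0 < s\<close> by (simp add: ennreal_top_mult)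
    then show ?thesis using less[of "s / 2"] \<open>0 < s\<close> by (simp add: top_unique)
  next
    case (real r)
    have "r * s \<le> F s m"
    proof (rule field_le_epsilon)
      fix e :: real assume "0 < e"
      \<comment> \<open>The distance to \<open>s\<close> is chosen so that \<open>r\<close> times it
        is at most \<open>e\<close>; adding 1 guards against \<open>r = 0\<close>, and the maximum
        keeps \<open>s'\<close> nonnegative.\<close>
      define s' where "s' = max 0 (s - e / (r + 1))"
      have s': "0 \<le> s'" "s' < s" using \<open>0 < s\<close> \<open>0 < e\<close> real by (simp_all add: s'_def)
      have "ennreal (r * s') \<le> ennreal (F s m)" using less[OF s'] real s' by (simp add: ennreal_mult)
      then have "r * s' \<le> F s m" using F_nonneg[of s m] s(1) m by (simp add: ennreal_le_iff)
      moreover have "r * (s - e / (r + 1)) \<le> r * s'" using real by (intro mult_left_mono) (auto simp: s'_def)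
      moreover have "r * (e / (r + 1)) \<le> e" using real \<open>0 < e\<close> by (simp add: field_simps)
      ultimately show "r * s \<le> F s m + e" by (simp add: right_diff_distrib)
    qed
    then show ?thesis using real s(1) by (simp add: ennreal_leI flip: ennreal_mult)
  qed
qed simp

lemma g_surf_small:
  assumes s: "0 \<le> s" "ennreal s \<le> inf_Phi l Q \<omega>"
  shows "g_surf l Q \<omega> s = \<sigma> * ennreal s"
proof (rule antisym)
  show "g_surf l Q \<omega> s \<le> \<sigma> * ennreal s" by (rule g_surf_le_sigma[OF s(1)])
  show "\<sigma> * ennreal s \<le> g_surf l Q \<omega> s"
  proof (rule g_surf_lower_bound[OF s(1) order_refl])
    fix m :: real assume "0 \<le> m" "m < 1"
    then show "\<sigma> * ennreal s \<le> ennreal (F s m)"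
      using sigma_le_F[OF s] le_F_0I[of "\<sigma> * ennreal s" s] by (cases "m = 0") auto
  qed
qed

text \<open>The counterpart from above: \<open>s + \<delta>\<close> lies strictly above all values
  of \<open>Phi\<close>, and by \<open>F_linear\<close> the error
  \<open>sqrt (\<theta> m) * \<delta>\<close> can be made arbitrarily small.\<close>

lemma g_surf_large:
  assumes s: "0 \<le> s" "sup_Phi l Q \<omega> \<le> ennreal s"
  shows "g_surf l Q \<omega> s = ennreal (2 * Psi \<omega> 1)"
proof (rule antisym)
  show "g_surf l Q \<omega> s \<le> ennreal (2 * Psi \<omega> 1)" by (rule g_surf_le_Psi[OF s(1)])
  have F: "F s 0 \<le> F s m" if m: "0 \<le> m" "m < 1" for m
  proof (rule field_le_epsilon)
    fix e :: real assume "0 < e"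
    \<comment> \<open>The summand 1 keeps the denominator positive when
      \<open>\<theta> m = 0\<close>.\<close>
    define \<delta> where "\<delta> = e / (sqrt (\<theta> m) + 1)"
    have th: "0 \<le> sqrt (\<theta> m)" using \<theta>_nonneg[of m] m by simp
    have pos: "0 < sqrt (\<theta> m) + 1" using th by linarith
    then have "(sqrt (\<theta> m) + 1) * \<delta> = e" by (simp add: \<delta>_def)
    moreover have "0 < \<delta>" unfolding \<delta>_def using pos \<open>0 < e\<close> by (rule divide_pos_pos[rotated])
    ultimately have \<delta>: "0 < \<delta>" "sqrt (\<theta> m) * \<delta> \<le> e" by (simp_all add: distrib_right)
    have "Phi l Q \<omega> y < ennreal (s + \<delta>)" if "0 < y" "y < 1" for y
    proof -
      have "Phi l Q \<omega> y \<le> sup_Phi l Q \<omega>" unfolding sup_Phi_def using that by (intro SUP_upper) simp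
      also have "\<dots> \<le> ennreal s" by (rule s(2))
      also have "\<dots> < ennreal (s + \<delta>)" using s(1) \<delta>(1) by (simp add: ennreal_less_iff)
      finally show ?thesis .
    qed
    then have "F (s + \<delta>) 0 \<le> F (s + \<delta>) m" using s(1) \<delta>(1) m by (intro F_lower_bound_large) auto
    then show "F s 0 \<le> F s m + e"
      using F_linear[of "s + \<delta>" m s] F_linear[of "s + \<delta>" 0 s] \<delta>(2) by (simp add: \<theta>_0)
  qed
  show "ennreal (2 * Psi \<omega> 1) \<le> g_surf l Q \<omega> s"
    unfolding F_0[of s, symmetric]
  proof (rule g_surf_lower_bound[OF s(1)])
    show "ennreal (F s 0) \<le> ennreal (F s m)" if "0 \<le> m" "m < 1" for m
      using F[OF that] by (rule ennreal_leI)
    \<comment> \<open>The bound by \<open>\<sigma> * ennreal s\<close> is the limit of the bounds by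
      \<open>F s m\<close> as \<open>m\<close> tends to 1.\<close>
    then show "ennreal (F s 0) \<le> \<sigma> * ennreal s"
      by (intro tendsto_lowerbound[OF F_tendsto[OF s(1)]] eventually_at_leftI[of 0]) (auto simp: trivial_limit_at_left_real)
  qed
qed

text \<open>The two lower limits are \<open>2 * Psi \<omega> 1\<close> and
  \<open>\<sigma> * ennreal s\<close>, the costs of the two extreme competitors; on the level set of
  \<open>Phi\<close>, \<open>min_scG\<close> and \<open>F\<close> coincide. If the level set is
  empty, its infimum is \<open>top\<close> and drops out of the minimum.\<close>

lemma g_surf_intermediate:
  assumes s: "0 \<le> s"
  shows "g_surf l Q \<omega> s =
          min (INF m\<in>{m\<in>{0<..<1}. Phi l Q \<omega> m = ennreal s}. min_scG l Q \<omega> s m)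
            (min (Liminf (at_right 0) (\<lambda>m. min_scG l Q \<omega> s m))
                 (Liminf (at_left 1) (\<lambda>m. min_scG l Q \<omega> s m)))" (is "_ = ?R")
proof (rule antisym)
  show "g_surf l Q \<omega> s \<le> ?R"
    unfolding Liminf_min_scG_0[OF s] Liminf_min_scG_1[OF s]
  proof (intro min.boundedI INF_greatest g_surf_le_Psi g_surf_le_sigma s)
    fix m assume "m \<in> {m \<in> {0<..<1}. Phi l Q \<omega> m = ennreal s}"
    then have "g_surf l Q \<omega> s \<le> ennreal (F s m)" "ennreal (F s m) \<le> min_scG l Q \<omega> s m"
      using s by (auto intro: g_surf_le_F min_scG_lower_bound)
    then show "g_surf l Q \<omega> s \<le> min_scG l Q \<omega> s m" by (rule order_trans)
  qed
  have R: "?R \<le> \<sigma> * ennreal s" "?R \<le> ennreal (F s 0)"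
    unfolding Liminf_min_scG_0[OF s] Liminf_min_scG_1[OF s] F_0 by (auto simp: min_le_iff_disj)
  show "?R \<le> g_surf l Q \<omega> s"
  proof (rule g_surf_lower_bound[OF s R(1)])
    fix m :: real assume m: "0 \<le> m" "m < 1"
    show "?R \<le> ennreal (F s m)"
    proof (rule F_lower_bound[OF s R(2,1) _ m])
      fix y assume y: "0 < y" "y < 1" "Phi l Q \<omega> y = ennreal s"
      have "?R \<le> (INF m\<in>{m\<in>{0<..<1}. Phi l Q \<omega> m = ennreal s}. min_scG l Q \<omega> s m)" by simp
      also have "\<dots> \<le> min_scG l Q \<omega> s y" using y by (intro INF_lower) auto
      also have "\<dots> \<le> ennreal (F s y)" by (rule min_scG_le_F[OF y(1,2) s y(3)])
      finally show "?R \<le> ennreal (F s y)" .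
    qed
  qed
qed

text \<open>Otherwise the energy would be infinite at a positive \<open>s\<close>, against the
  finite bound \<open>2 * Psi \<omega> 1\<close>.\<close>

lemma sigma_finite_of_inf_Phi:
  assumes "0 < s" "ennreal s \<le> inf_Phi l Q \<omega>"
  shows "\<sigma> < top"
proof (rule ccontr)
  assume "\<not> ?thesis"
  then have "g_surf l Q \<omega> s = top"
    using g_surf_small[of s] assms by (simp add: less_top[symmetric] ennreal_top_mult)
  then show False using g_surf_le_Psi[of s] assms(1) by (simp add: top_unique)
qed

lemma inf_Phi_eq_0:
  assumes "theta l Q \<omega> 1 = top"
  shows "inf_Phi l Q \<omega> = 0"
proof (rule ccontr)
  assume "\<not> ?thesis"
  then have "0 < inf_Phi l Q \<omega>" by (simp add: zero_less_iff_neq_zero)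
  then obtain x where x: "0 < x" "x < inf_Phi l Q \<omega>" using dense by blast
  then obtain s where s: "x = ennreal s" "0 \<le> s" by (cases x) auto
  then have "\<sigma> < top" using x by (intro sigma_finite_of_inf_Phi[of s]) auto
  then show False using assms by (auto simp: theta_1 ennreal_mult_eq_top_iff)
qed

text \<open>Up to the infimum of \<open>Phi\<close> the energy is linear with positive finite slope,
  hence strictly increasing. Since it never exceeds \<open>2 * Psi \<omega> 1\<close>, it stays
  strictly below this value at every \<open>s\<close> under the infimum.\<close>

lemma inf_Phi_le_s_frac: "inf_Phi l Q \<omega> \<le> s_frac l Q \<omega>"
proof (rule dense_le)
  fix x assume x: "x < inf_Phi l Q \<omega>"
  then obtain s where s: "x = ennreal s" "0 \<le> s" by (cases x) auto
  obtain y where y: "x < y" "y < inf_Phi l Q \<omega>" using dense[OF x] by blast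
  then obtain s' where s': "y = ennreal s'" "0 \<le> s'" by (cases y) auto
  have ss: "s < s'" using y(1) s s' by (simp add: ennreal_less_iff)
  have fin: "\<sigma> < top" using y s' ss s by (intro sigma_finite_of_inf_Phi[of s']) auto
  have "g_surf l Q \<omega> s = \<sigma> * ennreal s" using x s by (intro g_surf_small) auto
  also have "\<dots> < \<sigma> * ennreal s'"
    using \<sigma>_pos fin ss s by (intro ennreal_mult_strict_left_mono) (auto simp: ennreal_less_iff)
  also have "\<dots> = g_surf l Q \<omega> s'" using y s' by (intro g_surf_small[symmetric]) auto
  also have "\<dots> \<le> ennreal (2 * Psi \<omega> 1)" by (rule g_surf_le_Psi[OF s'(2)])
  finally show "x \<le> s_frac l Q \<omega>" unfolding s_frac_def s(1) using s(2) by (intro SUP_upper) simp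
qed

lemma s_frac_le_sup_Phi: "s_frac l Q \<omega> \<le> sup_Phi l Q \<omega>"
  unfolding s_frac_def
proof (rule SUP_least)
  fix s assume "s \<in> {s. 0 \<le> s \<and> g_surf l Q \<omega> s < ennreal (2 * Psi \<omega> 1)}"
  then show "ennreal s \<le> sup_Phi l Q \<omega>" using g_surf_large[of s] by (cases "sup_Phi l Q \<omega> \<le> ennreal s") auto
qed

end

theorem proposition2p14:
  fixes l Q \<omega> \<phi> :: "real \<Rightarrow> real"
  assumes "regular_data l Q \<omega> \<phi>"
  shows
    "(\<forall>s\<ge>0. ennreal s \<le> inf_Phi l Q \<omega> \<longrightarrow> g_surf l Q \<omega> s = sigma_bar Q \<omega> * ennreal s) \<and>
     (theta l Q \<omega> 1 = top \<longrightarrow> inf_Phi l Q \<omega> = 0) \<and>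
     (\<forall>s\<ge>0. inf_Phi l Q \<omega> < ennreal s \<and> ennreal s < sup_Phi l Q \<omega> \<longrightarrow>
        g_surf l Q \<omega> s =
          min (INF m\<in>{m\<in>{0<..<1}. Phi l Q \<omega> m = ennreal s}. min_scG l Q \<omega> s m)
            (min (Liminf (at_right 0) (\<lambda>m. min_scG l Q \<omega> s m))
                 (Liminf (at_left 1) (\<lambda>m. min_scG l Q \<omega> s m)))) \<and>
     (\<forall>s\<ge>0. sup_Phi l Q \<omega> \<le> ennreal s \<longrightarrow> g_surf l Q \<omega> s = ennreal (2 * Psi \<omega> 1)) \<and>
     inf_Phi l Q \<omega> \<le> s_frac l Q \<omega> \<and> s_frac l Q \<omega> \<le> sup_Phi l Q \<omega>"
proof -
  interpret regular l Q \<omega> \<phi> by standard (rule assms)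
  show ?thesis
    using g_surf_small inf_Phi_eq_0 g_surf_intermediate g_surf_large inf_Phi_le_s_frac s_frac_le_sup_Phi by blast
qed

end
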